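(* Let $\alpha,\beta\in(0,1)$, $T>0$, $\kappa\ge0$ and let $g:[0,1]\to[0,1]$ be measurable. The weak solutions of the Dirichlet problem (D) and of the Robin problem (R) are unique: if $\rho_1,\rho_2$ are two weak solutions of (D) with the same initial condition $g$, then $\rho_1=\rho_2$ almost everywhere on $[0,T]\times[0,1]$; and if $\rho_1,\rho_2$ are two weak solutions of (R) with the same $\kappa$ and the same initial condition $g$, then $\rho_1=\rho_2$ almost everywhere on $[0,T]\times[0,1]$.
   Context: $\langle\cdot,\cdot\rangle$ is the inner product of $L^2([0,1])$. $\mathcal H^1$ is the set of locally integrable $\zeta:[0,1]\to\mathbb R$ having a weak derivative $\partial_u\zeta\in L^2([0,1])$, with $\|\zeta\|_{\mathcal H^1}^2=\|\zeta\|_{L^2}^2+\|\partial_u\zeta\|_{L^2}^2$. $L^2(0,T;\mathcal H^1)$ is the space of measurable $\xi:[0,T]\to\mathcal H^1$ with $\int_0^T\|\xi_t\|_{\mathcal H^1}^2dt<\infty$. $C^{1,2}([0,T]\times[0,1])$ is the set of functions continuously differentiable once in time and twice in space; $C_0^{1,2}([0,T]\times[0,1])$ is the subset of those $G$ with $G_s(0)=G_s(1)=0$ for all $s\in[0,T]$. Weak solution of (D): $\partial_t\rho_t(u)=\Delta(\rho_t(u))^2$ on $(0,T]\times(0,1)$, $\rho_t(0)=\alpha$, $\rho_t(1)=\beta$ for $t\in(0,T]$, $\rho_0=g$. This is a function $\rho:[0,T]\times[0,1]\to[0,1]$ such that (1) $\rho^2\in L^2(0,T;\mathcal H^1)$;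 (2) for all $t\in[0,T]$ and $G\in C_0^{1,2}([0,T]\times[0,1])$, $$\langle\rho_t,G_t\rangle-\langle g,G_0\rangle-\int_0^t\langle\rho_s,\partial_sG_s+\rho_s\Delta G_s\rangle ds+\int_0^t\{\beta^2\partial_uG_s(1)-\alpha^2\partial_uG_s(0)\}ds=0;$$ (3) $\rho_t(0)=\alpha$ and $\rho_t(1)=\beta$ for all $t\in(0,T]$. Weak solution of (R), for $\kappa\ge0$: $\partial_t\rho_t(u)=\Delta(\rho_t(u))^2$ on $(0,T]\times(0,1)$, $\partial_u(\rho_t(0))^2=\kappa(\rho_t(0)-\alpha)$, $\partial_u(\rho_t(1))^2=\kappa(\beta-\rho_t(1))$ for $t\in(0,T]$, $\rho_0=g$. This is a function $\rho:[0,T]\times[0,1]\to[0,1]$ such that (1) $\rho^2\in L^2(0,T;\mathcal H^1)$; (2) for all $t\in[0,T]$ and $G\in C^{1,2}([0,T]\times[0,1])$, $$\langle\rho_t,G_t\rangle-\langle g,G_0\rangle-\int_0^t\langle\rho_s,\partial_sG_s+\rho_s\Delta G_s\rangle ds+\int_0^t\{(\rho_s(1))^2\partial_uG_s(1)-(\rho_s(0))^2\partial_uG_s(0)\}ds-\kappa\int_0^t\{G_s(0)(\alpha-\rho_s(0))+G_s(1)(\beta-\rho_s(1))\}ds=0.$$ *)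

theory Defs
  imports "HOL-Analysis.Analysis"
begin

section \<open>The spaces $L^2([0,1])$ and $\mathcal H^1$\<close>

text \<open>
  Functions on the intervals $[0,1]$ and $[0,T]$ are represented by total functions on the reals;
  nothing below depends on their values outside these intervals, because all measures are
  restrictions of Lebesgue measure and all derivatives are taken within the intervals.
  Function spaces are sets of functions rather than of classes modulo a.e. equality.
\<close>

definition L2 :: "(real \<Rightarrow> real) set" where
  "L2 = {f. f \<in> borel_measurable (lebesgue_on {0..1}) \<and>
            integrable (lebesgue_on {0..1}) (\<lambda>u. (f u)\<^sup>2)}"

definition L2_inner :: "(real \<Rightarrow> real) \<Rightarrow> (real \<Rightarrow> real) \<Rightarrow> real" where
  "L2_inner f h = (\<integral>u. f u * h u \<partial>lebesgue_on {0..1})"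

definition L2_norm :: "(real \<Rightarrow> real) \<Rightarrow> real" where
  "L2_norm f = sqrt (L2_inner f f)"

text \<open>$C_c^\infty((0,1))$\<close>

definition Cc_infinity :: "(real \<Rightarrow> real) set" where
  "Cc_infinity = {\<phi>. (\<forall>n. (deriv ^^ n) \<phi> differentiable_on UNIV) \<and>
     (\<exists>K. compact K \<and> K \<subseteq> {0<..<1} \<and> (\<forall>u. u \<notin> K \<longrightarrow> \<phi> u = 0))}"

definition has_weak_derivative :: "(real \<Rightarrow> real) \<Rightarrow> (real \<Rightarrow> real) \<Rightarrow> bool" where
  "has_weak_derivative \<zeta> \<eta> \<longleftrightarrow>
     (\<forall>\<phi>\<in>Cc_infinity. L2_inner (deriv \<phi>) \<zeta> = - L2_inner \<phi> \<eta>)"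

text \<open>Since $[0,1]$ is compact, local integrability on it is integrability.\<close>

definition H1 :: "(real \<Rightarrow> real) set" where
  "H1 = {\<zeta>. integrable (lebesgue_on {0..1}) \<zeta> \<and> (\<exists>\<eta>\<in>L2. has_weak_derivative \<zeta> \<eta>)}"

text \<open>The weak derivative is unique only up to a.e. equality; the norm below does not depend on
  the choice.\<close>

definition weak_deriv :: "(real \<Rightarrow> real) \<Rightarrow> real \<Rightarrow> real" where
  "weak_deriv \<zeta> = (SOME \<eta>. \<eta> \<in> L2 \<and> has_weak_derivative \<zeta> \<eta>)"

definition H1_norm :: "(real \<Rightarrow> real) \<Rightarrow> real" where
  "H1_norm \<zeta> = sqrt ((L2_norm \<zeta>)\<^sup>2 + (L2_norm (weak_deriv \<zeta>))\<^sup>2)"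

definition H1_open :: "(real \<Rightarrow> real) set \<Rightarrow> bool" where
  "H1_open U \<longleftrightarrow> U \<subseteq> H1 \<and>
     (\<forall>\<zeta>\<in>U. \<exists>r>0. \<forall>\<eta>\<in>H1. H1_norm (\<lambda>u. \<eta> u - \<zeta> u) < r \<longrightarrow> \<eta> \<in> U)"

definition H1_borel :: "(real \<Rightarrow> real) measure" where
  "H1_borel = sigma H1 {U. H1_open U}"

text \<open>
  $L^2(0,T;\mathcal H^1)$ consists of classes modulo a.e. equality, so \<^term>\<open>\<xi>\<close> only has to agree
  almost everywhere with a measurable map into $\mathcal H^1$ of finite norm. In particular
  the slice at time $0$ need not lie in $\mathcal H^1$.
\<close>

definition L2_H1 :: "real \<Rightarrow> (real \<Rightarrow> real \<Rightarrow> real) set" where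
  "L2_H1 T = {\<xi>. \<exists>\<zeta>. \<zeta> \<in> lebesgue_on {0..T} \<rightarrow>\<^sub>M H1_borel \<and>
     (\<integral>\<^sup>+ t. ennreal ((H1_norm (\<zeta> t))\<^sup>2) \<partial>lebesgue_on {0..T}) < \<infinity> \<and>
     (AE t in lebesgue_on {0..T}. AE u in lebesgue_on {0..1}. \<xi> t u = \<zeta> t u)}"


section \<open>Test functions\<close>

text \<open>Partial derivatives, one-sided at the boundary of $[0,T]\times[0,1]$.\<close>

definition d_time :: "real \<Rightarrow> (real \<Rightarrow> real \<Rightarrow> real) \<Rightarrow> real \<Rightarrow> real \<Rightarrow> real" where
  "d_time T G s u = vector_derivative (\<lambda>r. G r u) (at s within {0..T})"

definition d_space :: "(real \<Rightarrow> real \<Rightarrow> real) \<Rightarrow> real \<Rightarrow> real \<Rightarrow> real" where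
  "d_space G s u = vector_derivative (G s) (at u within {0..1})"

abbreviation laplacian :: "(real \<Rightarrow> real \<Rightarrow> real) \<Rightarrow> real \<Rightarrow> real \<Rightarrow> real" where
  "laplacian G \<equiv> d_space (d_space G)"

definition C12 :: "real \<Rightarrow> (real \<Rightarrow> real \<Rightarrow> real) set" where
  "C12 T = {G.
     (\<forall>s\<in>{0..T}. \<forall>u\<in>{0..1}.
        (\<lambda>r. G r u) differentiable (at s within {0..T}) \<and>
        G s differentiable (at u within {0..1}) \<and>
        d_space G s differentiable (at u within {0..1})) \<and>
     continuous_on ({0..T} \<times> {0..1}) (\<lambda>(s, u). G s u) \<and>
     continuous_on ({0..T} \<times> {0..1}) (\<lambda>(s, u). d_time T G s u) \<and>
     continuous_on ({0..T} \<times> {0..1}) (\<lambda>(s, u). d_space G s u) \<and>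
     continuous_on ({0..T} \<times> {0..1}) (\<lambda>(s, u). laplacian G s u)}"

definition C12_0 :: "real \<Rightarrow> (real \<Rightarrow> real \<Rightarrow> real) set" where
  "C12_0 T = {G \<in> C12 T. \<forall>s\<in>{0..T}. G s 0 = 0 \<and> G s 1 = 0}"


section \<open>Weak solutions\<close>

text \<open>
  Functions $[0,T]\times[0,1]\to[0,1]$ with the measurability that the integrals in the
  weak formulations presuppose. For Lebesgue (as opposed to Borel) measurable functions the
  measurability of every time slice and of the two boundary traces does not follow from joint
  measurability.
\<close>

definition density_profile :: "real \<Rightarrow> (real \<Rightarrow> real \<Rightarrow> real) \<Rightarrow> bool" where
  "density_profile T \<rho> \<longleftrightarrow>
     (\<forall>t\<in>{0..T}. \<forall>u\<in>{0..1}. \<rho> t u \<in> {0..1}) \<and>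
     (\<lambda>(t, u). \<rho> t u) \<in> borel_measurable (lebesgue_on ({0..T} \<times> {0..1})) \<and>
     (\<forall>t\<in>{0..T}. \<rho> t \<in> borel_measurable (lebesgue_on {0..1})) \<and>
     (\<forall>u\<in>{0, 1}. (\<lambda>t. \<rho> t u) \<in> borel_measurable (lebesgue_on {0..T}))"

definition weak_solution_Dirichlet ::
  "real \<Rightarrow> real \<Rightarrow> real \<Rightarrow> (real \<Rightarrow> real) \<Rightarrow> (real \<Rightarrow> real \<Rightarrow> real) \<Rightarrow> bool" where
  "weak_solution_Dirichlet \<alpha> \<beta> T g \<rho> \<longleftrightarrow>
     density_profile T \<rho> \<and>
     (\<lambda>t u. (\<rho> t u)\<^sup>2) \<in> L2_H1 T \<and>
     (\<forall>t\<in>{0..T}. \<forall>G\<in>C12_0 T.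
        L2_inner (\<rho> t) (G t) - L2_inner g (G 0)
        - (\<integral>s. L2_inner (\<rho> s) (\<lambda>u. d_time T G s u + \<rho> s u * laplacian G s u)
             \<partial>lebesgue_on {0..t})
        + (\<integral>s. \<beta>\<^sup>2 * d_space G s 1 - \<alpha>\<^sup>2 * d_space G s 0 \<partial>lebesgue_on {0..t}) = 0) \<and>
     (\<forall>t\<in>{0<..T}. \<rho> t 0 = \<alpha> \<and> \<rho> t 1 = \<beta>)"

definition weak_solution_Robin ::
  "real \<Rightarrow> real \<Rightarrow> real \<Rightarrow> real \<Rightarrow> (real \<Rightarrow> real) \<Rightarrow> (real \<Rightarrow> real \<Rightarrow> real) \<Rightarrow> bool" where
  "weak_solution_Robin \<kappa> \<alpha> \<beta> T g \<rho> \<longleftrightarrow>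
     density_profile T \<rho> \<and>
     (\<lambda>t u. (\<rho> t u)\<^sup>2) \<in> L2_H1 T \<and>
     (\<forall>t\<in>{0..T}. \<forall>G\<in>C12 T.
        L2_inner (\<rho> t) (G t) - L2_inner g (G 0)
        - (\<integral>s. L2_inner (\<rho> s) (\<lambda>u. d_time T G s u + \<rho> s u * laplacian G s u)
             \<partial>lebesgue_on {0..t})
        + (\<integral>s. (\<rho> s 1)\<^sup>2 * d_space G s 1 - (\<rho> s 0)\<^sup>2 * d_space G s 0 \<partial>lebesgue_on {0..t})
        - \<kappa> * (\<integral>s. G s 0 * (\<alpha> - \<rho> s 0) + G s 1 * (\<beta> - \<rho> s 1) \<partial>lebesgue_on {0..t}) = 0)"

end

theory Submission
  imports Defs
begin

text \<open>
  Only the very weak form is used: subtracting the equations of two solutions and testing with a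
  time-independent \<open>G\<close> gives, for \<open>w = \<rho> - \<sigma>\<close> and \<open>v = \<rho>\<^sup>2 - \<sigma>\<^sup>2 = a w\<close>, a formula for the increments
  of \<open>t \<mapsto> \<langle>w\<^sub>t, G\<rangle>\<close>. Uniqueness follows by duality. The dual backward problem
  \<open>\<partial>\<^sub>s G + a \<Delta> G = 0\<close> with terminal value \<open>F\<close> is discretised by the implicit Euler scheme
  \<open>G - \<delta> A \<Delta> G = F\<close>, where \<open>A\<close> is a continuous approximation of \<open>a\<close> at a grid time, shifted by
  \<open>\<epsilon> > 0\<close>, and where in the Robin case the boundary condition is \<open>\<partial>\<^sub>u G = \<plusminus> m G\<close> with a Lipschitz
  approximation \<open>m\<close> of \<open>\<kappa> / a\<close>. Each step is a linear two-point problem that satisfies a maximum principle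
  (which controls the boundary error) and an energy estimate \<open>\<epsilon> \<Sum> \<delta> \<parallel>\<Delta> G\<parallel>\<^sup>2 \<le> C\<close> (which, by Young's
  inequality, controls the interior error \<open>\<langle>v\<^sub>r - A w\<^sub>t, \<Delta> G\<rangle>\<close>). If the grid is translated suitably,
  the values of \<open>v\<close> at the grid times approximate \<open>v\<close> in \<open>L\<^sup>1\<close>, and letting the mesh
  and then \<open>\<epsilon>\<close> tend to \<open>0\<close> shows \<open>\<langle>w\<^sub>t, F\<rangle> = 0\<close>.
\<close>

section \<open>Approximation by continuous functions and Fubini for Lebesgue measurable functions\<close>

text \<open>The obstacle is that \<open>a = \<rho> + \<sigma>\<close> is merely measurable and may
  vanish, so the dual problem is degenerate and may have no regular solution. In Young's inequality
  with weight l, the shift by \<epsilon> costs a multiple of \<epsilon>^2 / l and the energy a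
  multiple of l / \<epsilon>. With l = \<epsilon> * \<eta> these become \<epsilon> / \<eta> and
  \<eta>, so \<eta> is made small before \<epsilon>. This is possible because the energy constant
  involves neither \<epsilon> nor the approximations of \<rho> and \<sigma>; the latter are chosen
  afterwards, as accurate in L^1 as the factor 1 / l demands. The boundary coefficient m does enter
  the energy. It varies in time, so the energy left by one step is not the one with which the next
  step starts; a Lipschitz m makes these mismatches add up to a multiple of T. Freezing the
  coefficients reduces each step to an ordinary differential equation, but brings in the densities
  at single times. For a fixed test function \<open>\<langle>w\<^sub>t, G\<rangle>\<close> is
  Lipschitz in t, yet the densities themselves are not known to be continuous in time; this is why
  the position of the grid matters.\<close>

lemma continuous_Icc_bound:
  fixes f :: "real \<Rightarrow> real"
  assumes "continuous_on {a..b} f"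
  obtains B where "B > 0" "\<And>x. x \<in> {a..b} \<Longrightarrow> \<bar>f x\<bar> \<le> B"
  using compact_imp_bounded[OF compact_continuous_image[OF assms compact_Icc]]
  unfolding bounded_pos by auto

lemma integrable_lebesgue_on_bounded:
  fixes f :: "'a::euclidean_space \<Rightarrow> real"
  assumes "f \<in> borel_measurable (lebesgue_on S)" "S \<in> lmeasurable" "\<And>x. x \<in> S \<Longrightarrow> \<bar>f x\<bar> \<le> B"
  shows "integrable (lebesgue_on S) f"
proof -
  interpret finite_measure "lebesgue_on S" by (rule finite_measure_lebesgue_on) fact
  show ?thesis
    by (rule integrable_const_bound[where B=B]) (use assms in \<open>auto intro!: AE_I2\<close>)
qed

text \<open>Measurability supplies continuous functions converging off a negligible set. Truncating
  them to \<open>{lo..hi}\<close> leaves the limit unchanged and provides the constant dominating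
  function, so convergence in L^1 follows; it also keeps the approximations within the physical
  range.\<close>

lemma continuous_approximation_L1:
  fixes f :: "'a::euclidean_space \<Rightarrow> real"
  assumes f: "f \<in> borel_measurable (lebesgue_on S)" and S: "S \<in> lmeasurable"
    and bd: "\<And>x. x \<in> S \<Longrightarrow> f x \<in> {lo..hi}" and lohi: "lo \<le> hi" and "e > 0"
  obtains g where "continuous_on UNIV g" "\<And>x. g x \<in> {lo..hi}"
    "(\<integral>x. \<bar>f x - g x\<bar> \<partial>lebesgue_on S) < e"
proof -
  have SL: "S \<in> sets lebesgue" using S by auto
  have "f measurable_on S"
    using measurable_on_iff_borel_measurable[OF SL] f by blast
  then obtain N F where N: "negligible N" and F: "\<And>n. continuous_on UNIV (F n)"
    and lim: "\<And>x. x \<notin> N \<Longrightarrow> (\<lambda>n. F n x) \<longlonglongrightarrow> (if x \<in> S then f x else 0)"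
    unfolding measurable_on_def by blast
  define G where "G n x = max lo (min hi (F n x))" for n x
  have G: "continuous_on UNIV (G n)" for n
    unfolding G_def by (intro continuous_intros F)
  have Gb: "G n x \<in> {lo..hi}" for n x using lohi by (auto simp: G_def)
  have Gm: "G n \<in> borel_measurable (lebesgue_on S)" for n
    using continuous_imp_measurable_on_sets_lebesgue[OF continuous_on_subset[OF G subset_UNIV] SL] .
  have Glim: "(\<lambda>n. G n x) \<longlonglongrightarrow> f x" if "x \<in> S" "x \<notin> N" for x
  proof -
    have "(\<lambda>n. G n x) \<longlonglongrightarrow> max lo (min hi (f x))"
      unfolding G_def using lim[OF that(2)] that(1) by (intro tendsto_intros) simp
    then show ?thesis using bd[OF that(1)] by (simp add: max_def min_def split: if_splits)
  qed
  have "(\<lambda>n. \<integral>x. \<bar>f x - G n x\<bar> \<partial>lebesgue_on S) \<longlonglongrightarrow> (\<integral>x. 0 \<partial>lebesgue_on S)"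
  proof (rule integral_dominated_convergence[where w="\<lambda>_. hi - lo"])
    show "integrable (lebesgue_on S) (\<lambda>_. hi - lo)"
      using finite_measure.integrable_const[OF finite_measure_lebesgue_on[OF S]] by blast
    have "N \<inter> S \<in> null_sets (lebesgue_on S)"
      using N SL by (metis negligible_Int inf_le2 negligible_iff_null_sets null_sets_restrict_space)
    then show "AE x in lebesgue_on S. (\<lambda>n. \<bar>f x - G n x\<bar>) \<longlonglongrightarrow> 0"
    proof (rule AE_I')
      show "{x \<in> space (lebesgue_on S). \<not> (\<lambda>n. \<bar>f x - G n x\<bar>) \<longlonglongrightarrow> 0} \<subseteq> N \<inter> S"
      proof (clarsimp, rule ccontr)
        fix x assume x: "x \<in> S" "\<not> (\<lambda>n. \<bar>f x - G n x\<bar>) \<longlonglongrightarrow> 0" "x \<notin> N"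
        have "(\<lambda>n. \<bar>f x - G n x\<bar>) \<longlonglongrightarrow> \<bar>f x - f x\<bar>"
          by (intro tendsto_intros Glim x)
        then show False using x by simp
      qed
    qed
    show "AE x in lebesgue_on S. norm \<bar>f x - G n x\<bar> \<le> hi - lo" for n
    proof (rule AE_I2)
      fix x assume "x \<in> space (lebesgue_on S)"
      then show "norm \<bar>f x - G n x\<bar> \<le> hi - lo" using bd[of x] Gb[of n x] by auto
    qed
  qed (use f Gm in auto)
  then have "(\<lambda>n. \<integral>x. \<bar>f x - G n x\<bar> \<partial>lebesgue_on S) \<longlonglongrightarrow> 0" by simp
  then have "\<forall>\<^sub>F n in sequentially. (\<integral>x. \<bar>f x - G n x\<bar> \<partial>lebesgue_on S) < e"
    using \<open>e > 0\<close> by (rule order_tendstoD)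
  then obtain n where "(\<integral>x. \<bar>f x - G n x\<bar> \<partial>lebesgue_on S) < e"
    by (auto simp: eventually_sequentially)
  then show thesis using G Gb that by blast
qed

text \<open>Lebesgue measure on the plane is the completion of a product, not itself a product of
  completed measures. Fubini is therefore applied to a Borel function \<open>g\<close> that equals
  the extension \<open>F\<close> of \<open>f\<close> by zero almost everywhere, and the result is
  carried back along almost every slice.\<close>

lemma lebesgue_on_Fubini:
  fixes f :: "real \<Rightarrow> real \<Rightarrow> real"
  assumes f: "(\<lambda>(t, u). f t u) \<in> borel_measurable (lebesgue_on ({a..b} \<times> {c..d}))"
    and bd: "\<And>t u. t \<in> {a..b} \<Longrightarrow> u \<in> {c..d} \<Longrightarrow> \<bar>f t u\<bar> \<le> B"
    and slice: "\<And>t. t \<in> {a..b} \<Longrightarrow> f t \<in> borel_measurable (lebesgue_on {c..d})"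
  shows "(\<lambda>t. \<integral>u. f t u \<partial>lebesgue_on {c..d}) \<in> borel_measurable (lebesgue_on {a..b})"
    and "(\<integral>t. (\<integral>u. f t u \<partial>lebesgue_on {c..d}) \<partial>lebesgue_on {a..b})
      = (\<integral>z. f (fst z) (snd z) \<partial>lebesgue_on ({a..b} \<times> {c..d}))"
proof -
  let ?S = "{a..b} \<times> {c..d}"
  have S: "?S = cbox (a, c) (b, d)" by (simp add: cbox_Pair_eq)
  have SL: "?S \<in> lmeasurable" "?S \<in> sets lebesgue" unfolding S by simp_all
  define F where "F z = indicat_real ?S z *\<^sub>R f (fst z) (snd z)" for z
  have f': "(\<lambda>z. f (fst z) (snd z)) \<in> borel_measurable (lebesgue_on ?S)"
    using f by (simp add: case_prod_unfold)
  have int: "integrable (lebesgue_on ?S) (\<lambda>z. f (fst z) (snd z))"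
    by (rule integrable_lebesgue_on_bounded[OF f' SL(1), of B]) (use bd in auto)
  have F_int: "integrable lebesgue F"
    unfolding F_def using int SL(2) by (simp add: integrable_restrict_space)
  obtain g where g: "g \<in> borel_measurable lborel" and Fg: "AE z in lborel. F z = g z"
    using completion_ex_borel_measurable_real[of F lborel] F_int by blast
  have Fg': "AE z in lebesgue. F z = g z" using Fg by (rule AE_completion)
  have "integrable lebesgue g"
    using F_int g Fg' by (subst integrable_cong_AE[where g=F]) (auto simp: measurable_completion)
  then have g_int: "integrable lborel g" using g by (simp add: integrable_completion)
  have gp: "integrable (lborel \<Otimes>\<^sub>M lborel) g" unfolding lborel_prod by (rule g_int)
  have "AE z in lborel \<Otimes>\<^sub>M lborel. F z = g z" unfolding lborel_prod by (rule Fg)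
  then have "AE t in lborel. AE u in lborel. F (t, u) = g (t, u)"
    by (rule lborel_pair.AE_pair)
  then have ae1: "AE t in lebesgue. AE u in lborel. F (t, u) = g (t, u)" by (rule AE_completion)
  define k where "k t = (\<integral>u. g (t, u) \<partial>lborel)" for t
  have k_int: "integrable lborel k" unfolding k_def using lborel_pair.integrable_fst'[OF gp] .
  have k_meas: "k \<in> borel_measurable lebesgue"
    using borel_measurable_integrable[OF k_int] by (rule measurable_completion)
  have slice_eq: "indicat_real {a..b} t *\<^sub>R (\<integral>u. f t u \<partial>lebesgue_on {c..d}) = k t"
    if "AE u in lborel. F (t, u) = g (t, u)" for t
  proof -
    have gt: "(\<lambda>u. g (t, u)) \<in> borel_measurable lborel" using g by simp
    have "k t = (\<integral>u. g (t, u) \<partial>lebesgue)" unfolding k_def using gt by (simp add: integral_completion)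
    also have "\<dots> = (\<integral>u. F (t, u) \<partial>lebesgue)"
    proof (rule integral_cong_AE)
      show "AE u in lebesgue. g (t, u) = F (t, u)"
        using AE_completion[OF that] by eventually_elim simp
      show "(\<lambda>u. F (t, u)) \<in> borel_measurable lebesgue"
      proof (cases "t \<in> {a..b}")
        case True
        have "(\<lambda>u. if u \<in> {c..d} then f t u else 0) \<in> borel_measurable lebesgue"
          using slice[OF True] by (intro borel_measurable_if_I) auto
        moreover have "(\<lambda>u. F (t, u)) = (\<lambda>u. if u \<in> {c..d} then f t u else 0)"
          using True by (auto simp: F_def fun_eq_iff indicator_def)
        ultimately show ?thesis by simp
      qed (auto simp: F_def)
    qed (use gt in \<open>auto intro: measurable_completion\<close>)
    also have "\<dots> = indicat_real {a..b} t *\<^sub>R (\<integral>u. indicat_real {c..d} u *\<^sub>R f t u \<partial>lebesgue)"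
      by (simp add: F_def indicator_times mult.assoc)
    also have "(\<integral>u. indicat_real {c..d} u *\<^sub>R f t u \<partial>lebesgue) = (\<integral>u. f t u \<partial>lebesgue_on {c..d})"
      by (simp add: integral_restrict_space)
    finally show ?thesis ..
  qed
  \<comment> \<open>The slice integrals equal the Borel function \<open>k\<close> only for almost
    every \<open>t\<close>; completeness of Lebesgue measure on the line then makes them
    measurable.\<close>
  have ae2: "AE t in lebesgue. k t = indicat_real {a..b} t *\<^sub>R (\<integral>u. f t u \<partial>lebesgue_on {c..d})"
    using ae1 by eventually_elim (rule slice_eq[symmetric])
  have ind_meas: "(\<lambda>t. indicat_real {a..b} t *\<^sub>R (\<integral>u. f t u \<partial>lebesgue_on {c..d})) \<in> borel_measurable lebesgue"
    using k_meas ae2 by (rule borel_measurable_AE)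
  show meas: "(\<lambda>t. \<integral>u. f t u \<partial>lebesgue_on {c..d}) \<in> borel_measurable (lebesgue_on {a..b})"
    using ind_meas by (simp add: borel_measurable_restrict_space_iff)
  have "(\<integral>t. (\<integral>u. f t u \<partial>lebesgue_on {c..d}) \<partial>lebesgue_on {a..b})
      = (\<integral>t. indicat_real {a..b} t *\<^sub>R (\<integral>u. f t u \<partial>lebesgue_on {c..d}) \<partial>lebesgue)"
    by (simp add: integral_restrict_space)
  also have "\<dots> = (\<integral>t. k t \<partial>lebesgue)"
    using ae2 by (intro integral_cong_AE ind_meas k_meas) auto
  also have "\<dots> = (\<integral>t. k t \<partial>lborel)" using k_int by (simp add: integral_completion)
  also have "\<dots> = (\<integral>z. g z \<partial>lborel)"
    unfolding k_def using lborel_pair.integral_fst'[OF gp] by (simp add: lborel_prod)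
  also have "\<dots> = (\<integral>z. g z \<partial>lebesgue)" using g by (simp add: integral_completion)
  also have "\<dots> = (\<integral>z. F z \<partial>lebesgue)"
    using Fg' F_int g by (intro integral_cong_AE) (auto simp: measurable_completion)
  also have "\<dots> = (\<integral>z. f (fst z) (snd z) \<partial>lebesgue_on ?S)"
    unfolding F_def using SL(2) by (simp add: integral_restrict_space)
  finally show "(\<integral>t. (\<integral>u. f t u \<partial>lebesgue_on {c..d}) \<partial>lebesgue_on {a..b})
      = (\<integral>z. f (fst z) (snd z) \<partial>lebesgue_on ?S)" .
qed


section \<open>The elliptic two-point boundary value problem\<close>

text \<open>Class C^2 on the closed interval, one-sided at the endpoints. The derivatives are
  arguments, so that the differential equation can deliver all three functions at once and no
  derivative has to be chosen.\<close>

definition two_derivs :: "(real \<Rightarrow> real) \<Rightarrow> (real \<Rightarrow> real) \<Rightarrow> (real \<Rightarrow> real) \<Rightarrow> bool" where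
  "two_derivs G G1 G2 \<longleftrightarrow> continuous_on {0..1} G2 \<and>
     (\<forall>u\<in>{0..1}. (G has_real_derivative G1 u) (at u within {0..1}) \<and>
                 (G1 has_real_derivative G2 u) (at u within {0..1}))"

lemma two_derivs_continuous:
  assumes "two_derivs G G1 G2"
  shows "continuous_on {0..1} G" "continuous_on {0..1} G1" "continuous_on {0..1} G2"
  using assms DERIV_continuous_on[of "{0..1}" G G1] DERIV_continuous_on[of "{0..1}" G1 G2]
  unfolding two_derivs_def by auto

lemma two_derivs_lincomb:
  assumes "two_derivs G G1 G2" "two_derivs K K1 K2"
  shows "two_derivs (\<lambda>u. G u + c * K u) (\<lambda>u. G1 u + c * K1 u) (\<lambda>u. G2 u + c * K2 u)"
  using assms unfolding two_derivs_def by (auto intro!: continuous_intros derivative_eq_intros)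

text \<open>Each integration gains a factor \<open>1 / l\<close> against the weight
  \<open>exp (l * x)\<close>. A second order equation is integrated twice, which gives the factor
  \<open>1 / l^2\<close> in the contraction constant below.\<close>

lemma exp_integral_bound:
  fixes f :: "real \<Rightarrow> real"
  assumes "continuous_on {0..s} f" "l > 0" "s \<ge> 0" "K \<ge> 0"
    and "\<And>x. x \<in> {0..s} \<Longrightarrow> \<bar>f x\<bar> \<le> K * exp (l * x)"
  shows "\<bar>integral {0..s} f\<bar> \<le> K / l * exp (l * s)"
proof -
  have "((\<lambda>x. K * exp (l * x)) has_integral (K / l * exp (l * s) - K / l * exp (l * 0))) {0..s}"
  proof (rule fundamental_theorem_of_calculus)
    fix x
    have "((\<lambda>x. K / l * exp (l * x)) has_real_derivative K * exp (l * x)) (at x within {0..s})"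
      using \<open>l > 0\<close> by (auto intro!: derivative_eq_intros)
    then show "((\<lambda>x. K / l * exp (l * x)) has_vector_derivative K * exp (l * x)) (at x within {0..s})"
      by (simp add: has_real_derivative_iff_has_vector_derivative)
  qed fact
  note exp_int = this
  have "norm (integral {0..s} f) \<le> integral {0..s} (\<lambda>x. K * exp (l * x))"
    using assms exp_int by (intro integral_norm_bound_integral) (auto intro: integrable_continuous_real)
  with exp_int have "norm (integral {0..s} f) \<le> K / l * exp (l * s) - K / l"
    unfolding integral_unique[OF exp_int] by simp
  moreover have "K / l \<ge> 0" using assms by simp
  ultimately show ?thesis unfolding real_norm_def by linarith
qed

text \<open>The integral equation is a contraction in the weighted supremum norm
  $\sup_u e^{-\lambda u} |y(u)|$ for large $\lambda$.\<close>

lemma linear_ivp_exists: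
  fixes q p :: "real \<Rightarrow> real"
  assumes q: "continuous_on {0..1} q" and p: "continuous_on {0..1} p"
  obtains y y1 where "two_derivs y y1 (\<lambda>u. q u * y u + p u)" "y 0 = a" "y1 0 = b"
proof -
  obtain Q where Q: "Q > 0" "\<And>x. x \<in> {0..1} \<Longrightarrow> \<bar>q x\<bar> \<le> Q"
    using continuous_Icc_bound[OF q] by metis
  \<comment> \<open>The Lipschitz constant of the integral operator will be \<open>Q / l^2\<close>,
    and \<open>l = Q + 1\<close> makes it smaller than 1.\<close>
  define l where "l = Q + 1"
  have l: "l > 0" using Q by (simp add: l_def)
  \<comment> \<open>The unknown is \<open>z x = exp (- l * x) * y x\<close>: the weighted norm of
    \<open>y\<close> is then the plain supremum norm of \<open>z\<close>.\<close>
  define f where "f z x = q x * (exp (l * x) * z x) + p x" for z x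
  define J where "J z u = integral {0..u} (\<lambda>s. integral {0..s} (f z))" for z u
  define \<Phi> where "\<Phi> z u = exp (- l * u) * (a + b * u + J z u)" for z u
  have cf: "continuous_on {0..1} (f z)" if "continuous_on {0..1} z" for z
    unfolding f_def by (intro continuous_intros q p that)
  have cJ1: "continuous_on {0..1} (\<lambda>s. integral {0..s} (f z))" if "continuous_on {0..1} z" for z
    by (intro indefinite_integral_continuous_1 integrable_continuous_real cf that)
  have cJ: "continuous_on {0..1} (J z)" if "continuous_on {0..1} z" for z
    unfolding J_def by (intro indefinite_integral_continuous_1 integrable_continuous_real cJ1 that)
  have c\<Phi>: "continuous_on {0..1} (\<Phi> z)" if "continuous_on {0..1} z" for z
    unfolding \<Phi>_def by (intro continuous_intros cJ that)
  have cz: "continuous_on S (apply_bcontfun z)" for z :: "real \<Rightarrow>\<^sub>C real" and S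
    by simp
  \<comment> \<open>Extending by the endpoint values outside \<open>{0..1}\<close> turns the
    operator into a self-map of the complete space of bounded continuous functions on the whole
    line.\<close>
  have "\<exists>g. \<forall>x. apply_bcontfun g x = \<Phi> z (clamp 0 1 x)" for z :: "real \<Rightarrow>\<^sub>C real"
  proof -
    have "continuous_on (cbox 0 1) (\<Phi> z)" using c\<Phi>[OF cz] by simp
    then show ?thesis by (rule continuous_on_cbox_bcontfunE) blast
  qed
  note ex = this
  define \<Psi> where "\<Psi> z = (SOME g. \<forall>x. apply_bcontfun g x = \<Phi> (apply_bcontfun z) (clamp 0 1 x))" for z
  have \<Psi>: "apply_bcontfun (\<Psi> z) x = \<Phi> z (clamp 0 1 x)" for z x
    unfolding \<Psi>_def using someI_ex[OF ex[of z]] by blast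
  have contr: "\<bar>\<Phi> z u - \<Phi> z' u\<bar> \<le> Q / l\<^sup>2 * dist z z'" if u: "u \<in> {0..1}" for z z' :: "real \<Rightarrow>\<^sub>C real" and u
  proof -
    define D where "D = dist z z'"
    have D: "\<bar>z x - z' x\<bar> \<le> D" for x using dist_bounded[of z x z'] by (simp add: D_def dist_real_def)
    have D0: "D \<ge> 0" by (simp add: D_def)
    have cf': "continuous_on {0..s} (f z)" and cJ1': "continuous_on {0..s} (\<lambda>s. integral {0..s} (f z))"
      if "s \<in> {0..1}" for s and z :: "real \<Rightarrow>\<^sub>C real"
      using that by (auto intro: continuous_on_subset[OF cf[OF cz]] continuous_on_subset[OF cJ1[OF cz]])
    have in1: "\<bar>integral {0..s} (f z) - integral {0..s} (f z')\<bar> \<le> (Q * D / l) * exp (l * s)"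
      if s: "s \<in> {0..1}" for s
    proof -
      have "integral {0..s} (f z) - integral {0..s} (f z') = integral {0..s} (\<lambda>x. f z x - f z' x)"
        using s by (intro Henstock_Kurzweil_Integration.integral_diff[symmetric]
              integrable_continuous_real cf')
      also have "\<bar>\<dots>\<bar> \<le> (Q * D) / l * exp (l * s)"
      proof (rule exp_integral_bound)
        fix x assume x: "x \<in> {0..s}"
        have "f z x - f z' x = q x * (z x - z' x) * exp (l * x)"
          by (simp add: f_def algebra_simps)
        then have "\<bar>f z x - f z' x\<bar> = \<bar>q x\<bar> * \<bar>z x - z' x\<bar> * exp (l * x)"
          by (simp add: abs_mult)
        also have "\<dots> \<le> Q * D * exp (l * x)"
          using Q D D0 x s by (intro mult_right_mono mult_mono) auto
        finally show "\<bar>f z x - f z' x\<bar> \<le> Q * D * exp (l * x)" .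
      qed (use s l Q D0 in \<open>auto intro!: continuous_intros cf'\<close>)
      finally show ?thesis .
    qed
    have "J z u - J z' u = integral {0..u} (\<lambda>s. integral {0..s} (f z) - integral {0..s} (f z'))"
      unfolding J_def using u by (intro Henstock_Kurzweil_Integration.integral_diff[symmetric]
              integrable_continuous_real cJ1')
    also have "\<bar>\<dots>\<bar> \<le> (Q * D / l) / l * exp (l * u)"
      by (rule exp_integral_bound) (use in1 u l Q D0 in \<open>auto intro!: continuous_intros cJ1'\<close>)
    finally have "exp (- l * u) * \<bar>J z u - J z' u\<bar> \<le> exp (- l * u) * ((Q * D / l) / l * exp (l * u))"
      by (intro mult_left_mono) auto
    also have "\<dots> = Q / l\<^sup>2 * D"
      by (simp add: power2_eq_square exp_minus field_simps)
    finally show ?thesis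
      by (simp add: \<Phi>_def D_def abs_mult flip: right_diff_distrib)
  qed
  have "Q < l\<^sup>2" using Q by (simp add: l_def power2_eq_square algebra_simps add_pos_pos)
  then have "\<exists>!z. \<Psi> z = z"
  proof (intro banach_fix_type[where c="Q / l\<^sup>2"])
    show "\<forall>z z'. dist (\<Psi> z) (\<Psi> z') \<le> Q / l\<^sup>2 * dist z z'"
    proof (intro allI dist_bound)
      fix z z' x
      have "clamp 0 1 x \<in> cbox 0 (1::real)" by (rule clamp_in_interval) simp
      then show "dist (apply_bcontfun (\<Psi> z) x) (apply_bcontfun (\<Psi> z') x) \<le> Q / l\<^sup>2 * dist z z'"
        by (simp only: \<Psi> dist_real_def contr cbox_interval)
    qed
  qed (use Q l in auto)
  then obtain z where z: "\<Psi> z = z" by blast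
  have zfix: "z u = \<Phi> z u" if "u \<in> {0..1}" for u
    using \<Psi>[of z u] z that by simp
  define y where "y u = a + b * u + J z u" for u
  define y1 where "y1 u = b + integral {0..u} (f z)" for u
  have yz: "exp (l * u) * z u = y u" if "u \<in> {0..1}" for u
    using zfix[OF that] by (simp add: \<Phi>_def y_def exp_minus)
  have fy: "f z u = q u * y u + p u" if "u \<in> {0..1}" for u
    using yz[OF that] by (simp add: f_def)
  have "two_derivs y y1 (\<lambda>u. q u * y u + p u)"
    unfolding two_derivs_def
  proof (intro conjI ballI)
    show "continuous_on {0..1} (\<lambda>u. q u * y u + p u)"
      unfolding y_def by (intro continuous_intros q p cJ cz)
    fix u :: real assume u: "u \<in> {0..1}"
    show "(y has_real_derivative y1 u) (at u within {0..1})"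
      unfolding y_def y1_def J_def
      by (rule derivative_eq_intros integral_has_real_derivative cJ1 cz u refl | simp)+
    show "(y1 has_real_derivative q u * y u + p u) (at u within {0..1})"
      unfolding y1_def fy[OF u, symmetric]
      by (rule derivative_eq_intros integral_has_real_derivative cf cz u refl | simp)+
  qed
  moreover have "y 0 = a" "y1 0 = b" by (simp_all add: y_def y1_def J_def)
  ultimately show thesis using that by blast
qed

text \<open>This replaces integration by parts: \<open>h\<close> is the boundary term and
  \<open>k\<close> the integrand. A nondecreasing \<open>h\<close> whose end value does not exceed
  its start value is constant. Both uniqueness for the homogeneous two-point problem and the maximum
  principle are obtained in this way, with the boundary condition providing the order of the two end
  values.\<close>

lemma flat_if_nonneg_derivative:
  fixes h k :: "real \<Rightarrow> real"
  assumes h: "\<And>u. u \<in> {0..1} \<Longrightarrow> (h has_real_derivative k u) (at u within {0..1})"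
    and k: "\<And>u. u \<in> {0..1} \<Longrightarrow> k u \<ge> 0" and le: "h 1 \<le> h 0" and u: "u \<in> {0..1}"
  shows "k u = 0"
proof -
  have ch: "continuous_on {0..1} h" by (rule DERIV_continuous_on) (rule h)
  have mono: "h x \<le> h y" if "0 \<le> x" "x \<le> y" "y \<le> 1" for x y
  proof (rule DERIV_nonneg_imp_increasing_open[where f=h and a=x and b=y])
    fix s assume "x < s" "s < y"
    then show "\<exists>d. (h has_real_derivative d) (at s) \<and> d \<ge> 0"
      using h[of s] k[of s] that at_within_Icc_at[of 0 s 1] by (auto intro!: exI[of _ "k s"])
  qed (use that in \<open>auto intro: continuous_on_subset[OF ch]\<close>)
  have const: "h s = h 0" if "s \<in> {0..1}" for s
    using mono[of 0 s] mono[of s 1] le that by auto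
  have "(h has_real_derivative 0) (at u within {0..1})"
    by (rule has_field_derivative_transform_within[OF _ zero_less_one u, where f="\<lambda>_. h 0"])
       (simp, erule const[symmetric])
  then have "(h has_vector_derivative 0) (at u within {0..1})"
    by (simp add: has_real_derivative_iff_has_vector_derivative)
  moreover have "(h has_vector_derivative k u) (at u within {0..1})"
    using h[OF u] by (simp add: has_real_derivative_iff_has_vector_derivative)
  ultimately show ?thesis
    using vector_derivative_within_closed_interval[OF zero_less_one u] by metis
qed

text \<open>The opposite signs at the two ends express one condition: the outward derivative is
  \<open>- m\<close> times the value. For nonnegative \<open>m\<close> this is the sign that suits
  both the maximum principle and the energy.\<close>

definition bdry_cond :: "bool \<Rightarrow> real \<Rightarrow> real \<Rightarrow> (real \<Rightarrow> real) \<Rightarrow> (real \<Rightarrow> real) \<Rightarrow> bool" where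
  "bdry_cond dir m0 m1 G G1 \<longleftrightarrow>
     (if dir then G 0 = 0 \<and> G 1 = 0 else G1 0 = m0 * G 0 \<and> G1 1 = - m1 * G 1)"

text \<open>Shooting from the left end for \<open>G2 = q * (G - F)\<close> with
  \<open>q = 1 / A\<close>: \<open>y\<close> is a particular solution with zero data at 0,
  \<open>z\<close> spans the homogeneous solutions satisfying the left condition, and
  \<open>c\<close> is adjusted to meet the right condition.\<close>

lemma elliptic_bvp_exists:
  fixes A F :: "real \<Rightarrow> real"
  assumes A: "continuous_on {0..1} A" "\<And>u. u \<in> {0..1} \<Longrightarrow> A u > 0"
    and F: "continuous_on {0..1} F" and m: "m0 \<ge> 0" "m1 \<ge> 0"
  obtains G G1 G2 where "two_derivs G G1 G2" "bdry_cond dir m0 m1 G G1"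
    "\<And>u. u \<in> {0..1} \<Longrightarrow> G u - A u * G2 u = F u"
proof -
  define q where "q u = 1 / A u" for u
  have q: "continuous_on {0..1} q" unfolding q_def using A by (intro continuous_intros) force+
  have qpos: "q u > 0" if "u \<in> {0..1}" for u using A that by (simp add: q_def)
  \<comment> \<open>A common form of both conditions: \<open>z\<close> starts with value
    \<open>s\<close> and slope \<open>n0\<close>, and the right condition reads
    \<open>s * G1 1 + n1 * G 1 = 0\<close>. Dirichlet is \<open>(s, n0, n1) = (0, 1, 1)\<close>,
    Robin is \<open>(1, m0, m1)\<close>.\<close>
  define s n0 n1 where "s = (if dir then 0 else 1::real)" and "n0 = (if dir then 1 else m0)"
    and "n1 = (if dir then 1 else m1)"
  have n: "s \<ge> 0" "n0 \<ge> 0" "n1 \<ge> 0" "s = 0 \<Longrightarrow> n1 = 1" "s \<noteq> 0 \<or> n0 \<noteq> 0" "s = 0 \<or> s = 1"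
    using m by (auto simp: s_def n0_def n1_def)
  obtain y y1 where y: "two_derivs y y1 (\<lambda>u. q u * y u + - q u * F u)" "y 0 = 0" "y1 0 = 0"
    by (rule linear_ivp_exists[OF q, of "\<lambda>u. - q u * F u"]) (auto intro!: continuous_intros q F)
  obtain z z1 where z: "two_derivs z z1 (\<lambda>u. q u * z u + 0)" "z 0 = s" "z1 0 = n0"
    by (rule linear_ivp_exists[OF q continuous_on_const])
  define \<Delta> where "\<Delta> = s * z1 1 + n1 * z 1"
  \<comment> \<open>If \<Delta> were zero, \<open>z\<close> would solve the homogeneous problem with
    both boundary conditions. Then \<open>z1 * z\<close> has the nonnegative derivative
    \<open>z1^2 + q * z^2\<close> but does not grow from 0 to 1, so that derivative vanishes; at 0
    this contradicts the nonzero initial data.\<close>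
  have "\<Delta> \<noteq> 0"
  proof
    assume \<Delta>: "\<Delta> = 0"
    have "z1 1 * z 1 \<le> 0"
    proof (cases "s = 0")
      case True then show ?thesis using \<Delta> n by (simp add: \<Delta>_def)
    next
      case False
      then have "z1 1 = - n1 * z 1" using \<Delta> n by (simp add: \<Delta>_def eq_neg_iff_add_eq_0)
      then have "z1 1 * z 1 = - (n1 * (z 1)\<^sup>2)" by (simp add: power2_eq_square)
      then show ?thesis using n by simp
    qed
    then have le: "z1 1 * z 1 \<le> z1 0 * z 0" using z(2,3) mult_nonneg_nonneg[OF n(2,1)] by simp
    have eq: "(z1 u)\<^sup>2 + q u * (z u)\<^sup>2 = 0" if "u \<in> {0..1}" for u
    proof (rule flat_if_nonneg_derivative[OF _ _ le that])
      fix u :: real assume u: "u \<in> {0..1}"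
      show "((\<lambda>u. z1 u * z u) has_real_derivative (z1 u)\<^sup>2 + q u * (z u)\<^sup>2) (at u within {0..1})"
        using z(1) u unfolding two_derivs_def
        by (auto intro!: derivative_eq_intros simp: power2_eq_square algebra_simps)
      show "0 \<le> (z1 u)\<^sup>2 + q u * (z u)\<^sup>2" using qpos[OF u] by simp
    qed
    have "q 0 * s\<^sup>2 \<ge> 0" using qpos[of 0] by simp
    moreover have "n0\<^sup>2 + q 0 * s\<^sup>2 = 0" using eq[of 0] z(2,3) by simp
    ultimately have "n0\<^sup>2 = 0 \<and> q 0 * s\<^sup>2 = 0" by (smt (verit) zero_le_power2)
    then show False using n qpos[of 0] by auto
  qed
  define c where "c = - (s * y1 1 + n1 * y 1) / \<Delta>"
  define G G1 G2 where "G u = y u + c * z u" and "G1 u = y1 u + c * z1 u"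
    and "G2 u = (q u * y u + - q u * F u) + c * (q u * z u + 0)" for u
  have "two_derivs G G1 G2"
    unfolding G_def[abs_def] G1_def[abs_def] G2_def[abs_def] by (rule two_derivs_lincomb[OF y(1) z(1)])
  moreover have "s * G1 1 + n1 * G 1 = 0"
  proof -
    have "s * G1 1 + n1 * G 1 = (s * y1 1 + n1 * y 1) + c * \<Delta>"
      by (simp add: G_def G1_def \<Delta>_def algebra_simps)
    then show ?thesis using \<open>\<Delta> \<noteq> 0\<close> by (simp add: c_def)
  qed
  then have "bdry_cond dir m0 m1 G G1"
    using y z by (auto simp: bdry_cond_def s_def n0_def n1_def G_def G1_def split: if_splits)
  moreover have "G u - A u * G2 u = F u" if "u \<in> {0..1}" for u
    using A(2)[OF that] by (simp add: G_def G2_def q_def field_simps)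
  ultimately show thesis using that by blast
qed

section \<open>Maximum principle for the two-point problem\<close>

lemma DERIV_pos_part_square:
  "((\<lambda>x::real. (max 0 x)\<^sup>2) has_real_derivative 2 * max 0 x) (at x)"
proof -
  consider "x < 0" | "x = 0" | "x > 0" by linarith
  then show ?thesis
  proof cases
    case 1
    have "((\<lambda>_. 0) has_real_derivative 0) (at x)" by simp
    then show ?thesis using 1
      by (subst DERIV_cong_ev[OF refl _ refl, where g="\<lambda>_. 0"])
         (auto intro: eventually_mono[OF order_tendstoD(2)[OF tendsto_ident_at 1]]
           eventually_mono[OF eventually_nhds_in_open[of "{..<0}" x]])
  next
    case 3
    have "((\<lambda>x. x\<^sup>2) has_real_derivative 2 * x) (at x)" by (auto intro!: derivative_eq_intros)
    then show ?thesis using 3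
      by (subst DERIV_cong_ev[OF refl _ refl, where g="\<lambda>x. x\<^sup>2"])
         (auto intro: eventually_mono[OF eventually_nhds_in_open[of "{0<..}" x]])
  next
    case 2
    have "(\<lambda>h::real. max 0 h * (max 0 h / h)) \<midarrow>0\<rightarrow> 0"
    proof (rule Lim_null_comparison)
      show "\<forall>\<^sub>F h in at (0::real). norm (max 0 h * (max 0 h / h)) \<le> \<bar>h\<bar>"
        by (auto intro!: always_eventually simp: max_def)
      show "(\<lambda>h::real. \<bar>h\<bar>) \<midarrow>0\<rightarrow> 0" by (auto intro!: tendsto_eq_intros)
    qed
    then show ?thesis using 2 by (simp add: DERIV_def power2_eq_square)
  qed
qed

text \<open>Test with \<phi>, the square of the positive part of \<open>G - M\<close>; squaring
  removes the kink, so \<phi> is differentiable. Where \<open>G > M\<close> the equation forces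
  \<open>A * G2 = G - F > 0\<close>, hence \<open>G1 * \<phi>\<close> has a nonnegative derivative.
  At the ends, \<open>G > M >= 0\<close> contradicts the Dirichlet condition, and under the Robin
  condition it gives \<open>G1\<close> the sign that prevents growth from 0 to 1. So the derivative
  vanishes, which is impossible at a point where \<open>G > M\<close>.\<close>

lemma elliptic_upper_bound:
  assumes G: "two_derivs G G1 G2" and bc: "bdry_cond dir m0 m1 G G1" and m: "m0 \<ge> 0" "m1 \<ge> 0"
    and A: "\<And>u. u \<in> {0..1} \<Longrightarrow> A u > 0"
    and eq: "\<And>u. u \<in> {0..1} \<Longrightarrow> G u - A u * G2 u = F u"
    and F: "\<And>u. u \<in> {0..1} \<Longrightarrow> F u \<le> M" and M: "M \<ge> 0" and u: "u \<in> {0..1}"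
  shows "G u \<le> M"
proof (rule ccontr)
  assume "\<not> G u \<le> M"
  then have Gu: "G u > M" by simp
  define \<phi> where "\<phi> v = (max 0 (G v - M))\<^sup>2" for v
  define k where "k v = 2 * max 0 (G v - M) * (G1 v)\<^sup>2 + \<phi> v * G2 v" for v
  have d\<phi>: "(\<phi> has_real_derivative 2 * max 0 (G v - M) * G1 v) (at v within {0..1})" if "v \<in> {0..1}" for v
    unfolding \<phi>_def
    by (rule DERIV_chain'[where f="\<lambda>v. G v - M", OF _ DERIV_pos_part_square, THEN DERIV_cong])
       (use G that in \<open>auto simp: two_derivs_def intro!: derivative_eq_intros\<close>)
  have G2: "G2 v > 0" if "v \<in> {0..1}" "G v > M" for v
  proof -
    have "A v * G2 v > 0" using eq[OF that(1)] F[OF that(1)] that(2) by linarith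
    then show ?thesis using A[OF that(1)] by (simp add: zero_less_mult_iff)
  qed
  have nn: "\<phi> v * G2 v \<ge> 0" if "v \<in> {0..1}" for v
    using G2[OF that] by (cases "G v > M") (auto simp: \<phi>_def max_def)
  have b1: "G1 1 * \<phi> 1 \<le> 0"
  proof (cases "G 1 > M")
    case True
    then have "G1 1 \<le> 0" using bc M m by (auto simp: bdry_cond_def split: if_splits)
    then show ?thesis by (simp add: \<phi>_def mult_nonpos_nonneg)
  qed (auto simp: \<phi>_def max_def)
  have b0: "G1 0 * \<phi> 0 \<ge> 0"
  proof (cases "G 0 > M")
    case True
    then have "G1 0 \<ge> 0" using bc M m by (auto simp: bdry_cond_def split: if_splits)
    then show ?thesis by (simp add: \<phi>_def)
  qed (auto simp: \<phi>_def max_def)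
  have "k u = 0"
  proof (rule flat_if_nonneg_derivative[where h="\<lambda>v. G1 v * \<phi> v" and k=k and u=u])
    fix v :: real assume v: "v \<in> {0..1}"
    have "((\<lambda>v. G1 v * \<phi> v) has_real_derivative G1 v * (2 * max 0 (G v - M) * G1 v) + G2 v * \<phi> v) (at v within {0..1})"
      by (intro DERIV_mult' d\<phi> v) (use G v in \<open>auto simp: two_derivs_def\<close>)
    then show "((\<lambda>v. G1 v * \<phi> v) has_real_derivative k v) (at v within {0..1})"
      by (simp add: k_def power2_eq_square algebra_simps)
    show "k v \<ge> 0" using nn[OF v] by (simp add: k_def)
  qed (use b0 b1 u in auto)
  moreover have "2 * max 0 (G u - M) * (G1 u)\<^sup>2 \<ge> 0" by simp
  moreover have "\<phi> u * G2 u > 0" using Gu G2[OF u] by (simp add: \<phi>_def)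
  ultimately show False by (simp add: k_def)
qed

lemma elliptic_max_principle:
  assumes G: "two_derivs G G1 G2" and bc: "bdry_cond dir m0 m1 G G1" and m: "m0 \<ge> 0" "m1 \<ge> 0"
    and A: "\<And>u. u \<in> {0..1} \<Longrightarrow> A u > 0"
    and eq: "\<And>u. u \<in> {0..1} \<Longrightarrow> G u - A u * G2 u = F u"
    and F: "\<And>u. u \<in> {0..1} \<Longrightarrow> \<bar>F u\<bar> \<le> M" and u: "u \<in> {0..1}"
  shows "\<bar>G u\<bar> \<le> M"
proof -
  have M: "M \<ge> 0" using F[OF u] by linarith
  have "G u \<le> M"
    by (rule elliptic_upper_bound[OF G bc m A eq _ M u]) (use F in force)+
  moreover have "- G u \<le> M"
  proof (rule elliptic_upper_bound[where G="\<lambda>u. - G u" and ?G1.0="\<lambda>u. - G1 u" and ?G2.0="\<lambda>u. - G2 u"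
        and F="\<lambda>u. - F u", OF _ _ m A _ _ M u])
    show "two_derivs (\<lambda>u. - G u) (\<lambda>u. - G1 u) (\<lambda>u. - G2 u)"
      using G by (auto simp: two_derivs_def intro!: continuous_intros derivative_eq_intros)
    show "bdry_cond dir m0 m1 (\<lambda>u. - G u) (\<lambda>u. - G1 u)"
      using bc by (auto simp: bdry_cond_def split: if_splits)
    show "- G v - A v * - G2 v = - F v" if "v \<in> {0..1}" for v using eq[OF that] by simp
    show "- F v \<le> M" if "v \<in> {0..1}" for v using F[OF that] by linarith
  qed
  ultimately show ?thesis by linarith
qed

text \<open>Half the quadratic form of the negative second derivative under the Robin condition. In
  the Dirichlet case the boundary terms vanish with the test functions.\<close>

definition bdry_energy :: "real \<Rightarrow> real \<Rightarrow> (real \<Rightarrow> real) \<Rightarrow> (real \<Rightarrow> real) \<Rightarrow> real" where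
  "bdry_energy m0 m1 G G1 =
     ((\<integral>u. (G1 u)\<^sup>2 \<partial>lebesgue_on {0..1}) + m0 * (G 0)\<^sup>2 + m1 * (G 1)\<^sup>2) / 2"

text \<open>Multiplying the equation by \<open>G2\<close> gives
  \<open>A * G2^2 = (G - F) * G2\<close>, and integration by parts moves one derivative to
  \<open>G - F\<close>. The convexity inequality \<open>x * (x - y) >= (x^2 - y^2) / 2\<close> then
  turns both the interior and the Robin boundary terms into a decrease of energy from
  \<open>F\<close> to \<open>G\<close>, a form that telescopes over successive steps.\<close>

lemma elliptic_energy_estimate:
  assumes G: "two_derivs G G1 G2" and bc: "bdry_cond dir m0 m1 G G1" and m: "m0 \<ge> 0" "m1 \<ge> 0"
    and A: "continuous_on {0..1} A"
    and eq: "\<And>u. u \<in> {0..1} \<Longrightarrow> G u - A u * G2 u = F u"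
    and F: "two_derivs F F1 F2" and F0: "dir \<Longrightarrow> F 0 = 0 \<and> F 1 = 0"
  shows "(\<integral>u. A u * (G2 u)\<^sup>2 \<partial>lebesgue_on {0..1}) \<le> bdry_energy m0 m1 F F1 - bdry_energy m0 m1 G G1"
proof -
  note cont = two_derivs_continuous[OF G] two_derivs_continuous[OF F] A
  let ?L = "lebesgue_on {0..1::real}"
  define r where "r u = (G1 u - F1 u) * G1 u + A u * (G2 u)\<^sup>2" for u
  have "(r has_integral ((G 1 - F 1) * G1 1 - (G 0 - F 0) * G1 0)) {0..1}"
  proof (rule fundamental_theorem_of_calculus)
    fix u :: real assume u: "u \<in> {0..1}"
    have "((\<lambda>u. (G u - F u) * G1 u) has_real_derivative (G u - F u) * G2 u + (G1 u - F1 u) * G1 u) (at u within {0..1})"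
      using G F u unfolding two_derivs_def by (auto intro!: derivative_eq_intros)
    moreover have "(G u - F u) * G2 u + (G1 u - F1 u) * G1 u = r u"
      using eq[OF u, symmetric] by (simp add: r_def power2_eq_square)
    ultimately show "((\<lambda>u. (G u - F u) * G1 u) has_vector_derivative r u) (at u within {0..1})"
      by (simp add: has_real_derivative_iff_has_vector_derivative)
  qed simp
  moreover have r_int: "integrable ?L r"
    unfolding r_def by (intro continuous_imp_integrable_real continuous_intros cont)
  ultimately have ir: "integral\<^sup>L ?L r = (G 1 - F 1) * G1 1 - (G 0 - F 0) * G1 0"
    by (simp add: lebesgue_integral_eq_integral integral_unique)
  have ints: "integrable ?L (\<lambda>u. (F1 u)\<^sup>2)" "integrable ?L (\<lambda>u. (G1 u)\<^sup>2)" "integrable ?L (\<lambda>u. A u * (G2 u)\<^sup>2)"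
    by (intro continuous_imp_integrable_real continuous_intros cont)+
  have "(\<integral>u. A u * (G2 u)\<^sup>2 \<partial>?L) \<le> (\<integral>u. r u + (F1 u)\<^sup>2 / 2 - (G1 u)\<^sup>2 / 2 \<partial>?L)"
  proof (rule integral_mono)
    fix u
    have "0 \<le> (G1 u - F1 u)\<^sup>2" by simp
    then show "A u * (G2 u)\<^sup>2 \<le> r u + (F1 u)\<^sup>2 / 2 - (G1 u)\<^sup>2 / 2"
      by (simp add: r_def power2_eq_square algebra_simps)
  qed (use ints r_int in auto)
  also have "\<dots> = integral\<^sup>L ?L r + (\<integral>u. (F1 u)\<^sup>2 \<partial>?L) / 2 - (\<integral>u. (G1 u)\<^sup>2 \<partial>?L) / 2"
    using ints r_int by simp
  finally have main: "(\<integral>u. A u * (G2 u)\<^sup>2 \<partial>?L) \<le> (G 1 - F 1) * G1 1 - (G 0 - F 0) * G1 0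
      + (\<integral>u. (F1 u)\<^sup>2 \<partial>?L) / 2 - (\<integral>u. (G1 u)\<^sup>2 \<partial>?L) / 2" by (simp add: ir)
  have sq: "x * (x - y) \<ge> (x\<^sup>2 - y\<^sup>2) / 2" for x y :: real
    using zero_le_power2[of "x - y"] by (simp add: power2_eq_square field_simps)
  have "(G 1 - F 1) * G1 1 \<le> m1 * (((F 1)\<^sup>2 - (G 1)\<^sup>2) / 2)"
  proof (cases dir)
    case False
    then have "(G 1 - F 1) * G1 1 = - (m1 * (G 1 * (G 1 - F 1)))" using bc by (simp add: bdry_cond_def)
    also have "\<dots> \<le> - (m1 * (((G 1)\<^sup>2 - (F 1)\<^sup>2) / 2))"
      using mult_left_mono[OF sq m(2)] by simp
    finally show ?thesis by (simp add: algebra_simps diff_divide_distrib)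
  qed (use bc F0 in \<open>simp add: bdry_cond_def\<close>)
  moreover have "- ((G 0 - F 0) * G1 0) \<le> m0 * (((F 0)\<^sup>2 - (G 0)\<^sup>2) / 2)"
  proof (cases dir)
    case False
    then have "- ((G 0 - F 0) * G1 0) = - (m0 * (G 0 * (G 0 - F 0)))" using bc by (simp add: bdry_cond_def)
    also have "\<dots> \<le> - (m0 * (((G 0)\<^sup>2 - (F 0)\<^sup>2) / 2))"
      using mult_left_mono[OF sq m(1)] by simp
    finally show ?thesis by (simp add: algebra_simps diff_divide_distrib)
  qed (use bc F0 in \<open>simp add: bdry_cond_def\<close>)
  ultimately have "(\<integral>u. A u * (G2 u)\<^sup>2 \<partial>?L) \<le> m1 * (((F 1)\<^sup>2 - (G 1)\<^sup>2) / 2) + m0 * (((F 0)\<^sup>2 - (G 0)\<^sup>2) / 2)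
      + (\<integral>u. (F1 u)\<^sup>2 \<partial>?L) / 2 - (\<integral>u. (G1 u)\<^sup>2 \<partial>?L) / 2" using main by linarith
  then show ?thesis by (simp add: bdry_energy_def field_simps)
qed


section \<open>Choice of the grid and of the dual boundary condition\<close>

text \<open>The average over \<open>x\<close> of the left-hand side is the integral.\<close>

lemma sampling_grid_exists:
  fixes p :: "real \<Rightarrow> real"
  assumes p: "p integrable_on {0..real n * h}" and h: "h > 0" and e: "e > 0"
  obtains x where "0 < x" "x \<le> h"
    "h * (\<Sum>i<n. p (x + real i * h)) \<le> integral {0..real n * h} p + e"
proof (rule ccontr)
  let ?S = "\<lambda>x. \<Sum>i<n. p (x + real i * h)"
  \<comment> \<open>If every translation failed, the sum would be at least \<open>c\<close> on all
    of \<open>(0, h]\<close>, although \<open>c * h\<close> exceeds its integral by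
    \<open>e\<close>.\<close>
  define c where "c = (integral {0..real n * h} p + e) / h"
  note grid = that
  assume neg: "\<not> thesis"
  have ge: "c \<le> ?S x" if x: "0 < x" "x \<le> h" for x
  proof (rule ccontr)
    assume "\<not> c \<le> ?S x"
    then have "h * ?S x \<le> integral {0..real n * h} p + e"
      using h by (simp add: c_def field_simps)
    with grid[OF x] neg show False by blast
  qed
  have "((\<lambda>x. \<Sum>i<k. p (x + real i * h)) has_integral integral {0..real k * h} p) {0..h}" if "k \<le> n" for k
    using that
  proof (induction k)
    case (Suc k)
    have pI: "p integrable_on {0..real (Suc k) * h}"
      by (rule integrable_on_subinterval[OF p]) (use Suc.prems h in \<open>auto intro!: mult_right_mono\<close>)
    have "p integrable_on {0 + real k * h..h + real k * h}"
      by (rule integrable_on_subinterval[OF pI]) (use h in \<open>auto simp: algebra_simps\<close>)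
    then have "((\<lambda>x. p (x + real k * h)) has_integral integral {0 + real k * h..h + real k * h} p) {0..h}"
      using has_integral_shift_Icc_real[of p "real k * h" _ 0 h]
      by (simp add: o_def add.commute has_integral_integral)
    moreover have comb: "integral {0..real k * h} p + integral {real k * h..real (Suc k) * h} p
        = integral {0..real (Suc k) * h} p"
      by (rule Henstock_Kurzweil_Integration.integral_combine) (use pI h in \<open>auto simp: algebra_simps\<close>)
    moreover have "((\<lambda>x. \<Sum>i<k. p (x + real i * h)) has_integral integral {0..real k * h} p) {0..h}"
      using Suc by simp
    ultimately have "((\<lambda>x. (\<Sum>i<k. p (x + real i * h)) + p (x + real k * h)) has_integral
        integral {0..real k * h} p + integral {0 + real k * h..h + real k * h} p) {0..h}"
      by (intro has_integral_add)
    moreover have "0 + real k * h = real k * h" "h + real k * h = real (Suc k) * h"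
      by (simp_all add: algebra_simps)
    ultimately show ?case unfolding sum.lessThan_Suc using comb by metis
  qed simp
  then have "(?S has_integral integral {0..real n * h} p) {0..h}" by blast
  \<comment> \<open>The lower bound is available for positive translations only; altering the
    integrand at the single point 0 preserves the integral.\<close>
  then have "((\<lambda>x. if x = 0 then c else ?S x) has_integral integral {0..real n * h} p) {0..h}"
    by (rule has_integral_spike_finite[rotated 2, where S="{0}"]) auto
  note S = this
  have "((\<lambda>x. c) has_integral c * h) {0..h}"
    using has_integral_const_real[of c 0 h] h by (simp add: mult.commute)
  then have "c * h \<le> integral {0..real n * h} p"
    by (rule has_integral_le[OF _ S]) (use ge in auto)
  then show False using h e by (simp add: c_def)
qed

text \<open>Approximates \<open>\<kappa> / a\<close> where \<open>a\<close> is not small; where it is small, \<open>w\<close> is small as well.\<close>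

lemma smooth_rate_exists:
  fixes a w :: "real \<Rightarrow> real"
  assumes "a \<in> borel_measurable (lebesgue_on {0..T})" "w \<in> borel_measurable (lebesgue_on {0..T})"
    and bd: "\<And>t. t \<in> {0..T} \<Longrightarrow> \<bar>w t\<bar> \<le> a t" "\<And>t. t \<in> {0..T} \<Longrightarrow> a t \<le> 2"
    and T: "T > 0" and \<kappa>: "\<kappa> \<ge> 0" and e: "e > 0"
  obtains m L where "\<And>t. t \<in> {0..T} \<Longrightarrow> 0 \<le> m t" "L \<ge> 0"
    "\<And>s t. s \<in> {0..T} \<Longrightarrow> t \<in> {0..T} \<Longrightarrow> \<bar>m s - m t\<bar> \<le> L * \<bar>s - t\<bar>"
    "m \<in> borel_measurable (lebesgue_on {0..T})"
    "(\<integral>t. \<bar>w t * (\<kappa> - a t * m t)\<bar> \<partial>lebesgue_on {0..T}) \<le> e"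
proof -
  let ?M = "lebesgue_on {0..T}"
  \<comment> \<open>The cutoff is chosen so that \<open>T * \<kappa> * \<eta>\<close> is at most
    \<open>e / 3\<close>; the summand 1 covers the case of vanishing \<kappa>.\<close>
  define \<eta> where "\<eta> = e / (3 * (\<kappa> * T + 1))"
  have \<eta>: "\<eta> > 0" using e T \<kappa> by (simp add: \<eta>_def add_nonneg_pos)
  \<comment> \<open>Where \<open>a >= \<eta>\<close> this is the exact quotient and the error is
    zero. Elsewhere \<open>\<kappa> - a * r\<close> lies between 0 and \<kappa>, while
    \<open>w\<close> is bounded by \<open>a < \<eta>\<close>.\<close>
  define r where "r t = \<kappa> / max (a t) \<eta>" for t
  have r_meas: "r \<in> borel_measurable ?M" unfolding r_def using assms(1) by simp
  have r_bd: "r t \<in> {0..\<kappa> / \<eta>}" for t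
    using \<eta> \<kappa> by (auto simp: r_def intro!: divide_left_mono mult_pos_pos divide_nonneg_nonneg)
  have r_err: "\<bar>w t * (\<kappa> - a t * r t)\<bar> \<le> \<kappa> * \<eta>" if t: "t \<in> {0..T}" for t
  proof (cases "a t \<ge> \<eta>")
    case True
    then show ?thesis using \<eta> \<kappa> by (simp add: r_def)
  next
    case False
    have a0: "0 \<le> a t" using bd(1)[OF t] by linarith
    have "\<kappa> - a t * r t = \<kappa> * (1 - a t / \<eta>)" using False \<eta> by (simp add: r_def field_simps)
    moreover have "0 \<le> 1 - a t / \<eta>" "1 - a t / \<eta> \<le> 1" using False a0 \<eta> by (auto simp: field_simps)
    ultimately have "0 \<le> \<kappa> - a t * r t" "\<kappa> - a t * r t \<le> \<kappa>" using \<kappa> by (auto intro: mult_left_le)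
    then have "\<bar>w t\<bar> * \<bar>\<kappa> - a t * r t\<bar> \<le> \<eta> * \<kappa>"
      using bd(1)[OF t] False \<eta> by (intro mult_mono) auto
    then show ?thesis by (simp add: abs_mult mult.commute)
  qed
  obtain g where g: "continuous_on UNIV g" "\<And>x. g x \<in> {0..\<kappa> / \<eta>}" "(\<integral>t. \<bar>r t - g t\<bar> \<partial>?M) < e / 12"
    by (rule continuous_approximation_L1[OF r_meas lmeasurable_interval(1), of 0 "\<kappa> / \<eta>" "e / 12"])
       (use r_bd \<eta> \<kappa> e in auto)
  \<comment> \<open>A continuous function need not be Lipschitz, so \<open>g\<close> is replaced by
    a polynomial. Since the product of \<open>w\<close> and \<open>a\<close> is at most 4 in
    absolute value, a deviation of \<open>2 * e'\<close> costs \<open>8 * e' * T = e / 3\<close>,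
    and the L^1 error \<open>e / 12\<close> of \<open>g\<close> costs another third.\<close>
  define e' where "e' = e / (24 * T)"
  have e': "e' > 0" using e T by (simp add: e'_def)
  obtain p where p: "real_polynomial_function p" "\<And>t. t \<in> {0..T} \<Longrightarrow> \<bar>g t - p t\<bar> < e'"
    using Stone_Weierstrass_real_polynomial_function[of "{0..T}" g e'] g(1) e'
    by (auto intro: continuous_on_subset)
  obtain p' where p': "real_polynomial_function p'" "\<And>x. (p has_real_derivative p' x) (at x)"
    using has_real_derivative_polynomial_function[OF p(1)] by blast
  have cp: "continuous_on S p" "continuous_on S p'" for S
    using p(1) p'(1) by (auto intro: continuous_on_polymonial_function simp: real_polynomial_function_eq)
  obtain L where L: "L > 0" "\<And>x. x \<in> {0..T} \<Longrightarrow> \<bar>p' x\<bar> \<le> L"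
    using continuous_Icc_bound[OF cp(2)[of "{0..T}"]] by blast
  \<comment> \<open>Since \<open>g >= 0\<close> and \<open>p\<close> stays within \<open>e'\<close>
    of \<open>g\<close>, raising the polynomial by \<open>e'\<close> makes it nonnegative.\<close>
  define m where "m t = p t + e'" for t
  have m_meas: "m \<in> borel_measurable ?M" unfolding m_def
    by (intro continuous_imp_measurable_on_sets_lebesgue continuous_intros cp) auto
  show thesis
  proof (rule that[of m L])
    show "0 \<le> m t" if "t \<in> {0..T}" for t using p(2)[OF that] g(2)[of t] by (auto simp: m_def)
    show "\<bar>m s - m t\<bar> \<le> L * \<bar>s - t\<bar>" if "s \<in> {0..T}" "t \<in> {0..T}" for s t
      using field_differentiable_bound[of "{0..T}" p p' L s t] that L p'(2)
      by (auto simp: m_def intro: has_field_derivative_at_within)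
    have gm: "g \<in> borel_measurable ?M"
      by (intro continuous_imp_measurable_on_sets_lebesgue continuous_on_subset[OF g(1)]) auto
    have int: "integrable ?M (\<lambda>t. \<bar>r t - g t\<bar>)"
    proof (rule integrable_lebesgue_on_bounded[where B="\<kappa> / \<eta>"])
      show "\<bar>\<bar>r t - g t\<bar>\<bar> \<le> \<kappa> / \<eta>" for t using r_bd[of t] g(2)[of t] by auto
    qed (use r_meas gm in auto)
    have "(\<integral>t. \<bar>w t * (\<kappa> - a t * m t)\<bar> \<partial>?M) \<le> (\<integral>t. (\<kappa> * \<eta> + 8 * e') + 4 * \<bar>r t - g t\<bar> \<partial>?M)"
    proof (rule integral_mono')
      show "integrable ?M (\<lambda>t. (\<kappa> * \<eta> + 8 * e') + 4 * \<bar>r t - g t\<bar>)" using int by auto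
      fix t assume "t \<in> space ?M"
      then have t: "t \<in> {0..T}" by simp
      have "\<bar>w t * a t\<bar> \<le> 2 * 2"
        unfolding abs_mult using bd[OF t] by (intro mult_mono) auto
      moreover have "\<bar>r t - m t\<bar> \<le> \<bar>r t - g t\<bar> + 2 * e'" using p(2)[OF t] by (auto simp: m_def)
      ultimately have ineq: "\<bar>(w t * a t) * (r t - m t)\<bar> \<le> 4 * (\<bar>r t - g t\<bar> + 2 * e')"
        unfolding abs_mult[of "w t * a t"] by (intro mult_mono) auto
      have "w t * (\<kappa> - a t * m t) = w t * (\<kappa> - a t * r t) + (w t * a t) * (r t - m t)"
        by (simp add: algebra_simps)
      also have "\<bar>\<dots>\<bar> \<le> \<kappa> * \<eta> + 4 * (\<bar>r t - g t\<bar> + 2 * e')"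
        by (rule order_trans[OF abs_triangle_ineq add_mono[OF r_err[OF t] ineq]])
      finally show "\<bar>w t * (\<kappa> - a t * m t)\<bar> \<le> (\<kappa> * \<eta> + 8 * e') + 4 * \<bar>r t - g t\<bar>" by simp
      show "0 \<le> (\<kappa> * \<eta> + 8 * e') + 4 * \<bar>r t - g t\<bar>" using \<kappa> \<eta> e' by simp
    qed
    also have "\<dots> = T * (\<kappa> * \<eta> + 8 * e') + 4 * (\<integral>t. \<bar>r t - g t\<bar> \<partial>?M)"
      using int T by (simp add: measure_restrict_space algebra_simps)
    also have "\<dots> \<le> e / 3 + e / 3 + e / 3"
    proof (intro add_mono)
      have "T * (\<kappa> * \<eta>) = (\<kappa> * T / (\<kappa> * T + 1)) * (e / 3)"
        by (simp add: \<eta>_def algebra_simps)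
      also have "\<dots> \<le> 1 * (e / 3)"
        using \<kappa> T e by (intro mult_right_mono) (auto simp: divide_le_eq_1 add_nonneg_pos)
      finally show "T * (\<kappa> * \<eta> + 8 * e') \<le> e / 3 + e / 3" using T by (simp add: e'_def distrib_left)
    qed (use g(3) in simp)
    finally show "(\<integral>t. \<bar>w t * (\<kappa> - a t * m t)\<bar> \<partial>?M) \<le> e" by simp
  qed (use L m_meas in auto)
qed

text \<open>The weight \<open>u * (1 - u)\<close> supplies the boundary values: for a polynomial
  \<open>p\<close>, the function \<open>u * (1 - u) * p u\<close> is an admissible \<open>F\<close>.
  Letting \<open>p\<close> approximate \<open>z\<close> in L^1 gives a zero integral of
  \<open>z^2 * u * (1 - u)\<close>, and the weight is positive away from the two endpoints.\<close>

lemma AE_zero_if_orthogonal: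
  fixes z :: "real \<Rightarrow> real"
  assumes z: "z \<in> borel_measurable (lebesgue_on {0..1})" and bd: "\<And>u. u \<in> {0..1} \<Longrightarrow> \<bar>z u\<bar> \<le> 1"
    and orth: "\<And>F F1 F2. two_derivs F F1 F2 \<Longrightarrow> F 0 = 0 \<Longrightarrow> F 1 = 0 \<Longrightarrow>
      (\<integral>u. z u * F u \<partial>lebesgue_on {0..1}) = 0"
  shows "AE u in lebesgue_on {0..1}. z u = 0"
proof -
  let ?L = "lebesgue_on {0..1::real}"
  have unit: "u * (1 - u) \<le> 1" "0 \<le> u * (1 - u)" if "u \<in> {0..1}" for u :: real
    using that mult_mono[of u 1 "1 - u" 1] by auto
  have L1: "{0..1::real} \<in> lmeasurable" by simp
  have um: "(\<lambda>u. u * (1 - u)) \<in> borel_measurable ?L"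
    by (intro continuous_imp_measurable_on_sets_lebesgue continuous_intros) auto
  have int: "integrable ?L (\<lambda>u. (z u)\<^sup>2 * (u * (1 - u)))"
  proof (rule integrable_lebesgue_on_bounded[where B=1])
    show "\<bar>(z u)\<^sup>2 * (u * (1 - u))\<bar> \<le> 1" if "u \<in> {0..1}" for u
      using mult_mono[of "(z u)\<^sup>2" 1 "u * (1 - u)" 1] unit[OF that] bd[OF that]
      by (simp add: abs_square_le_1)
  qed (intro borel_measurable_times borel_measurable_power z um L1)+
  have le: "(\<integral>u. (z u)\<^sup>2 * (u * (1 - u)) \<partial>?L) \<le> 0 + e" if e: "e > 0" for e
  proof -
    obtain g where g: "continuous_on UNIV g" "\<And>x. g x \<in> {-1..1}" "(\<integral>u. \<bar>z u - g u\<bar> \<partial>?L) < e / 2"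
      by (rule continuous_approximation_L1[OF z L1, of "-1" 1 "e / 2"]) (use bd e in \<open>auto simp: abs_le_iff minus_le_iff\<close>)
    obtain p where p: "real_polynomial_function p" "\<And>u. u \<in> {0..1} \<Longrightarrow> \<bar>g u - p u\<bar> < e / 2"
      using Stone_Weierstrass_real_polynomial_function[of "{0..1}" g "e / 2"] g(1) e
      by (auto intro: continuous_on_subset)
    define F where "F u = u * (1 - u) * p u" for u
    have F: "real_polynomial_function F"
      unfolding F_def using p(1)
      by (intro real_polynomial_function.intros(4) real_polynomial_function_diff
          real_polynomial_function.intros(1)[OF bounded_linear_ident] real_polynomial_function.intros(2))
    obtain F1 where F1: "real_polynomial_function F1" "\<And>x. (F has_real_derivative F1 x) (at x)"
      using has_real_derivative_polynomial_function[OF F] by blast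
    obtain F2 where F2: "real_polynomial_function F2" "\<And>x. (F1 has_real_derivative F2 x) (at x)"
      using has_real_derivative_polynomial_function[OF F1(1)] by blast
    have cont: "continuous_on S f" if "real_polynomial_function f" for f and S :: "real set"
      using that by (auto intro: continuous_on_polymonial_function simp: real_polynomial_function_eq)
    have "two_derivs F F1 F2"
      using F1 F2 cont by (auto simp: two_derivs_def intro: has_field_derivative_at_within)
    then have zF: "(\<integral>u. z u * F u \<partial>?L) = 0" by (rule orth) (auto simp: F_def)
    have pm: "p \<in> borel_measurable ?L" "F \<in> borel_measurable ?L" "g \<in> borel_measurable ?L"
      by (intro continuous_imp_measurable_on_sets_lebesgue cont p F continuous_on_subset[OF g(1)]; simp)+
    obtain B where B: "\<And>u. u \<in> {0..1} \<Longrightarrow> \<bar>F u\<bar> \<le> B"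
      using continuous_Icc_bound[OF cont[OF F, of "{0..1}"]] by metis
    have intF: "integrable ?L (\<lambda>u. z u * F u)"
    proof (rule integrable_lebesgue_on_bounded[where B=B])
      show "\<bar>z u * F u\<bar> \<le> B" if "u \<in> {0..1}" for u
        using mult_mono[of "\<bar>z u\<bar>" 1 "\<bar>F u\<bar>" B] bd[OF that] B[OF that] by (simp add: abs_mult)
    qed (use z pm in auto)
    have intg: "integrable ?L (\<lambda>u. \<bar>z u - g u\<bar>)"
    proof (rule integrable_lebesgue_on_bounded[where B=2])
      show "\<bar>\<bar>z u - g u\<bar>\<bar> \<le> 2" if "u \<in> {0..1}" for u using bd[OF that] g(2)[of u] by auto
    qed (use z pm in auto)
    have "(\<integral>u. (z u)\<^sup>2 * (u * (1 - u)) \<partial>?L) = (\<integral>u. (z u)\<^sup>2 * (u * (1 - u)) - z u * F u \<partial>?L)"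
      using int intF zF by simp
    also have "\<dots> \<le> (\<integral>u. \<bar>z u - g u\<bar> + e / 2 \<partial>?L)"
    proof (rule integral_mono)
      fix u assume "u \<in> space ?L"
      then have u: "u \<in> {0..1}" by simp
      have "(z u)\<^sup>2 * (u * (1 - u)) - z u * F u = (z u * (u * (1 - u))) * (z u - p u)"
        by (simp add: F_def power2_eq_square algebra_simps)
      also have "\<dots> \<le> \<bar>z u * (u * (1 - u))\<bar> * \<bar>z u - p u\<bar>" by (metis abs_ge_self abs_mult)
      also have "\<dots> \<le> (1 * 1) * (\<bar>z u - g u\<bar> + e / 2)"
      proof (rule mult_mono)
        show "\<bar>z u * (u * (1 - u))\<bar> \<le> 1 * 1"
          unfolding abs_mult[of "z u"] using bd[OF u] unit[OF u] by (intro mult_mono) auto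
        show "\<bar>z u - p u\<bar> \<le> \<bar>z u - g u\<bar> + e / 2" using p(2)[OF u] by linarith
      qed auto
      finally show "(z u)\<^sup>2 * (u * (1 - u)) - z u * F u \<le> \<bar>z u - g u\<bar> + e / 2" by simp
    qed (use int intF intg in auto)
    also have "\<dots> = (\<integral>u. \<bar>z u - g u\<bar> \<partial>?L) + e / 2"
      using intg by (simp add: measure_restrict_space)
    finally show ?thesis using g(3) by simp
  qed
  have "(\<integral>u. (z u)\<^sup>2 * (u * (1 - u)) \<partial>?L) \<le> 0" by (rule field_le_epsilon) (rule le)
  moreover have nn: "AE u in ?L. 0 \<le> (z u)\<^sup>2 * (u * (1 - u))"
    by (rule AE_I2) (use unit in simp)
  ultimately have "(\<integral>u. (z u)\<^sup>2 * (u * (1 - u)) \<partial>?L) = 0"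
    using integral_nonneg_AE[OF nn] by linarith
  then have "AE u in ?L. (z u)\<^sup>2 * (u * (1 - u)) = 0"
    using integral_nonneg_eq_0_iff_AE[OF int nn] by simp
  moreover have "AE u in ?L. u \<notin> {0, 1}"
  proof (rule AE_not_in)
    show "{0, 1} \<in> null_sets ?L" by (simp add: null_sets_restrict_space)
  qed
  ultimately show ?thesis by eventually_elim auto
qed


section \<open>The equation for the difference of two solutions\<close>

lemma bounded_measurable_integrable_on:
  fixes f :: "real \<Rightarrow> real"
  assumes "f \<in> borel_measurable (lebesgue_on {a..b})" "\<And>x. x \<in> {a..b} \<Longrightarrow> \<bar>f x\<bar> \<le> B"
  shows "f integrable_on {a..b}" "(\<integral>x. f x \<partial>lebesgue_on {a..b}) = integral {a..b} f"
proof -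
  have "integrable (lebesgue_on {a..b}) f"
    by (rule integrable_lebesgue_on_bounded[OF assms(1) lmeasurable_interval(1) assms(2)])
  then show "f integrable_on {a..b}" "(\<integral>x. f x \<partial>lebesgue_on {a..b}) = integral {a..b} f"
    by (auto intro: integrable_on_lebesgue_on lebesgue_integral_eq_integral)
qed

lemma integral_unit_bounds:
  fixes f :: "real \<Rightarrow> real"
  assumes "f \<in> borel_measurable (lebesgue_on {0..1})" "\<And>u. u \<in> {0..1} \<Longrightarrow> \<bar>f u\<bar> \<le> B"
  shows "integrable (lebesgue_on {0..1}) f" "\<bar>\<integral>u. f u \<partial>lebesgue_on {0..1}\<bar> \<le> B"
proof -
  show i: "integrable (lebesgue_on {0..1}) f"
    by (rule integrable_lebesgue_on_bounded[OF assms(1) lmeasurable_interval(1) assms(2)])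
  have "\<bar>\<integral>u. f u \<partial>lebesgue_on {0..1}\<bar> \<le> (\<integral>u. \<bar>f u\<bar> \<partial>lebesgue_on {0..1})" by simp
  also have "\<dots> \<le> (\<integral>u. B \<partial>lebesgue_on {0..1::real})"
    by (rule integral_mono) (use i assms(2) in auto)
  also have "\<dots> = B" by (simp add: measure_restrict_space)
  finally show "\<bar>\<integral>u. f u \<partial>lebesgue_on {0..1}\<bar> \<le> B" .
qed

lemma continuous_on_measurable_lebesgue_on:
  fixes f :: "'a::euclidean_space \<Rightarrow> real"
  assumes "continuous_on S f" "S \<in> sets lebesgue"
  shows "f \<in> borel_measurable (lebesgue_on S)"
  using continuous_imp_measurable_on_sets_lebesgue[OF assms] .

lemma box_measurable:
  fixes T :: real
  shows "{0..T} \<times> {0..1::real} \<in> sets lebesgue" "{0..T} \<times> {0..1::real} \<in> lmeasurable"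
  using lmeasurable_cbox[of "(0::real, 0::real)" "(T, 1)"] unfolding cbox_Pair_eq
  by (auto simp only: cbox_interval fmeasurableD)

text \<open>Both boundary value problems are instances: for Robin, \<open>a0\<close>, \<open>a1\<close> and \<open>w0\<close>, \<open>w1\<close> are the sums and
  the differences of the boundary values of \<open>\<rho>\<close> and \<open>\<sigma>\<close>; for Dirichlet (\<open>dir\<close>) they vanish, and so do the
  test functions at the boundary.\<close>

locale density_pair =
  fixes T \<kappa> :: real and dir :: bool and \<rho> \<sigma> :: "real \<Rightarrow> real \<Rightarrow> real" and a0 a1 w0 w1 :: "real \<Rightarrow> real"
  assumes T: "T > 0" and \<kappa>: "\<kappa> \<ge> 0"
    and \<rho>: "density_profile T \<rho>" and \<sigma>: "density_profile T \<sigma>"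
    and bdry_measurable: "a0 \<in> borel_measurable (lebesgue_on {0..T})" "a1 \<in> borel_measurable (lebesgue_on {0..T})"
      "w0 \<in> borel_measurable (lebesgue_on {0..T})" "w1 \<in> borel_measurable (lebesgue_on {0..T})"
    and bdry_le: "t \<in> {0..T} \<Longrightarrow> \<bar>w0 t\<bar> \<le> a0 t" "t \<in> {0..T} \<Longrightarrow> \<bar>w1 t\<bar> \<le> a1 t"
      "t \<in> {0..T} \<Longrightarrow> a0 t \<le> 2" "t \<in> {0..T} \<Longrightarrow> a1 t \<le> 2"
    and bdry_dir: "dir \<Longrightarrow> t \<in> {0..T} \<Longrightarrow> w0 t = 0 \<and> w1 t = 0"
    and weak: "t \<in> {0..T} \<Longrightarrow> two_derivs G G1 G2 \<Longrightarrow> (dir \<Longrightarrow> G 0 = 0 \<and> G 1 = 0) \<Longrightarrow>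
      (\<integral>u. (\<rho> t u - \<sigma> t u) * G u \<partial>lebesgue_on {0..1}) =
      (\<integral>s. (\<integral>u. ((\<rho> s u)\<^sup>2 - (\<sigma> s u)\<^sup>2) * G2 u \<partial>lebesgue_on {0..1})
         - (a1 s * w1 s * G1 1 - a0 s * w0 s * G1 0 + \<kappa> * (G 0 * w0 s + G 1 * w1 s)) \<partial>lebesgue_on {0..t})"
begin

definition pairing :: "real \<Rightarrow> (real \<Rightarrow> real) \<Rightarrow> real" where
  "pairing t G = (\<integral>u. (\<rho> t u - \<sigma> t u) * G u \<partial>lebesgue_on {0..1})"

definition bdry_flux :: "(real \<Rightarrow> real) \<Rightarrow> (real \<Rightarrow> real) \<Rightarrow> real \<Rightarrow> real" where
  "bdry_flux G G1 s = a1 s * w1 s * G1 1 - a0 s * w0 s * G1 0 + \<kappa> * (G 0 * w0 s + G 1 * w1 s)"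

text \<open>The density in time of the increments of \<open>pairing t G\<close>.\<close>

definition flux :: "(real \<Rightarrow> real) \<Rightarrow> (real \<Rightarrow> real) \<Rightarrow> (real \<Rightarrow> real) \<Rightarrow> real \<Rightarrow> real" where
  "flux G G1 G2 s = (\<integral>u. ((\<rho> s u)\<^sup>2 - (\<sigma> s u)\<^sup>2) * G2 u \<partial>lebesgue_on {0..1}) - bdry_flux G G1 s"

lemma density_bounds:
  assumes "t \<in> {0..T}" "u \<in> {0..1}"
  shows "0 \<le> \<rho> t u" "\<rho> t u \<le> 1" "0 \<le> \<sigma> t u" "\<sigma> t u \<le> 1"
    "\<bar>\<rho> t u - \<sigma> t u\<bar> \<le> 1" "\<bar>(\<rho> t u)\<^sup>2 - (\<sigma> t u)\<^sup>2\<bar> \<le> 1"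
proof -
  show b: "0 \<le> \<rho> t u" "\<rho> t u \<le> 1" "0 \<le> \<sigma> t u" "\<sigma> t u \<le> 1"
    using \<rho> \<sigma> assms by (auto simp: density_profile_def)
  then show "\<bar>\<rho> t u - \<sigma> t u\<bar> \<le> 1" by auto
  have "(\<rho> t u)\<^sup>2 \<le> 1" "(\<sigma> t u)\<^sup>2 \<le> 1" using b by (auto simp: abs_square_le_1)
  then show "\<bar>(\<rho> t u)\<^sup>2 - (\<sigma> t u)\<^sup>2\<bar> \<le> 1"
    using zero_le_power2[of "\<rho> t u"] zero_le_power2[of "\<sigma> t u"] by linarith
qed

lemma slice_measurable:
  assumes "t \<in> {0..T}"
  shows "\<rho> t \<in> borel_measurable (lebesgue_on {0..1})" "\<sigma> t \<in> borel_measurable (lebesgue_on {0..1})"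
  using \<rho> \<sigma> assms by (auto simp: density_profile_def)

lemma joint_measurable:
  "(\<lambda>z. \<rho> (fst z) (snd z)) \<in> borel_measurable (lebesgue_on ({0..T} \<times> {0..1}))"
  "(\<lambda>z. \<sigma> (fst z) (snd z)) \<in> borel_measurable (lebesgue_on ({0..T} \<times> {0..1}))"
  using \<rho> \<sigma> by (auto simp: density_profile_def case_prod_unfold)

lemma flux_integrable:
  assumes G: "two_derivs G G1 G2"
  obtains B where "B > 0" "\<And>s. s \<in> {0..T} \<Longrightarrow> \<bar>flux G G1 G2 s\<bar> \<le> B"
    "flux G G1 G2 \<in> borel_measurable (lebesgue_on {0..T})"
proof -
  obtain B2 where B2: "B2 > 0" "\<And>u. u \<in> {0..1} \<Longrightarrow> \<bar>G2 u\<bar> \<le> B2"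
    using continuous_Icc_bound[OF two_derivs_continuous(3)[OF G]] by blast
  have G2m: "G2 \<in> borel_measurable (lebesgue_on {0..1})"
    by (rule continuous_on_measurable_lebesgue_on[OF two_derivs_continuous(3)[OF G]]) simp
  have vG: "\<bar>((\<rho> t u)\<^sup>2 - (\<sigma> t u)\<^sup>2) * G2 u\<bar> \<le> B2" if "t \<in> {0..T}" "u \<in> {0..1}" for t u
    using mult_mono[OF density_bounds(6)[OF that] B2(2)[OF that(2)]] by (simp add: abs_mult)
  have vm: "(\<lambda>u. ((\<rho> t u)\<^sup>2 - (\<sigma> t u)\<^sup>2) * G2 u) \<in> borel_measurable (lebesgue_on {0..1})" if "t \<in> {0..T}" for t
    using slice_measurable[OF that] G2m by simp
  have "(\<lambda>z. G2 (snd z)) \<in> borel_measurable (lebesgue_on ({0..T} \<times> {0..1}))"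
    by (rule continuous_on_measurable_lebesgue_on[OF _ box_measurable(1)])
       (auto intro!: continuous_on_compose2[OF two_derivs_continuous(3)[OF G]] continuous_intros)
  then have "(\<lambda>(t, u). ((\<rho> t u)\<^sup>2 - (\<sigma> t u)\<^sup>2) * G2 u) \<in> borel_measurable (lebesgue_on ({0..T} \<times> {0..1}))"
    using joint_measurable by (simp add: case_prod_unfold)
  then have m1: "(\<lambda>s. \<integral>u. ((\<rho> s u)\<^sup>2 - (\<sigma> s u)\<^sup>2) * G2 u \<partial>lebesgue_on {0..1}) \<in> borel_measurable (lebesgue_on {0..T})"
    by (rule lebesgue_on_Fubini(1)[where B=B2]) (use vG vm in auto)
  have m2: "bdry_flux G G1 \<in> borel_measurable (lebesgue_on {0..T})"
    unfolding bdry_flux_def[abs_def] using bdry_measurable by simp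
  define K where "K = 4 * \<bar>G1 1\<bar> + 4 * \<bar>G1 0\<bar> + \<kappa> * (\<bar>G 0\<bar> * 2 + \<bar>G 1\<bar> * 2)"
  show thesis
  proof (rule that[of "B2 + K"])
    show "B2 + K > 0" using B2 \<kappa> by (simp add: K_def add_pos_nonneg)
    show "flux G G1 G2 \<in> borel_measurable (lebesgue_on {0..T})"
      unfolding flux_def[abs_def] using m1 m2 by simp
    fix s assume s: "s \<in> {0..T}"
    have w: "\<bar>w0 s\<bar> \<le> 2" "\<bar>w1 s\<bar> \<le> 2" "\<bar>a0 s\<bar> \<le> 2" "\<bar>a1 s\<bar> \<le> 2" using bdry_le[OF s] by auto
    have "\<bar>a1 s * w1 s * G1 1\<bar> \<le> (2 * 2) * \<bar>G1 1\<bar>" "\<bar>a0 s * w0 s * G1 0\<bar> \<le> (2 * 2) * \<bar>G1 0\<bar>"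
      unfolding abs_mult using w by (intro mult_mono; simp)+
    moreover have "\<bar>G 0 * w0 s\<bar> \<le> \<bar>G 0\<bar> * 2" "\<bar>G 1 * w1 s\<bar> \<le> \<bar>G 1\<bar> * 2"
      unfolding abs_mult using w by (intro mult_mono; simp)+
    then have "\<bar>G 0 * w0 s + G 1 * w1 s\<bar> \<le> \<bar>G 0\<bar> * 2 + \<bar>G 1\<bar> * 2" by linarith
    then have "\<kappa> * \<bar>G 0 * w0 s + G 1 * w1 s\<bar> \<le> \<kappa> * (\<bar>G 0\<bar> * 2 + \<bar>G 1\<bar> * 2)"
      using \<kappa> by (rule mult_left_mono)
    then have "\<bar>\<kappa> * (G 0 * w0 s + G 1 * w1 s)\<bar> \<le> \<kappa> * (\<bar>G 0\<bar> * 2 + \<bar>G 1\<bar> * 2)"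
      using \<kappa> by (simp add: abs_mult)
    ultimately have "\<bar>bdry_flux G G1 s\<bar> \<le> K" unfolding bdry_flux_def K_def by linarith
    moreover have "\<bar>\<integral>u. ((\<rho> s u)\<^sup>2 - (\<sigma> s u)\<^sup>2) * G2 u \<partial>lebesgue_on {0..1}\<bar> \<le> B2"
      by (rule integral_unit_bounds(2)[OF vm[OF s] vG[OF s]])
    ultimately show "\<bar>flux G G1 G2 s\<bar> \<le> B2 + K" unfolding flux_def by linarith
  qed
qed

lemma pairing_increment:
  assumes G: "two_derivs G G1 G2" "dir \<Longrightarrow> G 0 = 0 \<and> G 1 = 0" and st: "0 \<le> s" "s \<le> t" "t \<le> T"
  shows "flux G G1 G2 integrable_on {s..t}" "pairing t G - pairing s G = integral {s..t} (flux G G1 G2)"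
proof -
  obtain B where B: "\<And>s. s \<in> {0..T} \<Longrightarrow> \<bar>flux G G1 G2 s\<bar> \<le> B"
    "flux G G1 G2 \<in> borel_measurable (lebesgue_on {0..T})" using flux_integrable[OF G(1)] by metis
  have *: "flux G G1 G2 integrable_on {0..r}" "pairing r G = integral {0..r} (flux G G1 G2)" if r: "0 \<le> r" "r \<le> T" for r
  proof -
    have m: "flux G G1 G2 \<in> borel_measurable (lebesgue_on {0..r})"
      by (rule measurable_restrict_mono[OF B(2)]) (use r in auto)
    have b: "\<bar>flux G G1 G2 s\<bar> \<le> B" if "s \<in> {0..r}" for s using B(1)[of s] that r by auto
    show "flux G G1 G2 integrable_on {0..r}" by (rule bounded_measurable_integrable_on(1)[OF m b])
    have "pairing r G = (\<integral>s. flux G G1 G2 s \<partial>lebesgue_on {0..r})"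
      unfolding pairing_def flux_def bdry_flux_def using r G by (intro weak) auto
    then show "pairing r G = integral {0..r} (flux G G1 G2)"
      using bounded_measurable_integrable_on(2)[OF m b] by simp
  qed
  show "flux G G1 G2 integrable_on {s..t}"
    by (rule integrable_on_subinterval[OF *(1)[of t]]) (use st in auto)
  show "pairing t G - pairing s G = integral {s..t} (flux G G1 G2)"
    using Henstock_Kurzweil_Integration.integral_combine[of 0 s t "flux G G1 G2"] *[of t] *(2)[of s] st by simp
qed

text \<open>The common initial datum in the form in which the backward chain uses it: the identity
  \<open>weak\<close> at time 0 has a time integral over a single point.\<close>

lemma pairing_at_0:
  assumes "two_derivs G G1 G2" "dir \<Longrightarrow> G 0 = 0 \<and> G 1 = 0"
  shows "pairing 0 G = 0"
proof -
  have m: "flux G G1 G2 \<in> borel_measurable (lebesgue_on {0..0})"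
    by (rule flux_integrable[OF assms(1)], rule measurable_restrict_mono[where A="{0..T}"]) (use T in auto)
  have "pairing 0 G = (\<integral>s. flux G G1 G2 s \<partial>lebesgue_on {0..0})"
    unfolding pairing_def flux_def bdry_flux_def using T assms by (intro weak) auto
  also have "\<dots> = integral {0..0} (flux G G1 G2)"
    by (rule bounded_measurable_integrable_on(2)[OF m, of "\<bar>flux G G1 G2 0\<bar>"]) auto
  finally show ?thesis by simp
qed

text \<open>A translated grid need not contain the terminal time; this bounds the cost of moving to
  its largest point.\<close>

lemma pairing_Lipschitz:
  assumes G: "two_derivs G G1 G2" "dir \<Longrightarrow> G 0 = 0 \<and> G 1 = 0"
  obtains C where "C > 0" "\<And>s t. 0 \<le> s \<Longrightarrow> s \<le> t \<Longrightarrow> t \<le> T \<Longrightarrow> \<bar>pairing t G - pairing s G\<bar> \<le> C * (t - s)"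
proof -
  obtain B where B: "B > 0" "\<And>s. s \<in> {0..T} \<Longrightarrow> \<bar>flux G G1 G2 s\<bar> \<le> B" using flux_integrable[OF G(1)] by metis
  show thesis
  proof (rule that[OF B(1)])
    fix s t assume st: "0 \<le> s" "s \<le> t" "t \<le> T"
    have "norm (integral {s..t} (flux G G1 G2)) \<le> integral {s..t} (\<lambda>_. B)"
      by (rule integral_norm_bound_integral) (use pairing_increment(1)[OF G st] B(2) st in auto)
    then show "\<bar>pairing t G - pairing s G\<bar> \<le> B * (t - s)"
      using pairing_increment(2)[of G G1 G2 s t] G st by (simp add: mult.commute)
  qed
qed

text \<open>The dual Robin condition collapses each end to
  \<open>G * w * (\<kappa> - a * n)\<close>, which would vanish for \<open>n = \<kappa> / a\<close>.
  Here \<open>n0\<close>, \<open>n1\<close> are the coefficients frozen at a grid time, compared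
  with those at the running time \<open>r\<close>. As the product of \<open>w\<close> and
  \<open>a\<close> is at most 4 in absolute value, the freezing costs \<open>4 * d\<close> at each
  end.\<close>

lemma bdry_flux_bound:
  assumes G: "bdry_cond dir n0 n1 G G1" and M: "\<bar>G 0\<bar> \<le> M" "\<bar>G 1\<bar> \<le> M" and r: "r \<in> {0..T}"
    and n: "\<bar>m0 r - n0\<bar> \<le> d" "\<bar>m1 r - n1\<bar> \<le> d"
  shows "\<bar>bdry_flux G G1 r\<bar> \<le> M * (\<bar>w0 r * (\<kappa> - a0 r * m0 r)\<bar> + \<bar>w1 r * (\<kappa> - a1 r * m1 r)\<bar> + 8 * d)"
proof -
  have M0: "M \<ge> 0" and d0: "d \<ge> 0" using M n by auto
  have *: "\<bar>g * (w * (\<kappa> - a * n))\<bar> \<le> M * (\<bar>w * (\<kappa> - a * m)\<bar> + 4 * d)"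
    if "\<bar>g\<bar> \<le> M" "\<bar>w\<bar> \<le> a" "a \<le> 2" "\<bar>m - n\<bar> \<le> d" for g w a m n :: real
  proof -
    have "\<bar>w * a\<bar> \<le> 2 * 2" unfolding abs_mult using that by (intro mult_mono) auto
    then have "\<bar>(w * a) * (m - n)\<bar> \<le> 4 * d" unfolding abs_mult[of "w * a"] using that by (intro mult_mono) auto
    moreover have "w * (\<kappa> - a * n) = w * (\<kappa> - a * m) + (w * a) * (m - n)" by (simp add: algebra_simps)
    ultimately have "\<bar>w * (\<kappa> - a * n)\<bar> \<le> \<bar>w * (\<kappa> - a * m)\<bar> + 4 * d"
      using abs_triangle_ineq[of "w * (\<kappa> - a * m)" "(w * a) * (m - n)"] by simp
    then show ?thesis unfolding abs_mult[of g] using that(1) M0 by (intro mult_mono) auto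
  qed
  show ?thesis
  proof (cases dir)
    case True
    then have "bdry_flux G G1 r = 0" using bdry_dir[OF True r] by (simp add: bdry_flux_def)
    then show ?thesis using M0 d0 by simp
  next
    case False
    then have "bdry_flux G G1 r = G 0 * (w0 r * (\<kappa> - a0 r * n0)) + G 1 * (w1 r * (\<kappa> - a1 r * n1))"
      using G by (simp add: bdry_cond_def bdry_flux_def algebra_simps)
    then have "\<bar>bdry_flux G G1 r\<bar> \<le> M * (\<bar>w0 r * (\<kappa> - a0 r * m0 r)\<bar> + 4 * d) + M * (\<bar>w1 r * (\<kappa> - a1 r * m1 r)\<bar> + 4 * d)"
      using *[OF M(1) bdry_le(1)[OF r] bdry_le(3)[OF r] n(1)] *[OF M(2) bdry_le(2)[OF r] bdry_le(4)[OF r] n(2)]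
        abs_triangle_ineq[of "G 0 * (w0 r * (\<kappa> - a0 r * n0))" "G 1 * (w1 r * (\<kappa> - a1 r * n1))"] by simp
    then show ?thesis by (simp add: algebra_simps)
  qed
qed

end


section \<open>One step of the dual scheme\<close>

text \<open>The parameters \<open>r1\<close>, \<open>r2\<close> approximate \<open>\<rho>\<close>, \<open>\<sigma>\<close>; \<open>m0\<close>, \<open>m1\<close> are the coefficients of the dual boundary
  condition; \<open>h\<close> bounds the mesh; \<open>l\<close> is the weight in Young's inequality, taken to be small
  compared with \<open>\<epsilon>\<close>.\<close>

locale duality_scheme = density_pair +
  fixes r1 r2 :: "real \<times> real \<Rightarrow> real" and m0 m1 :: "real \<Rightarrow> real" and L M h \<omega> \<epsilon> l :: real
  assumes r_cont: "continuous_on UNIV r1" "continuous_on UNIV r2"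
    and r_bd: "r1 z \<in> {0..1}" "r2 z \<in> {0..1}"
    and m_nonneg: "t \<in> {0..T} \<Longrightarrow> 0 \<le> m0 t" "t \<in> {0..T} \<Longrightarrow> 0 \<le> m1 t"
    and m_meas: "m0 \<in> borel_measurable (lebesgue_on {0..T})" "m1 \<in> borel_measurable (lebesgue_on {0..T})"
    and m_Lip: "s \<in> {0..T} \<Longrightarrow> t \<in> {0..T} \<Longrightarrow> \<bar>m0 s - m0 t\<bar> \<le> L * \<bar>s - t\<bar>"
      "s \<in> {0..T} \<Longrightarrow> t \<in> {0..T} \<Longrightarrow> \<bar>m1 s - m1 t\<bar> \<le> L * \<bar>s - t\<bar>"
    and L: "L \<ge> 0" and M: "M > 0" and h: "h > 0" and \<epsilon>: "\<epsilon> > 0" and l: "l > 0"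
    and modulus: "s \<in> {0..T} \<Longrightarrow> t \<in> {0..T} \<Longrightarrow> \<bar>s - t\<bar> \<le> h \<Longrightarrow> u \<in> {0..1} \<Longrightarrow>
      \<bar>((r1 (s, u))\<^sup>2 - (r2 (s, u))\<^sup>2) - ((r1 (t, u))\<^sup>2 - (r2 (t, u))\<^sup>2)\<bar> \<le> \<omega>"
begin

definition err :: "real \<Rightarrow> real \<Rightarrow> real" where
  "err t u = \<bar>\<rho> t u - r1 (t, u)\<bar> + \<bar>\<sigma> t u - r2 (t, u)\<bar>"

definition perr :: "real \<Rightarrow> real" where
  "perr t = (\<integral>u. err t u \<partial>lebesgue_on {0..1})"

definition ebd :: "real \<Rightarrow> real" where
  "ebd t = \<bar>w0 t * (\<kappa> - a0 t * m0 t)\<bar> + \<bar>w1 t * (\<kappa> - a1 t * m1 t)\<bar>"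

text \<open>The error density that depends on the running time. The contributions frozen at a grid
  time are kept apart, since they are summed over the grid rather than integrated.\<close>

definition rate :: "real \<Rightarrow> real" where
  "rate t = (8 * (2 * perr t + \<omega>) + 2 * \<epsilon>\<^sup>2) / (2 * l) + M * (ebd t + 8 * (L * h))"

section \<open>Measurability and integrals of the approximation errors\<close>

lemma err_bd: "t \<in> {0..T} \<Longrightarrow> u \<in> {0..1} \<Longrightarrow> \<bar>err t u\<bar> \<le> 2" "0 \<le> err t u"
  using density_bounds(1-4)[of t u] r_bd[of "(t, u)"] by (auto simp: err_def)

lemma r_slice_cont: "continuous_on S (\<lambda>u. r1 (t, u))" "continuous_on S (\<lambda>u. r2 (t, u))"
  by (auto intro!: continuous_on_compose2[OF r_cont(1)] continuous_on_compose2[OF r_cont(2)] continuous_intros)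

lemma r_slice_meas: "(\<lambda>u. r1 (t, u)) \<in> borel_measurable (lebesgue_on {0..1})"
   "(\<lambda>u. r2 (t, u)) \<in> borel_measurable (lebesgue_on {0..1})"
  by (auto intro!: continuous_on_measurable_lebesgue_on r_slice_cont)

lemma err_meas: "t \<in> {0..T} \<Longrightarrow> err t \<in> borel_measurable (lebesgue_on {0..1})"
  unfolding err_def[abs_def] using slice_measurable r_slice_meas by simp

lemma err_int: "t \<in> {0..T} \<Longrightarrow> integrable (lebesgue_on {0..1}) (err t)"
  by (rule integral_unit_bounds(1)[OF err_meas err_bd(1)])

lemma perr_bd: "t \<in> {0..T} \<Longrightarrow> \<bar>perr t\<bar> \<le> 2" "0 \<le> perr t"
  unfolding perr_def by (rule integral_unit_bounds(2)[OF err_meas err_bd(1)]) (auto simp: err_bd intro!: integral_nonneg_AE)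

lemma err_joint_meas: "(\<lambda>(t, u). err t u) \<in> borel_measurable (lebesgue_on ({0..T} \<times> {0..1}))"
proof -
  have "r1 \<in> borel_measurable (lebesgue_on ({0..T} \<times> {0..1}))" "r2 \<in> borel_measurable (lebesgue_on ({0..T} \<times> {0..1}))"
    using r_cont by (auto intro!: continuous_on_measurable_lebesgue_on box_measurable intro: continuous_on_subset)
  then show ?thesis unfolding err_def[abs_def] using joint_measurable by (simp add: case_prod_unfold)
qed

lemma perr_meas: "perr \<in> borel_measurable (lebesgue_on {0..T})"
  unfolding perr_def[abs_def]
  by (rule lebesgue_on_Fubini(1)[OF err_joint_meas, of 2]) (use err_bd err_meas in auto)

lemma perr_integral:
  "integral {0..T} perr = (\<integral>z. \<bar>\<rho> (fst z) (snd z) - r1 z\<bar> \<partial>lebesgue_on ({0..T} \<times> {0..1}))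
      + (\<integral>z. \<bar>\<sigma> (fst z) (snd z) - r2 z\<bar> \<partial>lebesgue_on ({0..T} \<times> {0..1}))"
proof -
  have rm: "r1 \<in> borel_measurable (lebesgue_on ({0..T} \<times> {0..1}))" "r2 \<in> borel_measurable (lebesgue_on ({0..T} \<times> {0..1}))"
    using r_cont by (auto intro!: continuous_on_measurable_lebesgue_on box_measurable intro: continuous_on_subset)
  have unit_diff: "\<bar>\<rho> t u - r1 (t, u)\<bar> \<le> 1" "\<bar>\<sigma> t u - r2 (t, u)\<bar> \<le> 1" if "0 \<le> t" "t \<le> T" "0 \<le> u" "u \<le> 1" for t u
    using density_bounds(1-4)[of t u] r_bd[of "(t, u)"] that by auto
  have i: "integrable (lebesgue_on ({0..T} \<times> {0..1})) (\<lambda>z. \<bar>\<rho> (fst z) (snd z) - r1 z\<bar>)"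
     "integrable (lebesgue_on ({0..T} \<times> {0..1})) (\<lambda>z. \<bar>\<sigma> (fst z) (snd z) - r2 z\<bar>)"
    using joint_measurable rm unit_diff
    by (auto intro!: integrable_lebesgue_on_bounded[where B=1, OF _ box_measurable(2)])
  have "integral {0..T} perr = (\<integral>t. perr t \<partial>lebesgue_on {0..T})"
    using bounded_measurable_integrable_on(2)[OF perr_meas perr_bd(1)] by simp
  also have "\<dots> = (\<integral>z. err (fst z) (snd z) \<partial>lebesgue_on ({0..T} \<times> {0..1}))"
    unfolding perr_def
    by (rule lebesgue_on_Fubini(2)[OF err_joint_meas, of 2]) (use err_bd err_meas in auto)
  also have "\<dots> = (\<integral>z. \<bar>\<rho> (fst z) (snd z) - r1 z\<bar> \<partial>lebesgue_on ({0..T} \<times> {0..1}))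
      + (\<integral>z. \<bar>\<sigma> (fst z) (snd z) - r2 z\<bar> \<partial>lebesgue_on ({0..T} \<times> {0..1}))"
    unfolding err_def using i by simp
  finally show ?thesis .
qed

lemma ebd_meas: "ebd \<in> borel_measurable (lebesgue_on {0..T})"
  unfolding ebd_def[abs_def] using bdry_measurable m_meas by simp

lemma ebd_bd: obtains B where "\<And>t. t \<in> {0..T} \<Longrightarrow> \<bar>ebd t\<bar> \<le> B"
proof -
  define K where "K = m0 0 + m1 0 + L * T"
  have *: "\<bar>w * (\<kappa> - a * m)\<bar> \<le> 2 * (\<kappa> + 2 * K)" if "\<bar>w\<bar> \<le> a" "a \<le> 2" "0 \<le> m" "m \<le> K" for w a m
  proof -
    have "a * m \<le> 2 * K" using that by (intro mult_mono) auto
    moreover have "0 \<le> a * m" using that by auto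
    ultimately have "\<bar>\<kappa> - a * m\<bar> \<le> \<kappa> + 2 * K" using \<kappa> by linarith
    then show ?thesis unfolding abs_mult using that by (intro mult_mono) auto
  qed
  have mK: "m0 t \<le> K" "m1 t \<le> K" if "t \<in> {0..T}" for t
  proof -
    have "\<bar>m0 t - m0 0\<bar> \<le> L * T" "\<bar>m1 t - m1 0\<bar> \<le> L * T"
      using m_Lip[of t 0] that L T mult_left_mono[of t T L] by auto
    then show "m0 t \<le> K" "m1 t \<le> K" using m_nonneg[of 0] T unfolding K_def by auto
  qed
  show thesis
  proof (rule that)
    fix t assume t: "t \<in> {0..T}"
    show "\<bar>ebd t\<bar> \<le> 2 * (\<kappa> + 2 * K) + 2 * (\<kappa> + 2 * K)"
      using *[OF bdry_le(1)[OF t] bdry_le(3)[OF t] m_nonneg(1)[OF t] mK(1)[OF t]]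
        *[OF bdry_le(2)[OF t] bdry_le(4)[OF t] m_nonneg(2)[OF t] mK(2)[OF t]] by (simp add: ebd_def)
  qed
qed

lemma ebd_integrable: "ebd integrable_on {0..T}"
  by (rule ebd_bd, rule bounded_measurable_integrable_on(1)[OF ebd_meas])

lemma perr_integrable: "perr integrable_on {0..T}"
  by (rule bounded_measurable_integrable_on(1)[OF perr_meas perr_bd(1)])

lemma rate_has_integral:
  "(rate has_integral (8 * (2 * integral {0..T} perr + \<omega> * T) + 2 * \<epsilon>\<^sup>2 * T) / (2 * l)
      + M * (integral {0..T} ebd + 8 * (L * h) * T)) {0..T}"
proof -
  have c: "((\<lambda>_. c) has_integral c * T) {0..T}" for c :: real
    using has_integral_const_real[of c 0 T] T by (simp add: mult.commute)
  have p: "(perr has_integral integral {0..T} perr) {0..T}" "(ebd has_integral integral {0..T} ebd) {0..T}"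
    using ebd_integrable perr_integrable by (simp_all add: has_integral_integral)
  show ?thesis unfolding rate_def[abs_def]
    by (intro has_integral_add has_integral_mult_right has_integral_divide p c)
qed

text \<open>Young's inequality with weight \<open>l\<close> is applied pointwise to the product of
  \<open>X = v\<^sub>r - A w\<^sub>t\<close> with \<open>G2\<close>, and \<open>X\<close> is split
  into an approximation error \<open>Y\<close> and the shift \<open>\<epsilon> * w\<^sub>t\<close>.
  Because \<open>Y\<close> is bounded, its square is controlled by its absolute value, so closeness
  in L^1 of \<open>r1\<close>, \<open>r2\<close> to the densities is all that the estimate asks
  for.\<close>

lemma interior_error:
  assumes t: "t \<in> {0..T}" and r: "r \<in> {0..T}" and tr: "\<bar>r - t\<bar> \<le> h" and G2: "continuous_on {0..1} G2"
  shows "\<bar>\<integral>u. (((\<rho> r u)\<^sup>2 - (\<sigma> r u)\<^sup>2) - (r1 (t, u) + r2 (t, u) + \<epsilon>) * (\<rho> t u - \<sigma> t u)) * G2 u \<partial>lebesgue_on {0..1}\<bar>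
    \<le> (8 * (2 * perr r + 3 * perr t + \<omega>) + 2 * \<epsilon>\<^sup>2) / (2 * l) + l / 2 * (\<integral>u. (G2 u)\<^sup>2 \<partial>lebesgue_on {0..1})"
    (is "\<bar>\<integral>u. ?X u * G2 u \<partial>?L\<bar> \<le> _")
proof -
  have pw: "\<bar>?X u * G2 u\<bar> \<le> (8 * (2 * err r u + 3 * err t u + \<omega>) + 2 * \<epsilon>\<^sup>2) / (2 * l) + l / 2 * (G2 u)\<^sup>2"
    if u: "u \<in> {0..1}" for u
  proof -
    define Y where "Y = ((\<rho> r u)\<^sup>2 - (\<sigma> r u)\<^sup>2) - (r1 (t, u) + r2 (t, u)) * (\<rho> t u - \<sigma> t u)"
    define g where "g s = (r1 (s, u))\<^sup>2 - (r2 (s, u))\<^sup>2" for s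
    define b where "b = (\<rho> t u + \<sigma> t u - (r1 (t, u) + r2 (t, u))) * (\<rho> t u - \<sigma> t u)"
    have sq: "\<bar>x\<^sup>2 - y\<^sup>2\<bar> \<le> 2 * \<bar>x - y\<bar>" if "0 \<le> x" "x \<le> 1" "0 \<le> y" "y \<le> 1" for x y :: real
    proof -
      have "x\<^sup>2 - y\<^sup>2 = (x + y) * (x - y)" by (simp add: power2_eq_square algebra_simps)
      then show ?thesis using that by (simp add: abs_mult mult_right_mono)
    qed
    have vg: "\<bar>((\<rho> s u)\<^sup>2 - (\<sigma> s u)\<^sup>2) - g s\<bar> \<le> 2 * err s u" if s: "s \<in> {0..T}" for s
    proof -
      have "\<bar>(\<rho> s u)\<^sup>2 - (r1 (s, u))\<^sup>2\<bar> \<le> 2 * \<bar>\<rho> s u - r1 (s, u)\<bar>" "\<bar>(\<sigma> s u)\<^sup>2 - (r2 (s, u))\<^sup>2\<bar> \<le> 2 * \<bar>\<sigma> s u - r2 (s, u)\<bar>"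
        using density_bounds(1-4)[OF s u] r_bd[of "(s, u)"] by (auto intro: sq)
      moreover have "\<bar>(a - b) - (c - d)\<bar> \<le> \<bar>a - c\<bar> + \<bar>b - d\<bar>" for a b c d :: real by linarith
      ultimately show ?thesis unfolding g_def err_def distrib_left by (meson add_mono order_trans)
    qed
    have g: "\<bar>g r - g t\<bar> \<le> \<omega>" using modulus[OF r t tr u] by (simp add: g_def)
    have b: "\<bar>b\<bar> \<le> err t u * 1" unfolding b_def abs_mult
      using density_bounds(5)[OF t u] by (intro mult_mono) (auto simp: err_def)
    \<comment> \<open>By \<open>v = (\<rho> + \<sigma>) * w\<close> at time \<open>t\<close>, the
      term \<open>b\<close> is the error of replacing \<open>\<rho> + \<sigma>\<close> by
      \<open>r1 + r2\<close> and costs \<open>err t u\<close>. Passing from \<open>v\<close> at time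
      \<open>r\<close> to \<open>v\<close> at time \<open>t\<close> through the continuous
      \<open>g\<close> costs \<open>2 * err\<close> at both times and the modulus \<omega>.\<close>
    have Yb: "Y = ((\<rho> r u)\<^sup>2 - (\<sigma> r u)\<^sup>2) - ((\<rho> t u)\<^sup>2 - (\<sigma> t u)\<^sup>2) + b"
      by (simp add: Y_def b_def power2_eq_square algebra_simps)
    have Y1: "\<bar>Y\<bar> \<le> 2 * err r u + 3 * err t u + \<omega>"
      unfolding Yb using vg[OF r] vg[OF t] g b by linarith
    \<comment> \<open>This crude bound makes \<open>Y^2\<close> at most four times the absolute
      value of \<open>Y\<close>, hence linear in the errors.\<close>
    have Y4: "\<bar>Y\<bar> \<le> 4"
      unfolding Yb using density_bounds(6)[OF r u] density_bounds(6)[OF t u] b err_bd(1)[OF t u] by linarith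
    have "Y\<^sup>2 = \<bar>Y\<bar> * \<bar>Y\<bar>" by (simp add: power2_eq_square flip: abs_mult)
    also have "\<dots> \<le> 4 * \<bar>Y\<bar>" using Y4 by (intro mult_right_mono) auto
    finally have Ysq: "Y\<^sup>2 \<le> 4 * (2 * err r u + 3 * err t u + \<omega>)"
      by (rule order_trans) (intro mult_left_mono Y1, simp)
    have "(\<rho> t u - \<sigma> t u)\<^sup>2 \<le> 1" using density_bounds(5)[OF t u] by (simp add: abs_square_le_1)
    then have "(\<epsilon> * (\<rho> t u - \<sigma> t u))\<^sup>2 \<le> \<epsilon>\<^sup>2" by (simp add: power_mult_distrib mult_left_le)
    moreover have XY: "?X u = Y - \<epsilon> * (\<rho> t u - \<sigma> t u)" by (simp add: Y_def algebra_simps)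
    have "(?X u)\<^sup>2 \<le> 2 * Y\<^sup>2 + 2 * (\<epsilon> * (\<rho> t u - \<sigma> t u))\<^sup>2"
      unfolding XY using zero_le_power2[of "Y + \<epsilon> * (\<rho> t u - \<sigma> t u)"]
      by (simp add: power2_sum power2_diff)
    ultimately have X: "(?X u)\<^sup>2 \<le> 8 * (2 * err r u + 3 * err t u + \<omega>) + 2 * \<epsilon>\<^sup>2" using Ysq by linarith
    have "0 \<le> (\<bar>?X u\<bar> - l * \<bar>G2 u\<bar>)\<^sup>2" by simp
    also have "\<dots> = (?X u)\<^sup>2 - 2 * l * \<bar>?X u * G2 u\<bar> + l\<^sup>2 * (G2 u)\<^sup>2"
      by (simp add: power2_diff power_mult_distrib abs_mult)
    finally have "2 * l * \<bar>?X u * G2 u\<bar> \<le> (?X u)\<^sup>2 + l\<^sup>2 * (G2 u)\<^sup>2" by simp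
    then have "\<bar>?X u * G2 u\<bar> \<le> (?X u)\<^sup>2 / (2 * l) + l / 2 * (G2 u)\<^sup>2"
      using l by (simp add: field_simps power2_eq_square)
    also have "\<dots> \<le> (8 * (2 * err r u + 3 * err t u + \<omega>) + 2 * \<epsilon>\<^sup>2) / (2 * l) + l / 2 * (G2 u)\<^sup>2"
      using X l by (intro add_right_mono divide_right_mono) auto
    finally show ?thesis .
  qed
  obtain B2 where B2: "\<And>u. u \<in> {0..1} \<Longrightarrow> \<bar>G2 u\<bar> \<le> B2" using continuous_Icc_bound[OF G2] by blast
  have G2m: "G2 \<in> borel_measurable ?L" by (rule continuous_on_measurable_lebesgue_on[OF G2]) simp
  have G2i: "integrable ?L (\<lambda>u. (G2 u)\<^sup>2)" by (intro continuous_imp_integrable_real continuous_intros G2)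
  note ei = err_int[OF r] err_int[OF t]
  have Ri: "integrable ?L (\<lambda>u. (8 * (2 * err r u + 3 * err t u + \<omega>) + 2 * \<epsilon>\<^sup>2) / (2 * l) + l / 2 * (G2 u)\<^sup>2)"
    using ei G2i by (intro Bochner_Integration.integrable_add integrable_divide integrable_mult_right) auto
  have Xm: "(\<lambda>u. ?X u * G2 u) \<in> borel_measurable ?L"
    using slice_measurable[OF r] slice_measurable[OF t] r_slice_meas[of t] G2m by simp
  have "\<bar>\<integral>u. ?X u * G2 u \<partial>?L\<bar> \<le> (\<integral>u. \<bar>?X u * G2 u\<bar> \<partial>?L)" by simp
  also have "\<dots> \<le> (\<integral>u. (8 * (2 * err r u + 3 * err t u + \<omega>) + 2 * \<epsilon>\<^sup>2) / (2 * l) + l / 2 * (G2 u)\<^sup>2 \<partial>?L)"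
  proof (rule integral_mono)
    show "integrable ?L (\<lambda>u. \<bar>?X u * G2 u\<bar>)"
      by (rule Bochner_Integration.integrable_bound[OF Ri]) (use Xm pw in \<open>auto intro!: AE_I2 order_trans[OF _ abs_ge_self]\<close>)
  qed (use pw Ri in auto)
  also have "\<dots> = (8 * (2 * perr r + 3 * perr t + \<omega>) + 2 * \<epsilon>\<^sup>2) / (2 * l) + l / 2 * (\<integral>u. (G2 u)\<^sup>2 \<partial>?L)"
    using ei G2i by (simp add: perr_def measure_restrict_space)
  finally show ?thesis .
qed

text \<open>Pairing \<open>F = G - \<delta> * A * G2\<close> with \<open>w\<^sub>t\<close> gives
  \<open>pairing t F = pairing t G - \<delta> * q\<close>, while the equation gives the increment of
  \<open>pairing\<close> from \<open>s\<close> to \<open>t\<close> as the integral of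
  \<open>flux\<close>. The step error is thus the integral of \<open>flux - q\<close>, in which the
  leading interior terms cancel. The second derivative that remains from Young's inequality is paid
  for by the drop in energy.\<close>

lemma dual_step:
  assumes st: "0 \<le> s" "s < t" "t \<le> T" "t - s \<le> h"
    and F: "two_derivs F F1 F2" "dir \<Longrightarrow> F 0 = 0 \<and> F 1 = 0" "\<And>u. u \<in> {0..1} \<Longrightarrow> \<bar>F u\<bar> \<le> M"
  obtains G G1 G2 where "two_derivs G G1 G2" "dir \<Longrightarrow> G 0 = 0 \<and> G 1 = 0" "\<And>u. u \<in> {0..1} \<Longrightarrow> \<bar>G u\<bar> \<le> M"
    "\<bar>pairing t F\<bar> \<le> \<bar>pairing s G\<bar> + integral {s..t} rate + 12 / l * ((t - s) * perr t)
       + l / (2 * \<epsilon>) * (bdry_energy (m0 t) (m1 t) F F1 - bdry_energy (m0 t) (m1 t) G G1)"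
proof -
  let ?L = "lebesgue_on {0..1::real}"
  have t: "t \<in> {0..T}" and s: "s \<in> {0..T}" using st by auto
  define \<delta> where "\<delta> = t - s"
  have \<delta>: "\<delta> > 0" using st by (simp add: \<delta>_def)
  define A where "A u = r1 (t, u) + r2 (t, u) + \<epsilon>" for u
  have A: "continuous_on {0..1} A" "\<And>u. A u \<ge> \<epsilon>"
    using r_bd \<epsilon> by (auto simp: A_def intro!: continuous_intros r_slice_cont add_nonneg_nonneg)
  have \<delta>A: "continuous_on {0..1} (\<lambda>u. \<delta> * A u)" "\<And>u. u \<in> {0..1} \<Longrightarrow> \<delta> * A u > 0"
    by (intro continuous_intros A(1)) (intro mult_pos_pos \<delta> less_le_trans[OF \<epsilon> A(2)])
  obtain G G1 G2 where G: "two_derivs G G1 G2" and bc: "bdry_cond dir (m0 t) (m1 t) G G1"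
    and eq: "\<And>u. u \<in> {0..1} \<Longrightarrow> G u - \<delta> * A u * G2 u = F u"
    using elliptic_bvp_exists[OF \<delta>A two_derivs_continuous(1)[OF F(1)] m_nonneg[OF t], where dir=dir] by metis
  have GM: "\<bar>G u\<bar> \<le> M" if "u \<in> {0..1}" for u
    by (rule elliptic_max_principle[OF G bc m_nonneg[OF t] \<delta>A(2) eq F(3) that])
  have Gdir: "dir \<Longrightarrow> G 0 = 0 \<and> G 1 = 0" using bc by (simp add: bdry_cond_def)
  have en: "(\<integral>u. \<delta> * A u * (G2 u)\<^sup>2 \<partial>?L) \<le> bdry_energy (m0 t) (m1 t) F F1 - bdry_energy (m0 t) (m1 t) G G1"
    by (rule elliptic_energy_estimate[OF G bc m_nonneg[OF t] \<delta>A(1) eq F(1,2)])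
  note contG = two_derivs_continuous[OF G] two_derivs_continuous[OF F(1)]
  define J where "J = (\<integral>u. (G2 u)\<^sup>2 \<partial>?L)"
  have J: "\<delta> * \<epsilon> * J \<le> bdry_energy (m0 t) (m1 t) F F1 - bdry_energy (m0 t) (m1 t) G G1"
  proof -
    have "\<delta> * \<epsilon> * J = (\<integral>u. \<delta> * \<epsilon> * (G2 u)\<^sup>2 \<partial>?L)" by (simp add: J_def)
    also have "\<dots> \<le> (\<integral>u. \<delta> * A u * (G2 u)\<^sup>2 \<partial>?L)"
      using A \<delta> by (intro integral_mono continuous_imp_integrable_real continuous_intros contG \<delta>A)
        (auto intro!: mult_right_mono)
    finally show ?thesis using en by linarith
  qed
  obtain B2 where B2: "\<And>u. u \<in> {0..1} \<Longrightarrow> \<bar>G2 u\<bar> \<le> B2" using continuous_Icc_bound[OF contG(3)] by blast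
  define q where "q = (\<integral>u. (A u * (\<rho> t u - \<sigma> t u)) * G2 u \<partial>?L)"
  have meas: "f \<in> borel_measurable ?L" if "continuous_on {0..1} f" for f :: "real \<Rightarrow> real"
    by (rule continuous_on_measurable_lebesgue_on[OF that]) simp
  have w_int: "integrable ?L (\<lambda>u. (\<rho> t u - \<sigma> t u) * f u)" if f: "continuous_on {0..1} f" for f
  proof -
    obtain B where B: "\<And>u. u \<in> {0..1} \<Longrightarrow> \<bar>f u\<bar> \<le> B" using continuous_Icc_bound[OF f] by blast
    show ?thesis
    proof (rule integral_unit_bounds(1))
      show "\<bar>(\<rho> t u - \<sigma> t u) * f u\<bar> \<le> 1 * B" if "u \<in> {0..1}" for u
        unfolding abs_mult using density_bounds(5)[OF t that] B[OF that] by (intro mult_mono) auto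
    qed (use slice_measurable[OF t] meas[OF f] in simp)
  qed
  have AG2: "continuous_on {0..1} (\<lambda>u. A u * G2 u)" by (intro continuous_intros A contG)
  have "pairing t F = (\<integral>u. (\<rho> t u - \<sigma> t u) * G u - \<delta> * ((\<rho> t u - \<sigma> t u) * (A u * G2 u)) \<partial>?L)"
    unfolding pairing_def
  proof (rule Bochner_Integration.integral_cong[OF refl])
    fix u assume "u \<in> space ?L"
    then have F: "F u = G u - \<delta> * A u * G2 u" using eq[of u] by simp
    show "(\<rho> t u - \<sigma> t u) * F u = (\<rho> t u - \<sigma> t u) * G u - \<delta> * ((\<rho> t u - \<sigma> t u) * (A u * G2 u))"
      unfolding F by (simp add: algebra_simps)
  qed
  also have "\<dots> = (\<integral>u. (\<rho> t u - \<sigma> t u) * G u \<partial>?L) - \<delta> * (\<integral>u. (\<rho> t u - \<sigma> t u) * (A u * G2 u) \<partial>?L)"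
    using w_int[OF contG(1)] w_int[OF AG2] by simp
  also have "\<dots> = pairing t G - \<delta> * q"
    unfolding pairing_def q_def by (simp add: ac_simps)
  finally have id1: "pairing t F = pairing t G - \<delta> * q" .
  have id2: "pairing t G - pairing s G = integral {s..t} (flux G G1 G2)"
    and fi: "flux G G1 G2 integrable_on {s..t}"
    using pairing_increment[of G G1 G2 s t] G Gdir st by simp_all
  have "integral {s..t} (\<lambda>r. flux G G1 G2 r - q) = integral {s..t} (flux G G1 G2) - \<delta> * q"
    using fi st by (subst Henstock_Kurzweil_Integration.integral_diff) (auto simp: \<delta>_def)
  with id1 id2 have id: "pairing t F = pairing s G + integral {s..t} (\<lambda>r. flux G G1 G2 r - q)"
    by linarith
  \<comment> \<open>The part of the bound that does not depend on the running time:
    \<open>12 / l\<close> is the factor \<open>8 * 3 / (2 * l)\<close> of \<open>perr t\<close> in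
    the interior error.\<close>
  define c where "c = 12 / l * perr t + l / 2 * J"
  have rate_int: "rate integrable_on {s..t}"
    by (rule integrable_on_subinterval[OF has_integral_integrable[OF rate_has_integral]]) (use st in auto)
  have bd: "\<bar>flux G G1 G2 r - q\<bar> \<le> rate r + c" if "r \<in> {s..t}" for r
  proof -
    have r: "r \<in> {0..T}" and rt: "\<bar>r - t\<bar> \<le> h" using that st by auto
    have "integrable ?L (\<lambda>u. ((\<rho> r u)\<^sup>2 - (\<sigma> r u)\<^sup>2) * G2 u)"
    proof (rule integral_unit_bounds(1))
      show "\<bar>((\<rho> r u)\<^sup>2 - (\<sigma> r u)\<^sup>2) * G2 u\<bar> \<le> 1 * B2" if "u \<in> {0..1}" for u
        unfolding abs_mult using density_bounds(6)[OF r that] B2[OF that] by (intro mult_mono) auto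
    qed (use slice_measurable[OF r] meas[OF contG(3)] in simp)
    then have "(\<integral>u. ((\<rho> r u)\<^sup>2 - (\<sigma> r u)\<^sup>2) * G2 u \<partial>?L) - q
        = (\<integral>u. (((\<rho> r u)\<^sup>2 - (\<sigma> r u)\<^sup>2) - (r1 (t, u) + r2 (t, u) + \<epsilon>) * (\<rho> t u - \<sigma> t u)) * G2 u \<partial>?L)"
      unfolding q_def A_def[symmetric] left_diff_distrib[of _ _ "G2 _"] using w_int[OF AG2]
      by (subst Bochner_Integration.integral_diff) (auto simp: ac_simps)
    then have e1: "\<bar>(\<integral>u. ((\<rho> r u)\<^sup>2 - (\<sigma> r u)\<^sup>2) * G2 u \<partial>?L) - q\<bar>
        \<le> (8 * (2 * perr r + 3 * perr t + \<omega>) + 2 * \<epsilon>\<^sup>2) / (2 * l) + l / 2 * J"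
      using interior_error[OF t r rt contG(3)] by (simp add: J_def)
    have "L * \<bar>r - t\<bar> \<le> L * h" using rt L by (rule mult_left_mono)
    then have "\<bar>m0 r - m0 t\<bar> \<le> L * h" "\<bar>m1 r - m1 t\<bar> \<le> L * h" using m_Lip[OF r t] by linarith+
    from bdry_flux_bound[where ?m0.0=m0 and ?m1.0=m1, OF bc GM[of 0] GM[of 1] r this]
    have "\<bar>bdry_flux G G1 r\<bar> \<le> M * (ebd r + 8 * (L * h))" by (simp add: ebd_def)
    then have "\<bar>flux G G1 G2 r - q\<bar> \<le> (8 * (2 * perr r + 3 * perr t + \<omega>) + 2 * \<epsilon>\<^sup>2) / (2 * l) + l / 2 * J
        + M * (ebd r + 8 * (L * h))" using e1 unfolding flux_def by linarith
    also have "\<dots> = rate r + c" using l by (simp add: rate_def c_def field_simps)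
    finally show ?thesis .
  qed
  have "norm (integral {s..t} (\<lambda>r. flux G G1 G2 r - q)) \<le> integral {s..t} (\<lambda>r. rate r + c)"
  proof (rule integral_norm_bound_integral)
    show "(\<lambda>r. flux G G1 G2 r - q) integrable_on {s..t}"
      using fi by (intro Henstock_Kurzweil_Integration.integrable_diff) auto
  qed (use rate_int bd in \<open>auto intro: Henstock_Kurzweil_Integration.integrable_add\<close>)
  also have "\<dots> = integral {s..t} rate + \<delta> * c"
    using rate_int st by (subst Henstock_Kurzweil_Integration.integral_add) (auto simp: \<delta>_def)
  finally have fin: "\<bar>pairing t F\<bar> \<le> \<bar>pairing s G\<bar> + (integral {s..t} rate + \<delta> * c)"
    unfolding id by simp
  \<comment> \<open>Inserting \<epsilon> exhibits \<open>\<delta> * \<epsilon> * J\<close>, which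
    the lower bound \<open>A >= \<epsilon>\<close> lets the energy drop control.\<close>
  have "\<delta> * c = 12 / l * (\<delta> * perr t) + l / (2 * \<epsilon>) * (\<delta> * \<epsilon> * J)"
    using \<epsilon> by (simp add: c_def field_simps)
  also have "\<dots> \<le> 12 / l * (\<delta> * perr t) + l / (2 * \<epsilon>) * (bdry_energy (m0 t) (m1 t) F F1 - bdry_energy (m0 t) (m1 t) G G1)"
    using J l \<epsilon> by (intro add_left_mono mult_left_mono) auto
  finally show thesis using fin by (intro that[OF G Gdir GM]) (auto simp: \<delta>_def)
qed

end


section \<open>Summation over the grid and passage to the limit\<close>

context duality_scheme
begin

lemma omega_nonneg: "0 \<le> \<omega>"
  using modulus[of 0 0 0] T h by simp

lemma rate_nonneg: "t \<in> {0..T} \<Longrightarrow> 0 \<le> rate t"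
  using perr_bd(2) omega_nonneg l M L h by (simp add: rate_def ebd_def)

text \<open>The energy drop at \<open>t\<close> uses the coefficients at \<open>t\<close>, but the
  next step starts with those at \<open>s\<close>. Each end changes the doubled energy by at most
  \<open>L * M^2\<close> times the time difference, and the factor 1/2 in the energy absorbs the
  number of ends.\<close>

lemma bdry_energy_shift:
  assumes s: "s \<in> {0..T}" and t: "t \<in> {0..T}" and G: "\<bar>G 0\<bar> \<le> M" "\<bar>G 1\<bar> \<le> M"
  shows "bdry_energy (m0 s) (m1 s) G G1 \<le> bdry_energy (m0 t) (m1 t) G G1 + L * M\<^sup>2 * \<bar>s - t\<bar>"
proof -
  have *: "m * g\<^sup>2 \<le> m' * g\<^sup>2 + (L * \<bar>s - t\<bar>) * M\<^sup>2" if "\<bar>m - m'\<bar> \<le> L * \<bar>s - t\<bar>" "\<bar>g\<bar> \<le> M" for m m' g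
  proof -
    have "g\<^sup>2 \<le> M\<^sup>2" using that(2) M by (metis abs_of_pos abs_le_square_iff)
    then have "(m - m') * g\<^sup>2 \<le> (L * \<bar>s - t\<bar>) * M\<^sup>2"
      using that(1) L by (intro mult_mono) auto
    then show ?thesis by (simp add: algebra_simps)
  qed
  show ?thesis
    using *[OF m_Lip(1)[OF s t] G(1)] *[OF m_Lip(2)[OF s t] G(2)]
    by (simp add: bdry_energy_def field_simps)
qed

text \<open>The index runs backwards in time. The maximum principle hands on the same bound
  \<open>M\<close> at every step; keeping the difference of energies, rather than a bound for it,
  makes the energy contributions telescope up to the Lipschitz corrections, which sum to the elapsed
  time.\<close>

lemma dual_chain:
  fixes \<tau> :: "nat \<Rightarrow> real"
  assumes dec: "\<And>j. j < n \<Longrightarrow> \<tau> (Suc j) < \<tau> j" "\<And>j. j < n \<Longrightarrow> \<tau> j - \<tau> (Suc j) \<le> h"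
    and range: "\<And>j. j \<le> n \<Longrightarrow> \<tau> j \<in> {0..T}"
    and F: "two_derivs F F1 F2" "dir \<Longrightarrow> F 0 = 0 \<and> F 1 = 0" "\<And>u. u \<in> {0..1} \<Longrightarrow> \<bar>F u\<bar> \<le> M"
    and "j \<le> n"
  shows "\<tau> j \<le> \<tau> 0 \<and> (\<exists>G G1 G2. two_derivs G G1 G2 \<and> (dir \<longrightarrow> G 0 = 0 \<and> G 1 = 0) \<and> (\<forall>u\<in>{0..1}. \<bar>G u\<bar> \<le> M) \<and>
    \<bar>pairing (\<tau> 0) F\<bar> \<le> \<bar>pairing (\<tau> j) G\<bar> + integral {\<tau> j..\<tau> 0} rate
      + 12 / l * (\<Sum>i<j. (\<tau> i - \<tau> (Suc i)) * perr (\<tau> i))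
      + l / (2 * \<epsilon>) * (bdry_energy (m0 (\<tau> 0)) (m1 (\<tau> 0)) F F1 - bdry_energy (m0 (\<tau> j)) (m1 (\<tau> j)) G G1
          + L * M\<^sup>2 * (\<tau> 0 - \<tau> j)))"
  using \<open>j \<le> n\<close>
proof (induction j)
  case 0
  show ?case
    by (rule conjI, simp, rule exI[of _ F], rule exI[of _ F1], rule exI[of _ F2]) (use F in auto)
next
  case (Suc j)
  define s t where "s = \<tau> (Suc j)" and "t = \<tau> j"
  have st: "0 \<le> s" "s < t" "t \<le> T" "t - s \<le> h" "t \<le> \<tau> 0"
    using Suc dec[of j] range[of j] range[of "Suc j"] by (auto simp: s_def t_def)
  from Suc obtain G G1 G2 where G: "two_derivs G G1 G2" "dir \<Longrightarrow> G 0 = 0 \<and> G 1 = 0" "\<And>u. u \<in> {0..1} \<Longrightarrow> \<bar>G u\<bar> \<le> M"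
    and le: "\<bar>pairing (\<tau> 0) F\<bar> \<le> \<bar>pairing t G\<bar> + integral {t..\<tau> 0} rate
      + 12 / l * (\<Sum>i<j. (\<tau> i - \<tau> (Suc i)) * perr (\<tau> i))
      + l / (2 * \<epsilon>) * (bdry_energy (m0 (\<tau> 0)) (m1 (\<tau> 0)) F F1 - bdry_energy (m0 t) (m1 t) G G1
          + L * M\<^sup>2 * (\<tau> 0 - t))"
    by (auto simp: t_def)
  obtain K K1 K2 where K: "two_derivs K K1 K2" "dir \<Longrightarrow> K 0 = 0 \<and> K 1 = 0" "\<And>u. u \<in> {0..1} \<Longrightarrow> \<bar>K u\<bar> \<le> M"
    and le2: "\<bar>pairing t G\<bar> \<le> \<bar>pairing s K\<bar> + integral {s..t} rate + 12 / l * ((t - s) * perr t)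
       + l / (2 * \<epsilon>) * (bdry_energy (m0 t) (m1 t) G G1 - bdry_energy (m0 t) (m1 t) K K1)"
    using dual_step[OF st(1-4) G] by metis
  have tT: "\<tau> 0 \<le> T" using range[of 0] by simp
  have comb: "integral {s..t} rate + integral {t..\<tau> 0} rate = integral {s..\<tau> 0} rate"
  proof (rule Henstock_Kurzweil_Integration.integral_combine)
    show "rate integrable_on {s..\<tau> 0}"
      by (rule integrable_on_subinterval[OF has_integral_integrable[OF rate_has_integral]]) (use st tT in auto)
  qed (use st in auto)
  have sh: "bdry_energy (m0 s) (m1 s) K K1 \<le> bdry_energy (m0 t) (m1 t) K K1 + L * M\<^sup>2 * (t - s)"
    using bdry_energy_shift[of s t K K1] st K(3) by auto
  have sum: "12 / l * (\<Sum>i<Suc j. (\<tau> i - \<tau> (Suc i)) * perr (\<tau> i))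
    = 12 / l * (\<Sum>i<j. (\<tau> i - \<tau> (Suc i)) * perr (\<tau> i)) + 12 / l * ((t - s) * perr t)"
    by (simp add: s_def t_def distrib_left)
  define c where "c = l / (2 * \<epsilon>)"
  have c: "c \<ge> 0" using l \<epsilon> by (simp add: c_def)
  have "c * (bdry_energy (m0 (\<tau> 0)) (m1 (\<tau> 0)) F F1 - bdry_energy (m0 t) (m1 t) G G1 + L * M\<^sup>2 * (\<tau> 0 - t))
    + c * (bdry_energy (m0 t) (m1 t) G G1 - bdry_energy (m0 t) (m1 t) K K1)
    \<le> c * (bdry_energy (m0 (\<tau> 0)) (m1 (\<tau> 0)) F F1 - bdry_energy (m0 s) (m1 s) K K1 + L * M\<^sup>2 * (\<tau> 0 - s))"
    unfolding distrib_left[symmetric] using sh by (intro mult_left_mono c) (simp add: algebra_simps)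
  then have "\<bar>pairing (\<tau> 0) F\<bar> \<le> \<bar>pairing s K\<bar> + integral {s..\<tau> 0} rate
      + 12 / l * (\<Sum>i<Suc j. (\<tau> i - \<tau> (Suc i)) * perr (\<tau> i))
      + c * (bdry_energy (m0 (\<tau> 0)) (m1 (\<tau> 0)) F F1 - bdry_energy (m0 s) (m1 s) K K1 + L * M\<^sup>2 * (\<tau> 0 - s))"
    using le le2 comb sum unfolding c_def[symmetric] by linarith
  then show ?case unfolding s_def[symmetric] c_def
    using K st by (intro conjI, simp) (rule exI[of _ K], rule exI[of _ K1], rule exI[of _ K2], auto)
qed

text \<open>At time 0 the pairing vanishes and the remaining energy, which enters with a minus sign,
  is nonnegative. What is left are the accumulated errors and the energy of
  \<open>F\<close>.\<close>

lemma dual_estimate: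
  fixes \<tau> :: "nat \<Rightarrow> real"
  assumes dec: "\<And>j. j < n \<Longrightarrow> \<tau> (Suc j) < \<tau> j" "\<And>j. j < n \<Longrightarrow> \<tau> j - \<tau> (Suc j) \<le> h"
    and range: "\<And>j. j \<le> n \<Longrightarrow> \<tau> j \<in> {0..T}" and \<tau>n: "\<tau> n = 0"
    and F: "two_derivs F F1 F2" "dir \<Longrightarrow> F 0 = 0 \<and> F 1 = 0" "\<And>u. u \<in> {0..1} \<Longrightarrow> \<bar>F u\<bar> \<le> M"
  shows "\<bar>pairing (\<tau> 0) F\<bar> \<le> (8 * (2 * integral {0..T} perr + \<omega> * T) + 2 * \<epsilon>\<^sup>2 * T) / (2 * l)
      + M * (integral {0..T} ebd + 8 * (L * h) * T)
      + 12 / l * (\<Sum>i<n. (\<tau> i - \<tau> (Suc i)) * perr (\<tau> i))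
      + l / (2 * \<epsilon>) * (((\<integral>u. (F1 u)\<^sup>2 \<partial>lebesgue_on {0..1}) + (m0 T + L * T) * M\<^sup>2 + (m1 T + L * T) * M\<^sup>2) / 2 + L * M\<^sup>2 * T)"
proof -
  obtain G G1 G2 where G: "two_derivs G G1 G2" "dir \<Longrightarrow> G 0 = 0 \<and> G 1 = 0"
    and le: "\<bar>pairing (\<tau> 0) F\<bar> \<le> \<bar>pairing 0 G\<bar> + integral {0..\<tau> 0} rate
      + 12 / l * (\<Sum>i<n. (\<tau> i - \<tau> (Suc i)) * perr (\<tau> i))
      + l / (2 * \<epsilon>) * (bdry_energy (m0 (\<tau> 0)) (m1 (\<tau> 0)) F F1 - bdry_energy (m0 0) (m1 0) G G1
          + L * M\<^sup>2 * (\<tau> 0 - 0))"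
    using dual_chain[where \<tau>=\<tau> and n=n and j=n, OF dec range F order_refl] unfolding \<tau>n by auto
  have \<tau>0: "\<tau> 0 \<in> {0..T}" by (rule range) simp
  have p0: "pairing 0 G = 0" using pairing_at_0[of G G1 G2] G by blast
  have ri: "rate integrable_on {0..T}" by (rule has_integral_integrable[OF rate_has_integral])
  have "integral {0..\<tau> 0} rate \<le> integral {0..T} rate"
    by (rule integral_subset_le)
      (use \<tau>0 rate_nonneg ri in \<open>auto intro: integrable_on_subinterval[OF ri]\<close>)
  also have "\<dots> = (8 * (2 * integral {0..T} perr + \<omega> * T) + 2 * \<epsilon>\<^sup>2 * T) / (2 * l)
      + M * (integral {0..T} ebd + 8 * (L * h) * T)"
    by (rule integral_unique[OF rate_has_integral])
  finally have r: "integral {0..\<tau> 0} rate \<le> \<dots>" .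
  have nn: "0 \<le> bdry_energy (m0 0) (m1 0) G G1"
    unfolding bdry_energy_def using m_nonneg[of 0] T by (simp add: integral_nonneg_AE)
  \<comment> \<open>Comparison with the values at \<open>T\<close> frees the energy constant from
    the grid point \<open>\<tau> 0\<close>; the constant is fixed before the grid.\<close>
  have mT: "m0 (\<tau> 0) \<le> m0 T + L * T" "m1 (\<tau> 0) \<le> m1 T + L * T"
  proof -
    have "L * \<bar>\<tau> 0 - T\<bar> \<le> L * T" using \<tau>0 L by (intro mult_left_mono) auto
    then show "m0 (\<tau> 0) \<le> m0 T + L * T" "m1 (\<tau> 0) \<le> m1 T + L * T"
      using m_Lip[OF \<tau>0, of T] T by auto
  qed
  have FM: "(F 0)\<^sup>2 \<le> M\<^sup>2" "(F 1)\<^sup>2 \<le> M\<^sup>2"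
    using F(3)[of 0] F(3)[of 1] M by (auto simp: abs_le_square_iff[symmetric])
  have "m0 (\<tau> 0) * (F 0)\<^sup>2 \<le> (m0 T + L * T) * M\<^sup>2" "m1 (\<tau> 0) * (F 1)\<^sup>2 \<le> (m1 T + L * T) * M\<^sup>2"
    using mT FM m_nonneg[OF \<tau>0] by (intro mult_mono; linarith?; simp)+
  then have "bdry_energy (m0 (\<tau> 0)) (m1 (\<tau> 0)) F F1
    \<le> ((\<integral>u. (F1 u)\<^sup>2 \<partial>lebesgue_on {0..1}) + (m0 T + L * T) * M\<^sup>2 + (m1 T + L * T) * M\<^sup>2) / 2"
    unfolding bdry_energy_def by (intro divide_right_mono add_mono) auto
  moreover have "L * M\<^sup>2 * (\<tau> 0 - 0) \<le> L * M\<^sup>2 * T" using \<tau>0 L by (intro mult_left_mono) auto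
  ultimately have "l / (2 * \<epsilon>) * (bdry_energy (m0 (\<tau> 0)) (m1 (\<tau> 0)) F F1 - bdry_energy (m0 0) (m1 0) G G1
          + L * M\<^sup>2 * (\<tau> 0 - 0)) \<le> l / (2 * \<epsilon>) *
      (((\<integral>u. (F1 u)\<^sup>2 \<partial>lebesgue_on {0..1}) + (m0 T + L * T) * M\<^sup>2 + (m1 T + L * T) * M\<^sup>2) / 2 + L * M\<^sup>2 * T)"
    using nn l \<epsilon> by (intro mult_left_mono; (linarith | simp))
  then show ?thesis using le r unfolding p0 by linarith
qed

end

text \<open>The points \<open>x + i * h\<close> are numbered from the top, and 0 is appended as the
  last point. All steps have length \<open>h\<close> except the last, whose length is
  \<open>x\<close>; as \<open>x\<close> may be at most \<open>h\<close>, every weight in the sum can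
  be enlarged to \<open>h\<close>.\<close>

lemma decreasing_grid:
  fixes p :: "real \<Rightarrow> real"
  assumes n: "n > 0" and h: "h > 0" and x: "0 < x" "x \<le> h"
  defines "\<tau> \<equiv> \<lambda>j. if j < n then x + real (n - Suc j) * h else 0"
  shows "\<And>j. j < n \<Longrightarrow> \<tau> (Suc j) < \<tau> j" "\<And>j. j < n \<Longrightarrow> \<tau> j - \<tau> (Suc j) \<le> h"
    "\<And>j. j \<le> n \<Longrightarrow> \<tau> j \<in> {0..real n * h}" "\<tau> n = 0" "\<tau> 0 \<in> {real n * h - h..real n * h}"
    "(\<And>t. t \<in> {0..real n * h} \<Longrightarrow> p t \<ge> 0) \<Longrightarrow>
      (\<Sum>i<n. (\<tau> i - \<tau> (Suc i)) * p (\<tau> i)) \<le> h * (\<Sum>i<n. p (x + real i * h))"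
proof -
  have step: "\<tau> (Suc j) < \<tau> j \<and> \<tau> j - \<tau> (Suc j) \<le> h" if j: "j < n" for j
  proof (cases "Suc j < n")
    case True
    then have "real (n - Suc j) = real (n - Suc (Suc j)) + 1" by (simp add: of_nat_diff)
    then show ?thesis using True h by (simp add: \<tau>_def algebra_simps)
  next
    case False
    then have "n = Suc j" using j by simp
    then show ?thesis using x by (simp add: \<tau>_def)
  qed
  then show dec: "\<And>j. j < n \<Longrightarrow> \<tau> (Suc j) < \<tau> j" "\<And>j. j < n \<Longrightarrow> \<tau> j - \<tau> (Suc j) \<le> h" by auto
  show range: "\<tau> j \<in> {0..real n * h}" if "j \<le> n" for j
  proof (cases "j < n")
    case True
    then have "real (n - Suc j) + 1 \<le> real n" by (simp add: of_nat_diff)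
    then have "(real (n - Suc j) + 1) * h \<le> real n * h" using h by (intro mult_right_mono) auto
    then have "x + real (n - Suc j) * h \<le> real n * h" using x by (simp add: distrib_right)
    moreover have "0 \<le> real (n - Suc j) * h" using h by simp
    ultimately show ?thesis using True x unfolding \<tau>_def by simp
  qed (use h in \<open>simp add: \<tau>_def\<close>)
  show "\<tau> n = 0" by (simp add: \<tau>_def)
  have "real (n - Suc 0) = real n - 1" using n by (simp add: of_nat_diff)
  then show "\<tau> 0 \<in> {real n * h - h..real n * h}" using n x by (simp add: \<tau>_def algebra_simps)
  assume p: "\<And>t. t \<in> {0..real n * h} \<Longrightarrow> p t \<ge> 0"
  have "(\<Sum>i<n. (\<tau> i - \<tau> (Suc i)) * p (\<tau> i)) \<le> (\<Sum>i<n. h * p (\<tau> i))"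
    using step range p by (intro sum_mono mult_right_mono) auto
  also have "\<dots> = h * (\<Sum>i<n. p (x + real (n - Suc i) * h))" by (simp add: \<tau>_def sum_distrib_left)
  also have "(\<Sum>i<n. p (x + real (n - Suc i) * h)) = (\<Sum>i<n. p (x + real i * h))"
    by (rule sum.nat_diff_reindex)
  finally show "(\<Sum>i<n. (\<tau> i - \<tau> (Suc i)) * p (\<tau> i)) \<le> h * (\<Sum>i<n. p (x + real i * h))" .
qed

section \<open>Choice of the parameters and vanishing of the pairing\<close>

context density_pair
begin

lemma pairing_eq_0:
  assumes t0: "0 < t0" "t0 \<le> T" and F: "two_derivs F F1 F2" "dir \<Longrightarrow> F 0 = 0 \<and> F 1 = 0"
  shows "pairing t0 F = 0"
proof -
  have "\<bar>pairing t0 F\<bar> \<le> 0 + \<nu>" if \<nu>: "\<nu> > 0" for \<nu>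
  proof -
    let ?B = "lebesgue_on ({0..T} \<times> {0..1})"
    obtain M where M: "M > 0" "\<And>u. u \<in> {0..1} \<Longrightarrow> \<bar>F u\<bar> \<le> M"
      using continuous_Icc_bound[OF two_derivs_continuous(1)[OF F(1)]] by blast
    obtain C where C: "C > 0" "\<And>s t. 0 \<le> s \<Longrightarrow> s \<le> t \<Longrightarrow> t \<le> T \<Longrightarrow> \<bar>pairing t F - pairing s F\<bar> \<le> C * (t - s)"
      using pairing_Lipschitz[of F F1 F2] F by metis
    \<comment> \<open>The total error \<nu> is split into seven equal parts. The boundary error is
      multiplied by \<open>M\<close> and arises at two ends, hence the factor 14.\<close>
    have e1: "\<nu> / (14 * M) > 0" using \<nu> M by simp
    obtain m0 L0 where m0: "\<And>t. t \<in> {0..T} \<Longrightarrow> 0 \<le> m0 t" "L0 \<ge> 0"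
      "\<And>s t. s \<in> {0..T} \<Longrightarrow> t \<in> {0..T} \<Longrightarrow> \<bar>m0 s - m0 t\<bar> \<le> L0 * \<bar>s - t\<bar>"
      "m0 \<in> borel_measurable (lebesgue_on {0..T})"
      "(\<integral>t. \<bar>w0 t * (\<kappa> - a0 t * m0 t)\<bar> \<partial>lebesgue_on {0..T}) \<le> \<nu> / (14 * M)"
      by (rule smooth_rate_exists[OF bdry_measurable(1,3) bdry_le(1,3) T \<kappa> e1]) (assumption | rule that; assumption)+
    obtain m1 L1 where m1: "\<And>t. t \<in> {0..T} \<Longrightarrow> 0 \<le> m1 t" "L1 \<ge> 0"
      "\<And>s t. s \<in> {0..T} \<Longrightarrow> t \<in> {0..T} \<Longrightarrow> \<bar>m1 s - m1 t\<bar> \<le> L1 * \<bar>s - t\<bar>"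
      "m1 \<in> borel_measurable (lebesgue_on {0..T})"
      "(\<integral>t. \<bar>w1 t * (\<kappa> - a1 t * m1 t)\<bar> \<partial>lebesgue_on {0..T}) \<le> \<nu> / (14 * M)"
      by (rule smooth_rate_exists[OF bdry_measurable(2,4) bdry_le(2,4) T \<kappa> e1]) (assumption | rule that; assumption)+
    define L where "L = L0 + L1"
    have L: "L \<ge> 0" using m0 m1 by (simp add: L_def)
    \<comment> \<open>The energy constant depends on \<open>F\<close>, \<open>M\<close>,
      \<open>T\<close> and the boundary coefficients, all fixed before \<epsilon>; the final 1 makes
      it positive.\<close>
    define Cb where "Cb = ((\<integral>u. (F1 u)\<^sup>2 \<partial>lebesgue_on {0..1}) + (m0 T + L * T) * M\<^sup>2 + (m1 T + L * T) * M\<^sup>2) / 2 + L * M\<^sup>2 * T + 1"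
    have Cb: "Cb > 0"
      unfolding Cb_def using m0(1)[of T] m1(1)[of T] L T
      by (intro add_nonneg_pos add_nonneg_nonneg divide_nonneg_nonneg mult_nonneg_nonneg integral_nonneg_AE) auto
    \<comment> \<open>Each of these values makes one error term equal to \<open>\<nu> / 7\<close>:
      \<eta> gives \<open>l / (2 * \<epsilon>) * Cb = \<eta> * Cb / 2\<close>, \<epsilon> gives
      \<open>\<epsilon>^2 * T / l = \<epsilon> * T / \<eta>\<close>, \<theta> gives
      \<open>(8 + 24) * \<theta> / l\<close>, and \<omega> gives
      \<open>4 * \<omega> * T / l\<close>.\<close>
    define \<eta> where "\<eta> = 2 * \<nu> / (7 * Cb)"
    define \<epsilon> where "\<epsilon> = \<eta> * \<nu> / (7 * T)"
    define l where "l = \<epsilon> * \<eta>"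
    define \<theta> where "\<theta> = l * \<nu> / 224"
    define \<omega> where "\<omega> = l * \<nu> / (28 * T)"
    have pos: "\<eta> > 0" "\<epsilon> > 0" "l > 0" "\<theta> > 0" "\<omega> > 0"
      using \<nu> Cb T by (auto simp: \<eta>_def \<epsilon>_def l_def \<theta>_def \<omega>_def)
    have \<theta>2: "\<theta> / 2 > 0" using pos by simp
    obtain r1 where r1: "continuous_on UNIV r1" "\<And>z. r1 z \<in> {0..1}"
      "(\<integral>z. \<bar>\<rho> (fst z) (snd z) - r1 z\<bar> \<partial>?B) < \<theta> / 2"
      by (rule continuous_approximation_L1[OF joint_measurable(1) box_measurable(2), of 0 1 "\<theta> / 2"])
        (use density_bounds(1-4) \<theta>2 in auto)
    obtain r2 where r2: "continuous_on UNIV r2" "\<And>z. r2 z \<in> {0..1}"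
      "(\<integral>z. \<bar>\<sigma> (fst z) (snd z) - r2 z\<bar> \<partial>?B) < \<theta> / 2"
      by (rule continuous_approximation_L1[OF joint_measurable(2) box_measurable(2), of 0 1 "\<theta> / 2"])
        (use density_bounds(1-4) \<theta>2 in auto)
    define g where "g z = (r1 z)\<^sup>2 - (r2 z)\<^sup>2" for z
    have "compact ({0..T} \<times> {0..1::real})" by (intro compact_Times compact_Icc)
    moreover have "continuous_on ({0..T} \<times> {0..1}) g"
      unfolding g_def by (intro continuous_intros continuous_on_subset[OF r1(1)] continuous_on_subset[OF r2(1)]) auto
    ultimately have "uniformly_continuous_on ({0..T} \<times> {0..1}) g" by (rule compact_uniformly_continuous[rotated])
    then obtain d where d: "d > 0" "\<And>z z'. z \<in> {0..T} \<times> {0..1} \<Longrightarrow> z' \<in> {0..T} \<times> {0..1} \<Longrightarrow> dist z' z < d \<Longrightarrow> dist (g z') (g z) < \<omega>"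
      unfolding uniformly_continuous_on_def using pos(5) by metis
    \<comment> \<open>The three bounds on the mesh serve the modulus of continuity of
      \<open>g\<close>, the variation of the boundary coefficients within a step, and the gap
      between \<open>t0\<close> and the top of the grid. The summand 1 in \<open>L + 1\<close>
      avoids a zero denominator.\<close>
    define H where "H = Min {d / 2, \<nu> / (56 * M * (L + 1) * T), \<nu> / (7 * C)}"
    have H: "H > 0" "H < d" "H \<le> \<nu> / (56 * M * (L + 1) * T)" "H \<le> \<nu> / (7 * C)"
      using d(1) \<nu> M C T L by (auto simp: H_def intro!: min.strict_coboundedI1)
    obtain n where n: "n > 0" "t0 / real n \<le> H"
    proof -
      obtain n where n: "t0 / H < real n" using reals_Archimedean2 by blast
      have "0 < t0 / H" using t0 H by simp
      then have "0 < real n" using n by linarith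
      then show thesis using that[of n] n H(1) by (simp add: field_simps)
    qed
    define h where "h = t0 / real n"
    have h: "h > 0" "real n * h = t0" "h \<le> H" using n t0 by (auto simp: h_def)
    interpret S: duality_scheme T \<kappa> dir \<rho> \<sigma> a0 a1 w0 w1 r1 r2 m0 m1 L M h \<omega> \<epsilon> l
    proof unfold_locales
      fix s t u :: real assume st: "s \<in> {0..T}" "t \<in> {0..T}"
      have "L0 * \<bar>s - t\<bar> \<le> L * \<bar>s - t\<bar>" "L1 * \<bar>s - t\<bar> \<le> L * \<bar>s - t\<bar>"
        using m0(2) m1(2) by (auto simp: L_def intro!: mult_right_mono)
      then show "\<bar>m0 s - m0 t\<bar> \<le> L * \<bar>s - t\<bar>" "\<bar>m1 s - m1 t\<bar> \<le> L * \<bar>s - t\<bar>"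
        using m0(3)[OF st] m1(3)[OF st] by auto
      assume u: "\<bar>s - t\<bar> \<le> h" "u \<in> {0..1}"
      have "dist (s, u) (t, u) < d" using u h H by (simp add: dist_Pair_Pair dist_real_def)
      then have "dist (g (s, u)) (g (t, u)) < \<omega>" using st u by (intro d(2)) auto
      then show "\<bar>((r1 (s, u))\<^sup>2 - (r2 (s, u))\<^sup>2) - ((r1 (t, u))\<^sup>2 - (r2 (t, u))\<^sup>2)\<bar> \<le> \<omega>"
        by (simp add: g_def dist_real_def)
    qed (rule m0(1) m1(1) m0(4) m1(4) r1(1) r2(1) r1(2) r2(2) L M(1) h(1) pos(2,3); assumption?)+
    have pI: "integral {0..T} S.perr \<le> \<theta>" using S.perr_integral r1(3) r2(3) by linarith
    have pi: "S.perr integrable_on {0..real n * h}"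
      by (rule integrable_on_subinterval[OF S.perr_integrable]) (use t0 h in auto)
    \<comment> \<open>The translation makes the Riemann sum of \<open>perr\<close> exceed its
      integral by at most \<theta>, so the grid errors stay below \<open>2 * \<theta>\<close>, as
      the integrated ones are below \<theta>.\<close>
    obtain x where x: "0 < x" "x \<le> h" "h * (\<Sum>i<n. S.perr (x + real i * h)) \<le> integral {0..real n * h} S.perr + \<theta>"
      using sampling_grid_exists[OF pi h(1) pos(4)] by metis
    have "integral {0..real n * h} S.perr \<le> integral {0..T} S.perr"
      by (rule integral_subset_le) (use h t0 S.perr_bd(2) S.perr_integrable pi in auto)
    then have x3: "h * (\<Sum>i<n. S.perr (x + real i * h)) \<le> 2 * \<theta>" using x(3) pI by linarith
    define \<tau> where "\<tau> j = (if j < n then x + real (n - Suc j) * h else 0)" for j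
    have pp: "S.perr t \<ge> 0" if "t \<in> {0..real n * h}" for t using S.perr_bd(2)[of t] that h t0 by auto
    note \<tau> = decreasing_grid[OF n(1) h(1) x(1,2), folded \<tau>_def]
    have \<tau>T: "\<tau> j \<in> {0..T}" if "j \<le> n" for j using \<tau>(3)[OF that] h t0 by auto
    have S: "(\<Sum>i<n. (\<tau> i - \<tau> (Suc i)) * S.perr (\<tau> i)) \<le> 2 * \<theta>" using \<tau>(6)[of S.perr, OF pp] x3 by linarith
    have eI: "integral {0..T} S.ebd \<le> \<nu> / (7 * M)"
    proof -
      obtain B where B: "\<And>t. t \<in> {0..T} \<Longrightarrow> \<bar>S.ebd t\<bar> \<le> B" using S.ebd_bd by metis
      have "\<bar>\<bar>w0 t * (\<kappa> - a0 t * m0 t)\<bar>\<bar> \<le> B" "\<bar>\<bar>w1 t * (\<kappa> - a1 t * m1 t)\<bar>\<bar> \<le> B" if "t \<in> {0..T}" for t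
        using B[OF that] by (auto simp: S.ebd_def)
      then have i: "integrable (lebesgue_on {0..T}) (\<lambda>t. \<bar>w0 t * (\<kappa> - a0 t * m0 t)\<bar>)"
        "integrable (lebesgue_on {0..T}) (\<lambda>t. \<bar>w1 t * (\<kappa> - a1 t * m1 t)\<bar>)"
        using bdry_measurable m0(4) m1(4)
        by (auto intro!: integrable_lebesgue_on_bounded[OF _ lmeasurable_interval(1), of _ 0 T B])
      have "integral {0..T} S.ebd = (\<integral>t. S.ebd t \<partial>lebesgue_on {0..T})"
        using bounded_measurable_integrable_on(2)[OF S.ebd_meas B] by simp
      also have "\<dots> = (\<integral>t. \<bar>w0 t * (\<kappa> - a0 t * m0 t)\<bar> \<partial>lebesgue_on {0..T}) + (\<integral>t. \<bar>w1 t * (\<kappa> - a1 t * m1 t)\<bar> \<partial>lebesgue_on {0..T})"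
        unfolding S.ebd_def using i by simp
      also have "\<dots> \<le> \<nu> / (14 * M) + \<nu> / (14 * M)" using m0(5) m1(5) by linarith
      finally show ?thesis using M by (simp add: field_simps)
    qed
    have est: "\<bar>pairing (\<tau> 0) F\<bar> \<le> (8 * (2 * integral {0..T} S.perr + \<omega> * T) + 2 * \<epsilon>\<^sup>2 * T) / (2 * l)
      + M * (integral {0..T} S.ebd + 8 * (L * h) * T)
      + 12 / l * (\<Sum>i<n. (\<tau> i - \<tau> (Suc i)) * S.perr (\<tau> i)) + l / (2 * \<epsilon>) * (Cb - 1)"
      using S.dual_estimate[OF \<tau>(1,2) \<tau>T \<tau>(4) F M(2)] unfolding Cb_def by simp
    have b1: "(8 * (2 * integral {0..T} S.perr + \<omega> * T) + 2 * \<epsilon>\<^sup>2 * T) / (2 * l)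
        \<le> 8 * \<theta> / l + \<nu> / 7 + \<nu> / 7"
    proof -
      have "(8 * (2 * integral {0..T} S.perr + \<omega> * T) + 2 * \<epsilon>\<^sup>2 * T) / (2 * l)
          \<le> (8 * (2 * \<theta> + \<omega> * T) + 2 * \<epsilon>\<^sup>2 * T) / (2 * l)"
        using pI pos by (intro divide_right_mono) auto
      also have "\<dots> = 8 * \<theta> / l + 4 * \<omega> * T / l + \<epsilon>\<^sup>2 * T / l" using pos by (simp add: field_simps)
      also have "4 * \<omega> * T / l = \<nu> / 7" using pos T by (simp add: \<omega>_def)
      also have "\<epsilon>\<^sup>2 * T / l = \<epsilon> * T / \<eta>" using pos by (simp add: l_def power2_eq_square)
      also have "\<epsilon> * T / \<eta> = \<nu> / 7" using pos(1) T by (simp add: \<epsilon>_def)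
      finally show ?thesis .
    qed
    have b2: "M * (integral {0..T} S.ebd + 8 * (L * h) * T) \<le> \<nu> / 7 + \<nu> / 7"
    proof -
      have "M * integral {0..T} S.ebd \<le> M * (\<nu> / (7 * M))" using eI M by (intro mult_left_mono) auto
      also have "\<dots> = \<nu> / 7" using M by simp
      finally have "M * integral {0..T} S.ebd \<le> \<nu> / 7" .
      moreover have "M * (8 * (L * h) * T) \<le> \<nu> / 7"
      proof -
        have "M * (8 * (L * h) * T) = (8 * M * L * T) * h" by simp
        also have "\<dots> \<le> (8 * M * (L + 1) * T) * (\<nu> / (56 * M * (L + 1) * T))"
          using M L T h H \<nu> by (intro mult_mono mult_nonneg_nonneg) auto
        also have "\<dots> = (8 * (M * (L + 1) * T)) * (\<nu> / (56 * (M * (L + 1) * T)))" by (simp only: mult.assoc)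
        also have "\<dots> = \<nu> / 7"
        proof -
          have "M * (L + 1) * T \<noteq> 0" using M L T by simp
          then show ?thesis by (simp only: times_divide_eq_right) (simp add: divide_eq_eq)
        qed
        finally show ?thesis .
      qed
      ultimately show ?thesis by (simp add: distrib_left)
    qed
    have b3: "12 / l * (\<Sum>i<n. (\<tau> i - \<tau> (Suc i)) * S.perr (\<tau> i)) \<le> 24 * \<theta> / l"
      using mult_left_mono[OF S, of "12 / l"] pos by simp
    have b13: "8 * \<theta> / l + 24 * \<theta> / l = \<nu> / 7" using pos by (simp add: \<theta>_def field_simps)
    have b4: "l / (2 * \<epsilon>) * (Cb - 1) \<le> \<nu> / 7"
    proof -
      have "l / (2 * \<epsilon>) * (Cb - 1) \<le> l / (2 * \<epsilon>) * Cb" using pos by (intro mult_left_mono) auto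
      also have "\<dots> = \<eta> * Cb / 2" using pos by (simp add: l_def)
      also have "\<dots> = \<nu> / 7" using Cb by (simp add: \<eta>_def)
      finally show ?thesis .
    qed
    have "\<bar>pairing t0 F - pairing (\<tau> 0) F\<bar> \<le> C * (t0 - \<tau> 0)"
      using \<tau>(5) \<tau>T[of 0] t0 h by (intro C(2)) auto
    also have "\<dots> \<le> C * (\<nu> / (7 * C))" using \<tau>(5) h H C by (intro mult_left_mono) auto
    also have "\<dots> = \<nu> / 7" using C by simp
    finally show ?thesis using est b1 b2 b3 b13 b4 by linarith
  qed
  then have "\<bar>pairing t0 F\<bar> \<le> 0" by (rule field_le_epsilon)
  then show ?thesis by simp
qed

text \<open>Functions vanishing at both ends are admissible under either boundary condition, and
  they determine a slice almost everywhere. Each slice at a positive time is thus settled; time 0 is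
  a null set, and Fubini passes to the rectangle.\<close>

lemma densities_eq_AE:
  "AE (t, u) in lebesgue_on ({0..T} \<times> {0..1}). \<rho> t u = \<sigma> t u"
proof -
  let ?B = "lebesgue_on ({0..T} \<times> {0..1})"
  have slice: "AE u in lebesgue_on {0..1}. \<rho> t u - \<sigma> t u = 0" if t: "0 < t" "t \<le> T" for t
  proof (rule AE_zero_if_orthogonal)
    show "(\<lambda>u. \<rho> t u - \<sigma> t u) \<in> borel_measurable (lebesgue_on {0..1})"
      using slice_measurable[of t] t by simp
    show "\<bar>\<rho> t u - \<sigma> t u\<bar> \<le> 1" if "u \<in> {0..1}" for u using density_bounds(5)[of t u] t that by simp
    show "(\<integral>u. (\<rho> t u - \<sigma> t u) * F u \<partial>lebesgue_on {0..1}) = 0" if "two_derivs F F1 F2" "F 0 = 0" "F 1 = 0" for F F1 F2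
      using pairing_eq_0[OF t that(1)] that by (simp add: pairing_def)
  qed
  have meas: "(\<lambda>(t, u). \<bar>\<rho> t u - \<sigma> t u\<bar>) \<in> borel_measurable ?B"
    using joint_measurable by (simp add: case_prod_unfold)
  have zero: "(\<integral>u. \<bar>\<rho> t u - \<sigma> t u\<bar> \<partial>lebesgue_on {0..1}) = 0" if "0 < t" "t \<le> T" for t
  proof -
    have "(\<integral>u. \<bar>\<rho> t u - \<sigma> t u\<bar> \<partial>lebesgue_on {0..1}) = (\<integral>u. 0 \<partial>lebesgue_on {0..1::real})"
      using slice[OF that] slice_measurable[of t] that by (intro integral_cong_AE) auto
    then show ?thesis by simp
  qed
  have "(\<integral>z. \<bar>\<rho> (fst z) (snd z) - \<sigma> (fst z) (snd z)\<bar> \<partial>?B)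
      = (\<integral>t. (\<integral>u. \<bar>\<rho> t u - \<sigma> t u\<bar> \<partial>lebesgue_on {0..1}) \<partial>lebesgue_on {0..T})"
    by (rule lebesgue_on_Fubini(2)[OF meas, of 1, symmetric]) (use density_bounds(5) slice_measurable in auto)
  also have "\<dots> = (\<integral>t. 0 \<partial>lebesgue_on {0..T})"
  proof (rule integral_cong_AE)
    have "AE t in lebesgue_on {0..T}. t \<notin> {0}"
      using T by (intro AE_not_in) (simp add: null_sets_restrict_space)
    then show "AE t in lebesgue_on {0..T}. (\<integral>u. \<bar>\<rho> t u - \<sigma> t u\<bar> \<partial>lebesgue_on {0..1}) = 0"
      using AE_space by eventually_elim (auto intro: zero)
    show "(\<lambda>t. \<integral>u. \<bar>\<rho> t u - \<sigma> t u\<bar> \<partial>lebesgue_on {0..1}) \<in> borel_measurable (lebesgue_on {0..T})"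
      by (rule lebesgue_on_Fubini(1)[OF meas, of 1]) (use density_bounds(5) slice_measurable in auto)
  qed simp
  finally have "(\<integral>z. \<bar>\<rho> (fst z) (snd z) - \<sigma> (fst z) (snd z)\<bar> \<partial>?B) = 0" by simp
  moreover have "integrable ?B (\<lambda>z. \<bar>\<rho> (fst z) (snd z) - \<sigma> (fst z) (snd z)\<bar>)"
    by (rule integrable_lebesgue_on_bounded[where B=1, OF _ box_measurable(2)])
       (use joint_measurable density_bounds(5) in auto)
  ultimately have "AE z in ?B. \<bar>\<rho> (fst z) (snd z) - \<sigma> (fst z) (snd z)\<bar> = 0"
    by (simp add: integral_nonneg_eq_0_iff_AE)
  then show ?thesis by eventually_elim auto
qed

end


section \<open>Weak solutions\<close>

text \<open>One-sided derivatives are unique on nondegenerate intervals, which is where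
  \<open>T > 0\<close> enters; so the chosen values of \<open>vector_derivative\<close> are the
  given functions.\<close>

lemma time_independent_test_function:
  assumes G: "two_derivs G G1 G2" and T: "T > 0"
  shows "(\<lambda>_. G) \<in> C12 T"
    and "\<And>s u. s \<in> {0..T} \<Longrightarrow> d_time T (\<lambda>_. G) s u = 0"
    and "\<And>s u. u \<in> {0..1} \<Longrightarrow> d_space (\<lambda>_. G) s u = G1 u"
    and "\<And>s u. u \<in> {0..1} \<Longrightarrow> laplacian (\<lambda>_. G) s u = G2 u"
proof -
  have der: "(G has_vector_derivative G1 u) (at u within {0..1})" "(G1 has_vector_derivative G2 u) (at u within {0..1})"
    if "u \<in> {0..1}" for u
    using G that by (auto simp: two_derivs_def has_real_derivative_iff_has_vector_derivative)
  show time: "d_time T (\<lambda>_. G) s u = 0" if "s \<in> {0..T}" for s u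
    unfolding d_time_def
    by (rule vector_derivative_within_closed_interval[OF T that has_vector_derivative_const])
  show space: "d_space (\<lambda>_. G) s u = G1 u" if "u \<in> {0..1}" for s u
    unfolding d_space_def by (rule vector_derivative_within_closed_interval[OF zero_less_one that der(1)[OF that]])
  \<comment> \<open>The function \<open>d_space\<close> is known to agree with \<open>G1\<close> on
    \<open>{0..1}\<close>, so its derivative is transferred within that interval.\<close>
  have der2: "(d_space (\<lambda>_. G) s has_vector_derivative G2 u) (at u within {0..1})" if "u \<in> {0..1}" for s u
    by (rule has_vector_derivative_transform[OF that space der(2)[OF that]])
  show lap: "laplacian (\<lambda>_. G) s u = G2 u" if "u \<in> {0..1}" for s u
    unfolding d_space_def[of "d_space (\<lambda>_. G)"]
    by (rule vector_derivative_within_closed_interval[OF zero_less_one that der2[OF that]])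
  have cont: "continuous_on ({0..T} \<times> {0..1}) (\<lambda>(s, u). K s u)"
    if "continuous_on {0..1} k" "\<And>s u. s \<in> {0..T} \<Longrightarrow> u \<in> {0..1} \<Longrightarrow> K s u = k u" for k :: "real \<Rightarrow> real" and K
  proof -
    have "continuous_on ({0..T} \<times> {0..1}) (\<lambda>z. k (snd z))"
      by (auto intro!: continuous_on_compose2[OF that(1)] continuous_intros)
    then show ?thesis using that(2) by (subst continuous_on_cong[OF refl, where g="\<lambda>z. k (snd z)"]) auto
  qed
  note c = two_derivs_continuous[OF G]
  show "(\<lambda>_. G) \<in> C12 T"
    unfolding C12_def
  proof (intro CollectI conjI ballI)
    show "(\<lambda>r. G u) differentiable at s within {0..T}" for s u by simp
    show "G differentiable at u within {0..1}" if "u \<in> {0..1}" for u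
      using der(1)[OF that] by (rule differentiableI_vector)
    show "d_space (\<lambda>_. G) s differentiable at u within {0..1}" if "u \<in> {0..1}" for s u
      using der2[OF that] by (rule differentiableI_vector)
    show "continuous_on ({0..T} \<times> {0..1}) (\<lambda>(s, u). d_time T (\<lambda>_. G) s u)"
      by (rule cont[of "\<lambda>_. 0"]) (use time in auto)
    show "continuous_on ({0..T} \<times> {0..1}) (\<lambda>(s, u). G u)" by (rule cont[OF c(1)]) simp
    show "continuous_on ({0..T} \<times> {0..1}) (\<lambda>(s, u). d_space (\<lambda>_. G) s u)" by (rule cont[OF c(2)]) (rule space)
    show "continuous_on ({0..T} \<times> {0..1}) (\<lambda>(s, u). laplacian (\<lambda>_. G) s u)" by (rule cont[OF c(3)]) (rule lap)
  qed
qed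

text \<open>These facts allow the two weak formulations to be subtracted term by term, since
  linearity of the Bochner integral requires integrability of each summand.\<close>

lemma density_profile_integrable:
  assumes \<rho>: "density_profile T \<rho>" and k: "continuous_on {0..1} k" and t: "t \<in> {0..T}"
  shows "integrable (lebesgue_on {0..1}) (\<lambda>u. \<rho> t u * k u)"
    "integrable (lebesgue_on {0..1}) (\<lambda>u. (\<rho> t u)\<^sup>2 * k u)"
    "integrable (lebesgue_on {0..t}) (\<lambda>s. \<integral>u. (\<rho> s u)\<^sup>2 * k u \<partial>lebesgue_on {0..1})"
    "x \<in> {0, 1} \<Longrightarrow> integrable (lebesgue_on {0..t}) (\<lambda>s. \<rho> s x)"
    "x \<in> {0, 1} \<Longrightarrow> integrable (lebesgue_on {0..t}) (\<lambda>s. (\<rho> s x)\<^sup>2)"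
proof -
  have bd: "\<bar>\<rho> s u\<bar> \<le> 1" "(\<rho> s u)\<^sup>2 \<le> 1" if "s \<in> {0..T}" "u \<in> {0..1}" for s u
    using \<rho> that by (auto simp: density_profile_def abs_square_le_1)
  have slice: "\<rho> s \<in> borel_measurable (lebesgue_on {0..1})" if "s \<in> {0..T}" for s
    using \<rho> that by (auto simp: density_profile_def)
  obtain B where B: "B > 0" "\<And>u. u \<in> {0..1} \<Longrightarrow> \<bar>k u\<bar> \<le> B" using continuous_Icc_bound[OF k] by blast
  have km: "k \<in> borel_measurable (lebesgue_on {0..1})" by (rule continuous_on_measurable_lebesgue_on[OF k]) simp
  have b1: "\<bar>\<rho> s u * k u\<bar> \<le> 1 * B" and b2: "\<bar>(\<rho> s u)\<^sup>2 * k u\<bar> \<le> 1 * B"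
    if "s \<in> {0..T}" "u \<in> {0..1}" for s u
    unfolding abs_mult using bd[OF that] B(2)[OF that(2)] by (intro mult_mono; simp)+
  show "integrable (lebesgue_on {0..1}) (\<lambda>u. \<rho> t u * k u)"
    by (rule integral_unit_bounds(1)[OF _ b1[OF t]]) (use slice[OF t] km in simp)
  show "integrable (lebesgue_on {0..1}) (\<lambda>u. (\<rho> t u)\<^sup>2 * k u)"
    by (rule integral_unit_bounds(1)[OF _ b2[OF t]]) (use slice[OF t] km in simp)
  have "(\<lambda>z. k (snd z)) \<in> borel_measurable (lebesgue_on ({0..T} \<times> {0..1}))"
    by (rule continuous_on_measurable_lebesgue_on[OF _ box_measurable(1)])
       (auto intro!: continuous_on_compose2[OF k] continuous_intros)
  moreover have "(\<lambda>z. \<rho> (fst z) (snd z)) \<in> borel_measurable (lebesgue_on ({0..T} \<times> {0..1}))"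
    using \<rho> by (simp add: density_profile_def case_prod_unfold)
  ultimately have joint: "(\<lambda>(s, u). (\<rho> s u)\<^sup>2 * k u) \<in> borel_measurable (lebesgue_on ({0..T} \<times> {0..1}))"
    by (simp add: case_prod_unfold)
  have "(\<lambda>s. \<integral>u. (\<rho> s u)\<^sup>2 * k u \<partial>lebesgue_on {0..1}) \<in> borel_measurable (lebesgue_on {0..T})"
    by (rule lebesgue_on_Fubini(1)[OF joint b2]) (use slice km in auto)
  then have m: "(\<lambda>s. \<integral>u. (\<rho> s u)\<^sup>2 * k u \<partial>lebesgue_on {0..1}) \<in> borel_measurable (lebesgue_on {0..t})"
    by (rule measurable_restrict_mono) (use t in auto)
  show "integrable (lebesgue_on {0..t}) (\<lambda>s. \<integral>u. (\<rho> s u)\<^sup>2 * k u \<partial>lebesgue_on {0..1})"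
  proof (rule integrable_lebesgue_on_bounded[OF m lmeasurable_interval(1)])
    fix s assume "s \<in> {0..t}"
    then have s: "s \<in> {0..T}" using t by auto
    show "\<bar>\<integral>u. (\<rho> s u)\<^sup>2 * k u \<partial>lebesgue_on {0..1}\<bar> \<le> 1 * B"
      by (rule integral_unit_bounds(2)[OF _ b2[OF s]]) (use slice[OF s] km in simp)
  qed
  fix x :: real assume x: "x \<in> {0, 1}"
  have "(\<lambda>s. \<rho> s x) \<in> borel_measurable (lebesgue_on {0..T})"
    using \<rho> x by (auto simp: density_profile_def)
  then have m: "(\<lambda>s. \<rho> s x) \<in> borel_measurable (lebesgue_on {0..t})"
    by (rule measurable_restrict_mono) (use t in auto)
  show "integrable (lebesgue_on {0..t}) (\<lambda>s. \<rho> s x)" "integrable (lebesgue_on {0..t}) (\<lambda>s. (\<rho> s x)\<^sup>2)"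
    by (rule integrable_lebesgue_on_bounded[OF _ lmeasurable_interval(1), where B=1]; use m bd x t in force)+
qed

lemma weak_form_interior_term:
  assumes G: "two_derivs G G1 G2" and T: "T > 0" and t: "t \<in> {0..T}"
  shows "(\<integral>s. L2_inner (\<rho> s) (\<lambda>u. d_time T (\<lambda>_. G) s u + \<rho> s u * laplacian (\<lambda>_. G) s u) \<partial>lebesgue_on {0..t})
    = (\<integral>s. (\<integral>u. (\<rho> s u)\<^sup>2 * G2 u \<partial>lebesgue_on {0..1}) \<partial>lebesgue_on {0..t})"
proof (rule Bochner_Integration.integral_cong[OF refl])
  fix s assume "s \<in> space (lebesgue_on {0..t})"
  then have s: "s \<in> {0..T}" using t by simp
  show "L2_inner (\<rho> s) (\<lambda>u. d_time T (\<lambda>_. G) s u + \<rho> s u * laplacian (\<lambda>_. G) s u)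
    = (\<integral>u. (\<rho> s u)\<^sup>2 * G2 u \<partial>lebesgue_on {0..1})"
    unfolding L2_inner_def
    using time_independent_test_function(2,4)[OF G T] s
    by (intro Bochner_Integration.integral_cong[OF refl]) (simp add: power2_eq_square)
qed

lemma Dirichlet_weak_form:
  assumes sol: "weak_solution_Dirichlet \<alpha> \<beta> T g \<rho>" and T: "T > 0" and t: "t \<in> {0..T}"
    and G: "two_derivs G G1 G2" "G 0 = 0" "G 1 = 0"
  shows "(\<integral>u. \<rho> t u * G u \<partial>lebesgue_on {0..1}) = L2_inner g G
    + (\<integral>s. (\<integral>u. (\<rho> s u)\<^sup>2 * G2 u \<partial>lebesgue_on {0..1}) \<partial>lebesgue_on {0..t})
    - (\<integral>s. \<beta>\<^sup>2 * G1 1 - \<alpha>\<^sup>2 * G1 0 \<partial>lebesgue_on {0..t})"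
proof -
  note test = time_independent_test_function[OF G(1) T]
  have "(\<lambda>_. G) \<in> C12_0 T" using test(1) G by (simp add: C12_0_def)
  from sol[unfolded weak_solution_Dirichlet_def, THEN conjunct2, THEN conjunct2, THEN conjunct1,
      rule_format, OF t this]
  have "L2_inner (\<rho> t) G - L2_inner g G
        - (\<integral>s. L2_inner (\<rho> s) (\<lambda>u. d_time T (\<lambda>_. G) s u + \<rho> s u * laplacian (\<lambda>_. G) s u) \<partial>lebesgue_on {0..t})
        + (\<integral>s. \<beta>\<^sup>2 * d_space (\<lambda>_. G) s 1 - \<alpha>\<^sup>2 * d_space (\<lambda>_. G) s 0 \<partial>lebesgue_on {0..t}) = 0"
    by simp
  then show ?thesis
    unfolding weak_form_interior_term[OF G(1) T t] by (simp add: test(3) L2_inner_def)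
qed

lemma Robin_weak_form:
  assumes sol: "weak_solution_Robin \<kappa> \<alpha> \<beta> T g \<rho>" and T: "T > 0" and t: "t \<in> {0..T}"
    and G: "two_derivs G G1 G2"
  shows "(\<integral>u. \<rho> t u * G u \<partial>lebesgue_on {0..1}) = L2_inner g G
    + (\<integral>s. (\<integral>u. (\<rho> s u)\<^sup>2 * G2 u \<partial>lebesgue_on {0..1}) \<partial>lebesgue_on {0..t})
    - (\<integral>s. (\<rho> s 1)\<^sup>2 * G1 1 - (\<rho> s 0)\<^sup>2 * G1 0 \<partial>lebesgue_on {0..t})
    + \<kappa> * (\<integral>s. G 0 * (\<alpha> - \<rho> s 0) + G 1 * (\<beta> - \<rho> s 1) \<partial>lebesgue_on {0..t})"
proof -
  note test = time_independent_test_function[OF G T]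
  from sol[unfolded weak_solution_Robin_def, THEN conjunct2, THEN conjunct2, rule_format, OF t test(1)]
  have "L2_inner (\<rho> t) G - L2_inner g G
        - (\<integral>s. L2_inner (\<rho> s) (\<lambda>u. d_time T (\<lambda>_. G) s u + \<rho> s u * laplacian (\<lambda>_. G) s u) \<partial>lebesgue_on {0..t})
        + (\<integral>s. (\<rho> s 1)\<^sup>2 * d_space (\<lambda>_. G) s 1 - (\<rho> s 0)\<^sup>2 * d_space (\<lambda>_. G) s 0 \<partial>lebesgue_on {0..t})
        - \<kappa> * (\<integral>s. G 0 * (\<alpha> - \<rho> s 0) + G 1 * (\<beta> - \<rho> s 1) \<partial>lebesgue_on {0..t}) = 0"
    by simp
  then show ?thesis
    unfolding weak_form_interior_term[OF G T t] by (simp add: test(3) L2_inner_def)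
qed

text \<open>The boundary integrals contain the data \<alpha>, \<beta> and not the solution, so they
  are the same for both solutions and cancel; all boundary functions and the rate can be set to
  zero.\<close>

lemma Dirichlet_density_pair:
  assumes \<rho>: "weak_solution_Dirichlet \<alpha> \<beta> T g \<rho>" and \<sigma>: "weak_solution_Dirichlet \<alpha> \<beta> T g \<sigma>" and T: "T > 0"
  shows "density_pair T 0 True \<rho> \<sigma> (\<lambda>_. 0) (\<lambda>_. 0) (\<lambda>_. 0) (\<lambda>_. 0)"
proof
  show prof: "density_profile T \<rho>" "density_profile T \<sigma>"
    using \<rho> \<sigma> by (auto simp: weak_solution_Dirichlet_def)
  fix t and G G1 G2 :: "real \<Rightarrow> real"
  assume t: "t \<in> {0..T}" and G: "two_derivs G G1 G2" and "True \<Longrightarrow> G 0 = 0 \<and> G 1 = 0"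
  then have G0: "G 0 = 0" "G 1 = 0" by auto
  note cont = two_derivs_continuous[OF G]
  note i = density_profile_integrable[OF prof(1) cont(1) t] density_profile_integrable[OF prof(2) cont(1) t]
  note j = density_profile_integrable[OF prof(1) cont(3) t] density_profile_integrable[OF prof(2) cont(3) t]
  have "(\<integral>u. (\<rho> t u - \<sigma> t u) * G u \<partial>lebesgue_on {0..1}) =
     (\<integral>s. (\<integral>u. (\<rho> s u)\<^sup>2 * G2 u \<partial>lebesgue_on {0..1}) \<partial>lebesgue_on {0..t})
     - (\<integral>s. (\<integral>u. (\<sigma> s u)\<^sup>2 * G2 u \<partial>lebesgue_on {0..1}) \<partial>lebesgue_on {0..t})"
    using i(1,6) Dirichlet_weak_form[OF \<rho> T t G G0] Dirichlet_weak_form[OF \<sigma> T t G G0]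
    by (simp add: left_diff_distrib)
  also have "\<dots> = (\<integral>s. (\<integral>u. (\<rho> s u)\<^sup>2 * G2 u \<partial>lebesgue_on {0..1}) - (\<integral>u. (\<sigma> s u)\<^sup>2 * G2 u \<partial>lebesgue_on {0..1}) \<partial>lebesgue_on {0..t})"
    using j(3,8) by simp
  also have "\<dots> = (\<integral>s. (\<integral>u. ((\<rho> s u)\<^sup>2 - (\<sigma> s u)\<^sup>2) * G2 u \<partial>lebesgue_on {0..1})
      - (0 * 0 * G1 1 - 0 * 0 * G1 0 + 0 * (G 0 * 0 + G 1 * 0)) \<partial>lebesgue_on {0..t})"
  proof (rule Bochner_Integration.integral_cong[OF refl])
    fix s assume "s \<in> space (lebesgue_on {0..t})"
    then have s: "s \<in> {0..T}" using t by simp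
    show "(\<integral>u. (\<rho> s u)\<^sup>2 * G2 u \<partial>lebesgue_on {0..1}) - (\<integral>u. (\<sigma> s u)\<^sup>2 * G2 u \<partial>lebesgue_on {0..1})
      = (\<integral>u. ((\<rho> s u)\<^sup>2 - (\<sigma> s u)\<^sup>2) * G2 u \<partial>lebesgue_on {0..1})
      - (0 * 0 * G1 1 - 0 * 0 * G1 0 + 0 * (G 0 * 0 + G 1 * 0))"
      using density_profile_integrable(2)[OF prof(1) cont(3) s] density_profile_integrable(2)[OF prof(2) cont(3) s]
      by (simp add: left_diff_distrib)
  qed
  finally show "(\<integral>u. (\<rho> t u - \<sigma> t u) * G u \<partial>lebesgue_on {0..1}) = \<dots>" .
qed (use T in auto)

text \<open>The data \<alpha>, \<beta> and \<open>g\<close> cancel in the difference, and the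
  squares at the boundary factor into sum times difference. Nonnegativity of the densities makes the
  sum dominate the difference.\<close>

lemma Robin_density_pair:
  assumes \<rho>: "weak_solution_Robin \<kappa> \<alpha> \<beta> T g \<rho>" and \<sigma>: "weak_solution_Robin \<kappa> \<alpha> \<beta> T g \<sigma>"
    and T: "T > 0" and \<kappa>: "\<kappa> \<ge> 0"
  shows "density_pair T \<kappa> False \<rho> \<sigma> (\<lambda>t. \<rho> t 0 + \<sigma> t 0) (\<lambda>t. \<rho> t 1 + \<sigma> t 1)
    (\<lambda>t. \<rho> t 0 - \<sigma> t 0) (\<lambda>t. \<rho> t 1 - \<sigma> t 1)"
proof
  show prof: "density_profile T \<rho>" "density_profile T \<sigma>"
    using \<rho> \<sigma> by (auto simp: weak_solution_Robin_def)
  have bd: "0 \<le> \<rho> t u" "\<rho> t u \<le> 1" "0 \<le> \<sigma> t u" "\<sigma> t u \<le> 1" if "t \<in> {0..T}" "u \<in> {0..1}" for t u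
    using prof that by (auto simp: density_profile_def)
  have "(\<lambda>t. \<rho> t x) \<in> borel_measurable (lebesgue_on {0..T})" "(\<lambda>t. \<sigma> t x) \<in> borel_measurable (lebesgue_on {0..T})"
    if "x \<in> {0, 1}" for x using prof that by (auto simp: density_profile_def)
  from this[of 0] this[of 1]
  show "(\<lambda>t. \<rho> t 0 + \<sigma> t 0) \<in> borel_measurable (lebesgue_on {0..T})" "(\<lambda>t. \<rho> t 1 + \<sigma> t 1) \<in> borel_measurable (lebesgue_on {0..T})"
    "(\<lambda>t. \<rho> t 0 - \<sigma> t 0) \<in> borel_measurable (lebesgue_on {0..T})" "(\<lambda>t. \<rho> t 1 - \<sigma> t 1) \<in> borel_measurable (lebesgue_on {0..T})"
    by simp_all
  fix t assume t: "t \<in> {0..T}"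
  show "\<bar>\<rho> t 0 - \<sigma> t 0\<bar> \<le> \<rho> t 0 + \<sigma> t 0" "\<bar>\<rho> t 1 - \<sigma> t 1\<bar> \<le> \<rho> t 1 + \<sigma> t 1"
    "\<rho> t 0 + \<sigma> t 0 \<le> 2" "\<rho> t 1 + \<sigma> t 1 \<le> 2"
    using bd[OF t, of 0] bd[OF t, of 1] by auto
  fix G G1 G2 :: "real \<Rightarrow> real" assume G: "two_derivs G G1 G2"
  note cont = two_derivs_continuous[OF G]
  let ?M = "lebesgue_on {0..t}"
  define Q where "Q \<rho> s = (\<integral>u. (\<rho> s u)\<^sup>2 * G2 u \<partial>lebesgue_on {0..1})" for \<rho> :: "real \<Rightarrow> real \<Rightarrow> real" and s
  define X where "X \<rho> s = (\<rho> s 1)\<^sup>2 * G1 1 - (\<rho> s 0)\<^sup>2 * G1 0" for \<rho> :: "real \<Rightarrow> real \<Rightarrow> real" and s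
  define Y where "Y \<rho> s = G 0 * (\<alpha> - \<rho> s 0) + G 1 * (\<beta> - \<rho> s 1)" for \<rho> :: "real \<Rightarrow> real \<Rightarrow> real" and s
  have const: "integrable ?M (\<lambda>_. c)" for c :: real
    using finite_measure.integrable_const[OF finite_measure_lebesgue_on[OF lmeasurable_interval(1)]] .
  have ints: "integrable ?M (Q \<tau>)" "integrable ?M (X \<tau>)" "integrable ?M (Y \<tau>)" if "density_profile T \<tau>" for \<tau>
    unfolding Q_def[abs_def] X_def[abs_def] Y_def[abs_def]
    using density_profile_integrable(3-5)[OF that cont(3) t] const
    by (auto intro!: Bochner_Integration.integrable_add Bochner_Integration.integrable_diff
        integrable_mult_right integrable_mult_left)
  have form: "(\<integral>u. \<tau> t u * G u \<partial>lebesgue_on {0..1}) = L2_inner g G + (\<integral>s. Q \<tau> s \<partial>?M) - (\<integral>s. X \<tau> s \<partial>?M) + \<kappa> * (\<integral>s. Y \<tau> s \<partial>?M)"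
    if "weak_solution_Robin \<kappa> \<alpha> \<beta> T g \<tau>" for \<tau>
    using Robin_weak_form[OF that T t G] by (simp add: Q_def X_def Y_def)
  have "(\<integral>u. (\<rho> t u - \<sigma> t u) * G u \<partial>lebesgue_on {0..1})
    = (\<integral>u. \<rho> t u * G u \<partial>lebesgue_on {0..1}) - (\<integral>u. \<sigma> t u * G u \<partial>lebesgue_on {0..1})"
    using density_profile_integrable(1)[OF prof(1) cont(1) t] density_profile_integrable(1)[OF prof(2) cont(1) t]
    by (simp add: left_diff_distrib)
  also have "\<dots> = ((\<integral>s. Q \<rho> s \<partial>?M) - (\<integral>s. Q \<sigma> s \<partial>?M)) - ((\<integral>s. X \<rho> s \<partial>?M) - (\<integral>s. X \<sigma> s \<partial>?M))
      + \<kappa> * ((\<integral>s. Y \<rho> s \<partial>?M) - (\<integral>s. Y \<sigma> s \<partial>?M))"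
    unfolding form[OF \<rho>] form[OF \<sigma>] by (simp add: algebra_simps)
  also have "\<dots> = (\<integral>s. (Q \<rho> s - Q \<sigma> s) - (X \<rho> s - X \<sigma> s) + \<kappa> * (Y \<rho> s - Y \<sigma> s) \<partial>?M)"
    using ints[OF prof(1)] ints[OF prof(2)] by simp
  also have "\<dots> = (\<integral>s. (\<integral>u. ((\<rho> s u)\<^sup>2 - (\<sigma> s u)\<^sup>2) * G2 u \<partial>lebesgue_on {0..1})
      - ((\<rho> s 1 + \<sigma> s 1) * (\<rho> s 1 - \<sigma> s 1) * G1 1 - (\<rho> s 0 + \<sigma> s 0) * (\<rho> s 0 - \<sigma> s 0) * G1 0
         + \<kappa> * (G 0 * (\<rho> s 0 - \<sigma> s 0) + G 1 * (\<rho> s 1 - \<sigma> s 1))) \<partial>?M)"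
  proof (rule Bochner_Integration.integral_cong[OF refl])
    fix s assume "s \<in> space ?M"
    then have s: "s \<in> {0..T}" using t by simp
    have Q: "(\<integral>u. ((\<rho> s u)\<^sup>2 - (\<sigma> s u)\<^sup>2) * G2 u \<partial>lebesgue_on {0..1}) = Q \<rho> s - Q \<sigma> s"
      unfolding Q_def
      using density_profile_integrable(2)[OF prof(1) cont(3) s] density_profile_integrable(2)[OF prof(2) cont(3) s]
      by (simp add: left_diff_distrib)
    show "(Q \<rho> s - Q \<sigma> s) - (X \<rho> s - X \<sigma> s) + \<kappa> * (Y \<rho> s - Y \<sigma> s)
      = (\<integral>u. ((\<rho> s u)\<^sup>2 - (\<sigma> s u)\<^sup>2) * G2 u \<partial>lebesgue_on {0..1})
      - ((\<rho> s 1 + \<sigma> s 1) * (\<rho> s 1 - \<sigma> s 1) * G1 1 - (\<rho> s 0 + \<sigma> s 0) * (\<rho> s 0 - \<sigma> s 0) * G1 0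
         + \<kappa> * (G 0 * (\<rho> s 0 - \<sigma> s 0) + G 1 * (\<rho> s 1 - \<sigma> s 1)))"
      unfolding Q by (simp add: X_def Y_def power2_eq_square algebra_simps)
  qed
  finally show "(\<integral>u. (\<rho> t u - \<sigma> t u) * G u \<partial>lebesgue_on {0..1}) = \<dots>" .
qed (use T \<kappa> in auto)

theorem lemma2p6:
  fixes \<alpha> \<beta> T \<kappa> :: real and g :: "real \<Rightarrow> real"
  assumes "\<alpha> \<in> {0<..<1}" and "\<beta> \<in> {0<..<1}" and "T > 0" and "\<kappa> \<ge> 0"
    and "g \<in> borel_measurable (lebesgue_on {0..1})"
    and "\<forall>u\<in>{0..1}. g u \<in> {0..1}"
  shows "(\<forall>\<rho>\<^sub>1 \<rho>\<^sub>2. weak_solution_Dirichlet \<alpha> \<beta> T g \<rho>\<^sub>1 \<longrightarrow> weak_solution_Dirichlet \<alpha> \<beta> T g \<rho>\<^sub>2 \<longrightarrow>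
           (AE (t, u) in lebesgue_on ({0..T} \<times> {0..1}). \<rho>\<^sub>1 t u = \<rho>\<^sub>2 t u)) \<and>
         (\<forall>\<rho>\<^sub>1 \<rho>\<^sub>2. weak_solution_Robin \<kappa> \<alpha> \<beta> T g \<rho>\<^sub>1 \<longrightarrow> weak_solution_Robin \<kappa> \<alpha> \<beta> T g \<rho>\<^sub>2 \<longrightarrow>
           (AE (t, u) in lebesgue_on ({0..T} \<times> {0..1}). \<rho>\<^sub>1 t u = \<rho>\<^sub>2 t u))"
  using density_pair.densities_eq_AE[OF Dirichlet_density_pair[OF _ _ \<open>T > 0\<close>]]
    density_pair.densities_eq_AE[OF Robin_density_pair[OF _ _ \<open>T > 0\<close> \<open>\<kappa> \<ge> 0\<close>]]
  by blast

end
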